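(* Let $f : B \to A$ be a Kan fibration between Kan complexes in the category of simplicial sets. Then the M-type $M(f)$, i.e. the final coalgebra of the polynomial functor $P_f$ on simplicial sets, is a Kan complex.
   Context: For a map $f : B \to A$ in a locally cartesian closed category $\mathcal{E}$, the polynomial functor $P_f : \mathcal{E} \to \mathcal{E}$ is the composite $\mathcal{E} \xrightarrow{-\times B} \mathcal{E}/B \xrightarrow{\Pi_f} \mathcal{E}/A \xrightarrow{\Sigma_A} \mathcal{E}$, where $\Pi_f$ is right adjoint to pullback along $f$ and $\Sigma_A$ is the forgetful functor (left adjoint to taking the product with $A$). A coalgebra for an endofunctor $F$ is an object $X$ with a map $X\to FX$; a morphism of coalgebras $(X,\alpha)\to(Y,\beta)$ is a map $k : X\to Y$ with $\beta k = F(k)\alpha$. The M-type $M(f)$ is the terminal object in the category of $P_f$-coalgebras; it exists in every category of presheaves, in particular in simplicial sets. *)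

theory Defs
  imports "HOL-Library.FuncSet"
begin

section \<open>Simplicial sets\<close>

text \<open>Morphisms \<open>[m] \<rightarrow> [n]\<close> of the simplex category, as extensional functions, so that each
  monotone map has exactly one representative.\<close>

definition Delta :: "nat \<Rightarrow> nat \<Rightarrow> (nat \<Rightarrow> nat) set" where
  "Delta m n = {\<theta> \<in> {..m} \<rightarrow>\<^sub>E {..n}. mono_on {..m} \<theta>}"

text \<open>\<open>act X m n \<theta>\<close> is the operator \<open>X\<^sub>n \<rightarrow> X\<^sub>m\<close> given by \<open>\<theta> : [m] \<rightarrow> [n]\<close>. The sets
  \<open>simplices X n\<close> for different \<open>n\<close> need not be disjoint.\<close>

record 'x sset =
  simplices :: "nat \<Rightarrow> 'x set"
  act :: "nat \<Rightarrow> nat \<Rightarrow> (nat \<Rightarrow> nat) \<Rightarrow> 'x \<Rightarrow> 'x"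

definition simplicial_set :: "'x sset \<Rightarrow> bool" where
  "simplicial_set X \<longleftrightarrow>
     (\<forall>m n. \<forall>\<theta>\<in>Delta m n. \<forall>x\<in>simplices X n. act X m n \<theta> x \<in> simplices X m) \<and>
     (\<forall>n. \<forall>x\<in>simplices X n. act X n n (restrict id {..n}) x = x) \<and>
     (\<forall>k m n. \<forall>\<phi>\<in>Delta k m. \<forall>\<theta>\<in>Delta m n. \<forall>x\<in>simplices X n.
        act X k n (compose {..k} \<theta> \<phi>) x = act X k m \<phi> (act X m n \<theta> x))"

text \<open>Components of maps are extensional, so equality of maps is equality on simplices.\<close>

type_synonym ('x, 'y) smap = "nat \<Rightarrow> 'x \<Rightarrow> 'y"

definition hom :: "'x sset \<Rightarrow> 'y sset \<Rightarrow> ('x, 'y) smap set" where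
  "hom X Y = {k. (\<forall>n. k n \<in> simplices X n \<rightarrow>\<^sub>E simplices Y n) \<and>
     (\<forall>m n. \<forall>\<theta>\<in>Delta m n. \<forall>x\<in>simplices X n. k m (act X m n \<theta> x) = act Y m n \<theta> (k n x))}"

definition smap_comp :: "'x sset \<Rightarrow> ('y, 'z) smap \<Rightarrow> ('x, 'y) smap \<Rightarrow> ('x, 'z) smap" where
  "smap_comp X g h = (\<lambda>n. compose (simplices X n) (g n) (h n))"

definition smap_restrict :: "('x, 'y) smap \<Rightarrow> 'x sset \<Rightarrow> ('x, 'y) smap" where
  "smap_restrict k X = (\<lambda>n. restrict (k n) (simplices X n))"

definition std_simplex :: "nat \<Rightarrow> (nat \<Rightarrow> nat) sset" where
  "std_simplex n = \<lparr>simplices = (\<lambda>m. Delta m n), act = (\<lambda>k m \<phi> \<theta>. compose {..k} \<theta> \<phi>)\<rparr>"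

text \<open>The map \<open>\<Delta>[n] \<rightarrow> X\<close> classifying an \<open>n\<close>-simplex \<open>x\<close> of \<open>X\<close>.\<close>

definition classify :: "'x sset \<Rightarrow> nat \<Rightarrow> 'x \<Rightarrow> (nat \<Rightarrow> nat, 'x) smap" where
  "classify X n x = (\<lambda>m. \<lambda>\<theta>\<in>Delta m n. act X m n \<theta> x)"


section \<open>Kan fibrations\<close>

text \<open>A simplex of \<open>\<Delta>[n]\<close> lies in the horn iff its image omits a vertex other than \<open>k\<close>, i.e.
  iff it lies in a face other than the \<open>k\<close>-th.\<close>

definition horn :: "nat \<Rightarrow> nat \<Rightarrow> (nat \<Rightarrow> nat) sset" where
  "horn n k = (std_simplex n)
     \<lparr>simplices := (\<lambda>m. {\<theta> \<in> Delta m n. \<exists>j\<in>{..n} - {k}. j \<notin> \<theta> ` {..m}})\<rparr>"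

definition kan_fibration :: "'x sset \<Rightarrow> 'y sset \<Rightarrow> ('x, 'y) smap \<Rightarrow> bool" where
  "kan_fibration X Y p \<longleftrightarrow> simplicial_set X \<and> simplicial_set Y \<and> p \<in> hom X Y \<and>
     (\<forall>n\<ge>1. \<forall>k\<le>n. \<forall>u\<in>hom (horn n k) X. \<forall>v\<in>hom (std_simplex n) Y.
        smap_comp (horn n k) p u = smap_restrict v (horn n k) \<longrightarrow>
        (\<exists>w\<in>hom (std_simplex n) X.
           smap_restrict w (horn n k) = u \<and> smap_comp (std_simplex n) p w = v))"

definition kan_complex :: "'x sset \<Rightarrow> bool" where
  "kan_complex X \<longleftrightarrow> simplicial_set X \<and>
     (\<forall>n\<ge>1. \<forall>k\<le>n. \<forall>u\<in>hom (horn n k) X.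
        \<exists>w\<in>hom (std_simplex n) X. smap_restrict w (horn n k) = u)"


section \<open>Polynomial functors\<close>

text \<open>An object of the slice over \<open>B\<close> is a simplicial set together with a map to \<open>B\<close>.\<close>

definition slice_hom :: "'x sset \<Rightarrow> ('x, 'b) smap \<Rightarrow> 'y sset \<Rightarrow> ('y, 'b) smap \<Rightarrow> ('x, 'y) smap set" where
  "slice_hom X p Y q = {k \<in> hom X Y. smap_comp X q k = p}"

definition sprod :: "'x sset \<Rightarrow> 'b sset \<Rightarrow> ('x \<times> 'b) sset" where
  "sprod X B = \<lparr>simplices = (\<lambda>n. simplices X n \<times> simplices B n),
     act = (\<lambda>m n \<theta>. map_prod (act X m n \<theta>) (act B m n \<theta>))\<rparr>"

text \<open>The second projection of a product or of a pullback.\<close>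

definition proj2 :: "('x \<times> 'b) sset \<Rightarrow> ('x \<times> 'b, 'b) smap" where
  "proj2 Z = (\<lambda>n. restrict snd (simplices Z n))"

definition sprod_map :: "'x sset \<Rightarrow> 'b sset \<Rightarrow> ('x, 'y) smap \<Rightarrow> ('x \<times> 'b, 'y \<times> 'b) smap" where
  "sprod_map X B k = (\<lambda>n. \<lambda>(x, b)\<in>simplices X n \<times> simplices B n. (k n x, b))"

text \<open>The pullback of \<open>g : X \<rightarrow> A\<close> along \<open>f : B \<rightarrow> A\<close>, an object over \<open>B\<close> by \<open>proj2\<close>.\<close>

definition pullback :: "'b sset \<Rightarrow> ('b, 'a) smap \<Rightarrow> 'x sset \<Rightarrow> ('x, 'a) smap \<Rightarrow> ('x \<times> 'b) sset" where
  "pullback B f X g = (sprod X B)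
     \<lparr>simplices := (\<lambda>n. {(x, b) \<in> simplices X n \<times> simplices B n. g n x = f n b})\<rparr>"

definition pullback_map :: "'b sset \<Rightarrow> ('b, 'a) smap \<Rightarrow> 'x sset \<Rightarrow> ('x, 'a) smap \<Rightarrow> ('x, 'y) smap
    \<Rightarrow> ('x \<times> 'b, 'y \<times> 'b) smap" where
  "pullback_map B f X g k = smap_restrict (sprod_map X B k) (pullback B f X g)"

text \<open>The pullback along \<open>f\<close> of the simplex \<open>\<Delta>[n] \<rightarrow> A\<close> classifying \<open>a\<close>.\<close>

definition fibre :: "'b sset \<Rightarrow> 'a sset \<Rightarrow> ('b, 'a) smap \<Rightarrow> nat \<Rightarrow> 'a \<Rightarrow> ((nat \<Rightarrow> nat) \<times> 'b) sset" where
  "fibre B A f n a = pullback B f (std_simplex n) (classify A n a)"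

text \<open>The right adjoint \<open>\<Pi>\<^sub>f\<close> to pullback along \<open>f\<close>, applied to \<open>p : Y \<rightarrow> B\<close>. By the Yoneda lemma
  the adjunction forces its \<open>n\<close>-simplices over \<open>a \<in> A\<^sub>n\<close> to be the maps over \<open>B\<close> from
  \<open>fibre B A f n a\<close> to \<open>Y\<close>. Theorems \<open>dprod_adjunction\<close> and \<open>dprod_map_adjunction\<close> below
  verify the universal property.\<close>

type_synonym ('a, 'b, 'y) dprod_simplex = "'a \<times> ((nat \<Rightarrow> nat) \<times> 'b, 'y) smap"

definition dprod :: "'b sset \<Rightarrow> 'a sset \<Rightarrow> ('b, 'a) smap \<Rightarrow> 'y sset \<Rightarrow> ('y, 'b) smap
    \<Rightarrow> ('a, 'b, 'y) dprod_simplex sset" where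
  "dprod B A f Y p = \<lparr>
     simplices = (\<lambda>n. {(a, s). a \<in> simplices A n \<and>
        s \<in> slice_hom (fibre B A f n a) (proj2 (fibre B A f n a)) Y p}),
     act = (\<lambda>m n \<phi> (a, s). (act A m n \<phi> a,
        \<lambda>k. \<lambda>(\<theta>, b)\<in>simplices (fibre B A f m (act A m n \<phi> a)) k. s k (compose {..k} \<phi> \<theta>, b)))\<rparr>"

definition dprod_proj :: "'b sset \<Rightarrow> 'a sset \<Rightarrow> ('b, 'a) smap \<Rightarrow> 'y sset \<Rightarrow> ('y, 'b) smap
    \<Rightarrow> (('a, 'b, 'y) dprod_simplex, 'a) smap" where
  "dprod_proj B A f Y p = (\<lambda>n. restrict fst (simplices (dprod B A f Y p) n))"

text \<open>The action of \<open>\<Pi>\<^sub>f\<close> on a map \<open>h\<close> over \<open>B\<close> with domain \<open>p : Y \<rightarrow> B\<close>.\<close>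

definition dprod_map :: "'b sset \<Rightarrow> 'a sset \<Rightarrow> ('b, 'a) smap \<Rightarrow> 'y sset \<Rightarrow> ('y, 'b) smap \<Rightarrow> ('y, 'z) smap
    \<Rightarrow> (('a, 'b, 'y) dprod_simplex, ('a, 'b, 'z) dprod_simplex) smap" where
  "dprod_map B A f Y p h = (\<lambda>n. \<lambda>(a, s)\<in>simplices (dprod B A f Y p) n.
     (a, smap_comp (fibre B A f n a) h s))"

text \<open>The composite of \<open>X \<mapsto> (X \<times> B \<rightarrow> B)\<close>, \<open>\<Pi>\<^sub>f\<close> and \<open>\<Sigma>\<^sub>A\<close>; the last just forgets \<open>dprod_proj\<close>.\<close>

definition poly :: "'b sset \<Rightarrow> 'a sset \<Rightarrow> ('b, 'a) smap \<Rightarrow> 'x sset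
    \<Rightarrow> ('a, 'b, 'x \<times> 'b) dprod_simplex sset" where
  "poly B A f X = dprod B A f (sprod X B) (proj2 (sprod X B))"

definition poly_map :: "'b sset \<Rightarrow> 'a sset \<Rightarrow> ('b, 'a) smap \<Rightarrow> 'x sset \<Rightarrow> ('x, 'y) smap
    \<Rightarrow> (('a, 'b, 'x \<times> 'b) dprod_simplex, ('a, 'b, 'y \<times> 'b) dprod_simplex) smap" where
  "poly_map B A f X k = dprod_map B A f (sprod X B) (proj2 (sprod X B)) (sprod_map X B k)"


section \<open>Coalgebras and M-types\<close>

definition coalgebra :: "'b sset \<Rightarrow> 'a sset \<Rightarrow> ('b, 'a) smap \<Rightarrow> 'x sset
    \<Rightarrow> ('x, ('a, 'b, 'x \<times> 'b) dprod_simplex) smap \<Rightarrow> bool" where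
  "coalgebra B A f X \<alpha> \<longleftrightarrow> simplicial_set X \<and> \<alpha> \<in> hom X (poly B A f X)"

definition coalgebra_hom :: "'b sset \<Rightarrow> 'a sset \<Rightarrow> ('b, 'a) smap
    \<Rightarrow> 'x sset \<Rightarrow> ('x, ('a, 'b, 'x \<times> 'b) dprod_simplex) smap
    \<Rightarrow> 'y sset \<Rightarrow> ('y, ('a, 'b, 'y \<times> 'b) dprod_simplex) smap \<Rightarrow> ('x, 'y) smap set" where
  "coalgebra_hom B A f X \<alpha> Y \<beta> =
     {k \<in> hom X Y. smap_comp X \<beta> k = smap_comp X (poly_map B A f X k) \<alpha>}"

text \<open>Finality among the coalgebras whose simplices are drawn from the type \<open>'c\<close>.\<close>

definition final_coalgebra :: "'c itself \<Rightarrow> 'b sset \<Rightarrow> 'a sset \<Rightarrow> ('b, 'a) smap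
    \<Rightarrow> 'm sset \<Rightarrow> ('m, ('a, 'b, 'm \<times> 'b) dprod_simplex) smap \<Rightarrow> bool" where
  "final_coalgebra _ B A f M \<mu> \<longleftrightarrow> coalgebra B A f M \<mu> \<and>
     (\<forall>(X :: 'c sset) \<alpha>. coalgebra B A f X \<alpha> \<longrightarrow> (\<exists>!k. k \<in> coalgebra_hom B A f X \<alpha> M \<mu>))"

text \<open>The M-type is final among coalgebras over all types, but a formula cannot quantify over types.
  It is enough to test finality against two types: that of \<open>M\<close> itself, and the type \<open>mtree\<close>
  of \<open>'a\<close>-labelled trees, which is large enough to carry a final coalgebra
  (theorem \<open>tree_coalgebra_final\<close>). Theorem \<open>M_type_final\<close> shows that \<open>M_type\<close>
  implies finality over every type.\<close>

type_synonym ('a, 'b) mtree = "(nat \<times> (nat \<Rightarrow> nat) \<times> 'b) list \<Rightarrow> 'a option"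

definition M_type :: "'b sset \<Rightarrow> 'a sset \<Rightarrow> ('b, 'a) smap
    \<Rightarrow> 'm sset \<Rightarrow> ('m, ('a, 'b, 'm \<times> 'b) dprod_simplex) smap \<Rightarrow> bool" where
  "M_type B A f M \<mu> \<longleftrightarrow>
     final_coalgebra TYPE('m) B A f M \<mu> \<and> final_coalgebra TYPE(('a, 'b) mtree) B A f M \<mu>"


section \<open>Basic facts about simplicial sets\<close>

lemma Delta_id: "restrict id {..n} \<in> Delta n n"
  by (auto simp: Delta_def mono_on_def)

lemma Delta_comp: "\<lbrakk>\<theta> \<in> Delta m n; \<phi> \<in> Delta k m\<rbrakk> \<Longrightarrow> compose {..k} \<theta> \<phi> \<in> Delta k n"
  by (fastforce simp: Delta_def mono_on_def compose_def PiE_iff)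

lemma Delta_assoc:
  assumes "\<psi> \<in> Delta j k"
  shows "compose {..j} (compose {..k} \<theta> \<phi>) \<psi> = compose {..j} \<theta> (compose {..j} \<phi> \<psi>)"
  using assms by (intro ext) (auto simp: Delta_def compose_def PiE_iff)

lemma Delta_id_left: "\<phi> \<in> Delta k m \<Longrightarrow> compose {..k} (restrict id {..m}) \<phi> = \<phi>"
  by (intro ext) (auto simp: Delta_def compose_def PiE_iff extensional_def)

lemma Delta_id_right: "\<phi> \<in> Delta k m \<Longrightarrow> compose {..k} \<phi> (restrict id {..k}) = \<phi>"
  by (intro ext) (auto simp: Delta_def compose_def PiE_iff extensional_def)

lemma act_closed: "\<lbrakk>simplicial_set X; \<theta> \<in> Delta m n; x \<in> simplices X n\<rbrakk> \<Longrightarrow> act X m n \<theta> x \<in> simplices X m"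
  unfolding simplicial_set_def by blast

lemma act_id: "\<lbrakk>simplicial_set X; x \<in> simplices X n\<rbrakk> \<Longrightarrow> act X n n (restrict id {..n}) x = x"
  unfolding simplicial_set_def by blast

lemma act_comp: "\<lbrakk>simplicial_set X; \<phi> \<in> Delta k m; \<theta> \<in> Delta m n; x \<in> simplices X n\<rbrakk> \<Longrightarrow>
    act X k n (compose {..k} \<theta> \<phi>) x = act X k m \<phi> (act X m n \<theta> x)"
  unfolding simplicial_set_def by blast

lemma hom_closed: "\<lbrakk>k \<in> hom X Y; x \<in> simplices X n\<rbrakk> \<Longrightarrow> k n x \<in> simplices Y n"
  unfolding hom_def by (auto simp: PiE_iff)

lemma hom_nat: "\<lbrakk>k \<in> hom X Y; \<theta> \<in> Delta m n; x \<in> simplices X n\<rbrakk> \<Longrightarrow>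
    k m (act X m n \<theta> x) = act Y m n \<theta> (k n x)"
  unfolding hom_def by blast

lemma hom_ext: "k \<in> hom X Y \<Longrightarrow> k n \<in> extensional (simplices X n)"
  unfolding hom_def by (auto simp: PiE_iff)

lemma homI:
  assumes "\<And>n. k n \<in> extensional (simplices X n)"
    and "\<And>n x. x \<in> simplices X n \<Longrightarrow> k n x \<in> simplices Y n"
    and "\<And>m n \<theta> x. \<lbrakk>\<theta> \<in> Delta m n; x \<in> simplices X n\<rbrakk> \<Longrightarrow> k m (act X m n \<theta> x) = act Y m n \<theta> (k n x)"
  shows "k \<in> hom X Y"
  using assms unfolding hom_def by (auto simp: PiE_iff)

lemma smap_eqI:
  assumes "\<And>n. k n \<in> extensional (simplices X n)" "\<And>n. l n \<in> extensional (simplices X n)"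
    and "\<And>n x. x \<in> simplices X n \<Longrightarrow> k n x = l n x"
  shows "k = l"
  using assms by (intro ext extensionalityI[where A = "simplices X _"]) (metis extensional_arb)

lemma smap_comp_apply: "x \<in> simplices X n \<Longrightarrow> smap_comp X g h n x = g n (h n x)"
  by (simp add: smap_comp_def compose_def)

lemma smap_comp_ext: "smap_comp X g h n \<in> extensional (simplices X n)"
  by (simp add: smap_comp_def)

lemma smap_comp_hom: "\<lbrakk>simplicial_set X; h \<in> hom X Y; g \<in> hom Y Z\<rbrakk> \<Longrightarrow> smap_comp X g h \<in> hom X Z"
  by (intro homI) (simp_all add: smap_comp_apply smap_comp_ext act_closed hom_closed hom_nat)

lemma slice_hom_iff:
  assumes "p \<in> hom X B"
  shows "k \<in> slice_hom X p Y q \<longleftrightarrow> k \<in> hom X Y \<and> (\<forall>n. \<forall>x\<in>simplices X n. q n (k n x) = p n x)"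
proof -
  have "smap_comp X q k = p \<longleftrightarrow> (\<forall>n. \<forall>x\<in>simplices X n. q n (k n x) = p n x)"
    by (metis (no_types, lifting) smap_comp_apply smap_comp_ext hom_ext[OF assms] smap_eqI)
  then show ?thesis by (simp add: slice_hom_def)
qed

lemma sprod_simps [simp]:
  "simplices (sprod X B) n = simplices X n \<times> simplices B n"
  "act (sprod X B) m n \<theta> (x, b) = (act X m n \<theta> x, act B m n \<theta> b)"
  by (simp_all add: sprod_def)

lemma sprod_sset: "\<lbrakk>simplicial_set X; simplicial_set B\<rbrakk> \<Longrightarrow> simplicial_set (sprod X B)"
  unfolding simplicial_set_def by auto

lemma pullback_simps [simp]:
  "(x, b) \<in> simplices (pullback B f X g) n \<longleftrightarrow> x \<in> simplices X n \<and> b \<in> simplices B n \<and> g n x = f n b"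
  "act (pullback B f X g) m n \<theta> (x, b) = (act X m n \<theta> x, act B m n \<theta> b)"
  by (simp_all add: pullback_def sprod_def)

lemma pullback_sset:
  assumes "simplicial_set X" "simplicial_set B" "g \<in> hom X A" "f \<in> hom B A"
  shows "simplicial_set (pullback B f X g)"
  unfolding simplicial_set_def
  using assms by (auto simp: act_closed act_id act_comp hom_nat)

lemma proj2_hom_sprod: "proj2 (sprod X B) \<in> hom (sprod X B) B"
  if "simplicial_set X" "simplicial_set B"
  using that by (intro homI) (auto simp: proj2_def act_closed)

lemma proj2_hom_pullback:
  assumes "simplicial_set X" "simplicial_set B" "g \<in> hom X A" "f \<in> hom B A"
  shows "proj2 (pullback B f X g) \<in> hom (pullback B f X g) B"
  using assms
  by (intro homI) (auto simp: proj2_def act_closed hom_nat)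

lemma proj2_apply [simp]: "(x, b) \<in> simplices Z n \<Longrightarrow> proj2 Z n (x, b) = b"
  by (simp add: proj2_def)

lemma sprod_map_hom:
  assumes "simplicial_set X" "simplicial_set B" "k \<in> hom X Y"
  shows "sprod_map X B k \<in> slice_hom (sprod X B) (proj2 (sprod X B)) (sprod Y B) (proj2 (sprod Y B))"
  using assms unfolding slice_hom_iff[OF proj2_hom_sprod[OF assms(1,2)]]
  by (auto intro!: homI simp: sprod_map_def act_closed hom_closed hom_nat)

lemma std_simplex_simps [simp]:
  "simplices (std_simplex n) m = Delta m n"
  "act (std_simplex n) k m \<phi> \<theta> = compose {..k} \<theta> \<phi>"
  by (simp_all add: std_simplex_def)

lemma std_simplex_sset: "simplicial_set (std_simplex n)"
  unfolding simplicial_set_def by (auto simp: Delta_comp Delta_assoc Delta_id_right)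

lemma horn_simps:
  "\<theta> \<in> simplices (horn n k) m \<longleftrightarrow> \<theta> \<in> Delta m n \<and> (\<exists>j\<in>{..n} - {k}. j \<notin> \<theta> ` {..m})"
  "act (horn n k) = act (std_simplex n)"
  unfolding horn_def by simp_all

lemma horn_sset: "simplicial_set (horn n k)"
proof -
  have j: "j \<notin> compose {..m} \<theta> \<phi> ` {..m}" if "\<phi> \<in> Delta m l" "j \<notin> \<theta> ` {..l}"
    for j m l and \<theta> \<phi> :: "nat \<Rightarrow> nat"
    using that by (auto simp: compose_def Delta_def PiE_iff)
  have closed: "compose {..m} \<theta> \<phi> \<in> simplices (horn n k) m"
    if \<phi>: "\<phi> \<in> Delta m l" and \<theta>: "\<theta> \<in> simplices (horn n k) l" for m l \<theta> \<phi>
  proof -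
    obtain i where "i \<in> {..n} - {k}" "i \<notin> \<theta> ` {..l}" "\<theta> \<in> Delta l n"
      using \<theta> unfolding horn_simps by blast
    then show ?thesis
      unfolding horn_simps using j[OF \<phi>] Delta_comp[OF _ \<phi>] by blast
  qed
  have "\<theta> \<in> Delta l n" if "\<theta> \<in> simplices (horn n k) l" for l \<theta>
    using that unfolding horn_simps by blast
  then show ?thesis
    unfolding simplicial_set_def horn_simps(2) std_simplex_simps
    using closed by (simp add: Delta_assoc Delta_id_right[where m = n])
qed

lemma classify_hom: "\<lbrakk>simplicial_set X; x \<in> simplices X n\<rbrakk> \<Longrightarrow> classify X n x \<in> hom (std_simplex n) X"
  by (intro homI) (auto simp: classify_def act_closed act_comp Delta_comp)


section \<open>The adjunction between pullback and dependent product\<close>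

lemma fibre_simps [simp]:
  "(\<theta>, b) \<in> simplices (fibre B A f n a) k \<longleftrightarrow>
     \<theta> \<in> Delta k n \<and> b \<in> simplices B k \<and> act A k n \<theta> a = f k b"
  "act (fibre B A f n a) m k \<psi> (\<theta>, b) = (compose {..m} \<theta> \<psi>, act B m k \<psi> b)"
  by (auto simp: fibre_def classify_def)

definition dprod_counit :: "'b sset \<Rightarrow> 'a sset \<Rightarrow> ('b, 'a) smap \<Rightarrow> 'y sset \<Rightarrow> ('y, 'b) smap
    \<Rightarrow> (('a, 'b, 'y) dprod_simplex \<times> 'b, 'y) smap" where
  "dprod_counit B A f Y p = (\<lambda>n. \<lambda>((a, s), b)\<in>simplices (pullback B f (dprod B A f Y p) (dprod_proj B A f Y p)) n.
     s n (restrict id {..n}, b))"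

context
  fixes B :: "'b sset" and A :: "'a sset" and f :: "('b, 'a) smap"
  assumes B: "simplicial_set B" and A: "simplicial_set A" and f: "f \<in> hom B A"
begin

lemma fibre_sset: "a \<in> simplices A n \<Longrightarrow> simplicial_set (fibre B A f n a)"
  unfolding fibre_def using pullback_sset[OF std_simplex_sset B classify_hom[OF A] f] .

lemma fibre_proj: "a \<in> simplices A n \<Longrightarrow> proj2 (fibre B A f n a) \<in> hom (fibre B A f n a) B"
  unfolding fibre_def using proj2_hom_pullback[OF std_simplex_sset B classify_hom[OF A] f] .

lemma dprod_mem:
  "(a, s) \<in> simplices (dprod B A f Y p) n \<longleftrightarrow> a \<in> simplices A n \<and>
     (\<forall>k. s k \<in> extensional (simplices (fibre B A f n a) k)) \<and>
     (\<forall>k \<theta> b. (\<theta>, b) \<in> simplices (fibre B A f n a) k \<longrightarrow>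
        s k (\<theta>, b) \<in> simplices Y k \<and> p k (s k (\<theta>, b)) = b) \<and>
     (\<forall>m k \<psi> \<theta> b. \<psi> \<in> Delta m k \<and> (\<theta>, b) \<in> simplices (fibre B A f n a) k \<longrightarrow>
        s m (compose {..m} \<theta> \<psi>, act B m k \<psi> b) = act Y m k \<psi> (s k (\<theta>, b)))"
  (is "_ \<longleftrightarrow> ?a \<and> ?E \<and> ?P \<and> ?N")
proof (cases "a \<in> simplices A n")
  case True
  have "(a, s) \<in> simplices (dprod B A f Y p) n \<longleftrightarrow>
      s \<in> hom (fibre B A f n a) Y \<and>
      (\<forall>k. \<forall>x\<in>simplices (fibre B A f n a) k. p k (s k x) = proj2 (fibre B A f n a) k x)"
    using True by (simp add: dprod_def slice_hom_iff[OF fibre_proj])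
  also have "\<dots> \<longleftrightarrow> ?E \<and> ?P \<and> ?N"
    unfolding hom_def PiE_iff by (auto simp: Ball_def)
  finally show ?thesis using True by blast
next
  case False
  then show ?thesis by (simp add: dprod_def)
qed

lemma dprod_act:
  "act (dprod B A f Y p) m n \<phi> (a, s) = (act A m n \<phi> a,
     \<lambda>k. \<lambda>(\<theta>, b)\<in>simplices (fibre B A f m (act A m n \<phi> a)) k. s k (compose {..k} \<phi> \<theta>, b))"
  by (simp add: dprod_def)

lemma fibre_shift:
  assumes "a \<in> simplices A n" "\<phi> \<in> Delta m n"
    "(\<theta>, b) \<in> simplices (fibre B A f m (act A m n \<phi> a)) k"
  shows "(compose {..k} \<phi> \<theta>, b) \<in> simplices (fibre B A f n a) k"
  using assms by (auto simp: Delta_comp act_comp[OF A])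

lemma fibre_act:
  assumes "a \<in> simplices A n" "\<psi> \<in> Delta m k" "(\<theta>, b) \<in> simplices (fibre B A f n a) k"
  shows "(compose {..m} \<theta> \<psi>, act B m k \<psi> b) \<in> simplices (fibre B A f n a) m"
  using act_closed[OF fibre_sset[OF assms(1)] assms(2,3)] by simp

lemma dprod_sset:
  assumes Y: "simplicial_set Y"
  shows "simplicial_set (dprod B A f Y p)"
  unfolding simplicial_set_def
proof (intro conjI allI ballI)
  fix m n \<phi> x assume \<phi>: "\<phi> \<in> Delta m n" and x: "x \<in> simplices (dprod B A f Y p) n"
  obtain a s where xas: "x = (a, s)" by fastforce
  note s = x[unfolded xas dprod_mem]
  have a: "a \<in> simplices A n" using s by blast
  have a': "act A m n \<phi> a \<in> simplices A m" by (rule act_closed[OF A \<phi> a])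
  show "act (dprod B A f Y p) m n \<phi> x \<in> simplices (dprod B A f Y p) m"
    unfolding xas dprod_act dprod_mem
  proof (intro conjI allI impI a')
    fix k show "(\<lambda>(\<theta>, b)\<in>simplices (fibre B A f m (act A m n \<phi> a)) k. s k (compose {..k} \<phi> \<theta>, b))
      \<in> extensional (simplices (fibre B A f m (act A m n \<phi> a)) k)" by simp
  next
    fix k \<theta> b assume *: "(\<theta>, b) \<in> simplices (fibre B A f m (act A m n \<phi> a)) k"
    note ** = fibre_shift[OF a \<phi> *]
    show "(\<lambda>(\<theta>, b)\<in>simplices (fibre B A f m (act A m n \<phi> a)) k. s k (compose {..k} \<phi> \<theta>, b)) (\<theta>, b) \<in> simplices Y k"
      using * ** s by (simp del: fibre_simps)
    show "p k ((\<lambda>(\<theta>, b)\<in>simplices (fibre B A f m (act A m n \<phi> a)) k. s k (compose {..k} \<phi> \<theta>, b)) (\<theta>, b)) = b"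
      using * ** s by (simp del: fibre_simps)
  next
    fix l k \<psi> \<theta> b assume *: "\<psi> \<in> Delta l k \<and> (\<theta>, b) \<in> simplices (fibre B A f m (act A m n \<phi> a)) k"
    then have ** : "(compose {..k} \<phi> \<theta>, b) \<in> simplices (fibre B A f n a) k" using fibre_shift[OF a \<phi>] by blast
    have "s l (compose {..l} (compose {..k} \<phi> \<theta>) \<psi>, act B l k \<psi> b) = act Y l k \<psi> (s k (compose {..k} \<phi> \<theta>, b))"
      using s * ** by blast
    moreover have "(compose {..l} \<theta> \<psi>, act B l k \<psi> b) \<in> simplices (fibre B A f m (act A m n \<phi> a)) l"
      using fibre_act[OF a'] * by blast
    ultimately show "(\<lambda>(\<theta>, b)\<in>simplices (fibre B A f m (act A m n \<phi> a)) l. s l (compose {..l} \<phi> \<theta>, b)) (compose {..l} \<theta> \<psi>, act B l k \<psi> b)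
       = act Y l k \<psi> ((\<lambda>(\<theta>, b)\<in>simplices (fibre B A f m (act A m n \<phi> a)) k. s k (compose {..k} \<phi> \<theta>, b)) (\<theta>, b))"
      using * by (simp add: Delta_assoc del: fibre_simps)
  qed
next
  fix n x assume x: "x \<in> simplices (dprod B A f Y p) n"
  obtain a s where xas: "x = (a, s)" by fastforce
  note s = x[unfolded xas dprod_mem]
  have a: "act A n n (restrict id {..n}) a = a" using s act_id[OF A] by blast
  have "(\<lambda>k. \<lambda>(\<theta>, b)\<in>simplices (fibre B A f n a) k. s k (compose {..k} (restrict id {..n}) \<theta>, b)) = s"
    using s by (intro smap_eqI[where X = "fibre B A f n a"]) (auto simp: Delta_id_left)
  then show "act (dprod B A f Y p) n n (restrict id {..n}) x = x"
    unfolding xas dprod_act a by simp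
next
  fix k m n \<phi> \<theta> x assume \<phi>: "\<phi> \<in> Delta k m" and \<theta>: "\<theta> \<in> Delta m n"
    and x: "x \<in> simplices (dprod B A f Y p) n"
  obtain a s where xas: "x = (a, s)" by fastforce
  note s = x[unfolded xas dprod_mem]
  have a: "a \<in> simplices A n" using s by blast
  note a' = act_comp[OF A \<phi> \<theta> a]
  have a'': "act A m n \<theta> a \<in> simplices A m" by (rule act_closed[OF A \<theta> a])
  show "act (dprod B A f Y p) k n (compose {..k} \<theta> \<phi>) x =
      act (dprod B A f Y p) k m \<phi> (act (dprod B A f Y p) m n \<theta> x)"
    unfolding xas dprod_act a' prod.inject
    by (intro conjI refl smap_eqI[where X = "fibre B A f k (act A k m \<phi> (act A m n \<theta> a))"])
      (auto simp: Delta_assoc Delta_comp Delta_comp[OF \<phi>] act_comp[OF A _ \<phi> a''])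
qed

lemma dprod_proj_hom:
  assumes Y: "simplicial_set Y"
  shows "dprod_proj B A f Y p \<in> hom (dprod B A f Y p) A"
  unfolding dprod_proj_def
  by (intro homI) (auto simp: dprod_act dprod_mem act_closed[OF dprod_sset[OF Y]] act_closed[OF dprod_sset[OF Y], unfolded dprod_act])

lemma dprod_counit_apply:
  assumes "((a, s), b) \<in> simplices (pullback B f (dprod B A f Y p) (dprod_proj B A f Y p)) n"
  shows "dprod_counit B A f Y p n ((a, s), b) = s n (restrict id {..n}, b)"
  using assms unfolding dprod_counit_def by (simp del: pullback_simps)

lemma dprod_counit_slice_hom:
  fixes p
  assumes Y: "simplicial_set Y"
  defines "E \<equiv> pullback B f (dprod B A f Y p) (dprod_proj B A f Y p)"
  shows "dprod_counit B A f Y p \<in> slice_hom E (proj2 E) Y p"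
proof -
  have E: "simplicial_set E"
    unfolding E_def by (rule pullback_sset[OF dprod_sset[OF Y] B dprod_proj_hom[OF Y] f])
  have pE: "proj2 E \<in> hom E B"
    unfolding E_def by (rule proj2_hom_pullback[OF dprod_sset[OF Y] B dprod_proj_hom[OF Y] f])
  have Emem: "(a, s) \<in> simplices (dprod B A f Y p) n" "b \<in> simplices B n" "a = f n b" "a \<in> simplices A n"
    "(restrict id {..n}, b) \<in> simplices (fibre B A f n a) n"
    if "((a, s), b) \<in> simplices E n" for a s b n
    using that by (auto simp: E_def dprod_proj_def Delta_id dprod_mem act_id[OF A])
  have app: "dprod_counit B A f Y p n ((a, s), b) = s n (restrict id {..n}, b)"
    if "((a, s), b) \<in> simplices E n" for a s b n
    using dprod_counit_apply that unfolding E_def by blast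
  show ?thesis
    unfolding slice_hom_iff[OF pE]
  proof (intro conjI allI ballI homI)
    fix n show "dprod_counit B A f Y p n \<in> extensional (simplices E n)"
      by (simp add: dprod_counit_def E_def)
  next
    fix n x assume x: "x \<in> simplices E n"
    obtain a s b where xas: "x = ((a, s), b)" by (metis prod.exhaust)
    note m = Emem[OF x[unfolded xas]]
    show "dprod_counit B A f Y p n x \<in> simplices Y n"
      using m(1,5) unfolding xas app[OF x[unfolded xas]] dprod_mem by blast
    show "p n (dprod_counit B A f Y p n x) = proj2 E n x"
      using m(1,5) x unfolding xas app[OF x[unfolded xas]] dprod_mem by simp
  next
    fix m n \<theta> x assume \<theta>: "\<theta> \<in> Delta m n" and x: "x \<in> simplices E n"
    obtain a s b where xas: "x = ((a, s), b)" by (metis prod.exhaust)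
    note em = Emem[OF x[unfolded xas]]
    have "act E m n \<theta> x \<in> simplices E m" by (rule act_closed[OF E \<theta> x])
    then have x': "((act A m n \<theta> a, \<lambda>k. \<lambda>(\<theta>', b)\<in>simplices (fibre B A f m (act A m n \<theta> a)) k. s k (compose {..k} \<theta> \<theta>', b)), act B m n \<theta> b) \<in> simplices E m"
      unfolding xas E_def pullback_simps dprod_act .
    have "s m (compose {..m} (restrict id {..n}) \<theta>, act B m n \<theta> b) = act Y m n \<theta> (s n (restrict id {..n}, b))"
      using em(1,5) \<theta> unfolding dprod_mem by blast
    then show "dprod_counit B A f Y p m (act E m n \<theta> x) = act Y m n \<theta> (dprod_counit B A f Y p n x)"
      unfolding xas app[OF x[unfolded xas]]
      using app[OF x'] Emem(5)[OF x']
      by (simp add: E_def dprod_act Delta_id_left Delta_id_right[OF \<theta>] \<theta> del: fibre_simps)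
  qed
qed

lemma pullback_map_apply [simp]:
  "(x, b) \<in> simplices (pullback B f X g) n \<Longrightarrow> pullback_map B f X g k n (x, b) = (k n x, b)"
  by (simp add: pullback_map_def smap_restrict_def sprod_map_def)

theorem dprod_adjunction:
  assumes X: "simplicial_set X" and g: "g \<in> hom X A" and Y: "simplicial_set Y"
    and h: "h \<in> slice_hom (pullback B f X g) (proj2 (pullback B f X g)) Y p"
  shows "\<exists>!t. t \<in> slice_hom X g (dprod B A f Y p) (dprod_proj B A f Y p) \<and>
    smap_comp (pullback B f X g) (dprod_counit B A f Y p) (pullback_map B f X g t) = h"
proof (rule ex1I)
  let ?E = "pullback B f X g"
  let ?D = "dprod B A f Y p"
  have h': "h \<in> hom ?E Y" "\<And>n x b. (x, b) \<in> simplices ?E n \<Longrightarrow> p n (h n (x, b)) = b"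
    using h unfolding slice_hom_iff[OF proj2_hom_pullback[OF X B g f]] by auto
  define t where "t = (\<lambda>n. \<lambda>x\<in>simplices X n. (g n x,
     \<lambda>k. \<lambda>(\<theta>, b)\<in>simplices (fibre B A f n (g n x)) k. h k (act X k n \<theta> x, b)))"
  have gx: "g n x \<in> simplices A n" if "x \<in> simplices X n" for x n using hom_closed[OF g that] .
  have inE: "(act X k n \<theta> x, b) \<in> simplices ?E k"
    if "x \<in> simplices X n" "(\<theta>, b) \<in> simplices (fibre B A f n (g n x)) k" for x n \<theta> b k
    using that by (simp add: act_closed[OF X] hom_nat[OF g])
  have tD: "t n x \<in> simplices ?D n" if x: "x \<in> simplices X n" for x n
  proof -
    have "(g n x, \<lambda>k. \<lambda>(\<theta>, b)\<in>simplices (fibre B A f n (g n x)) k. h k (act X k n \<theta> x, b)) \<in> simplices ?D n"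
      unfolding dprod_mem
    proof (intro conjI allI impI gx x)
      fix k show "(\<lambda>(\<theta>, b)\<in>simplices (fibre B A f n (g n x)) k. h k (act X k n \<theta> x, b))
        \<in> extensional (simplices (fibre B A f n (g n x)) k)" by simp
    next
      fix k \<theta> b assume *: "(\<theta>, b) \<in> simplices (fibre B A f n (g n x)) k"
      note ** = inE[OF x *]
      show "(\<lambda>(\<theta>, b)\<in>simplices (fibre B A f n (g n x)) k. h k (act X k n \<theta> x, b)) (\<theta>, b) \<in> simplices Y k"
        using * hom_closed[OF h'(1) **] by (simp del: fibre_simps)
      show "p k ((\<lambda>(\<theta>, b)\<in>simplices (fibre B A f n (g n x)) k. h k (act X k n \<theta> x, b)) (\<theta>, b)) = b"
        using * h'(2)[OF **] by (simp del: fibre_simps)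
    next
      fix m k \<psi> \<theta> b assume *: "\<psi> \<in> Delta m k \<and> (\<theta>, b) \<in> simplices (fibre B A f n (g n x)) k"
      then have ** : "(act X k n \<theta> x, b) \<in> simplices ?E k" using inE[OF x] by blast
      have "h m (act X m k \<psi> (act X k n \<theta> x), act B m k \<psi> b) = act Y m k \<psi> (h k (act X k n \<theta> x, b))"
        using hom_nat[OF h'(1), of \<psi> m k "(act X k n \<theta> x, b)"] * ** by simp
      moreover have "(compose {..m} \<theta> \<psi>, act B m k \<psi> b) \<in> simplices (fibre B A f n (g n x)) m"
        using fibre_act[OF gx[OF x]] * by blast
      moreover have "act X m n (compose {..m} \<theta> \<psi>) x = act X m k \<psi> (act X k n \<theta> x)"
        using * x by (simp add: act_comp[OF X])
      ultimately show "(\<lambda>(\<theta>, b)\<in>simplices (fibre B A f n (g n x)) m. h m (act X m n \<theta> x, b)) (compose {..m} \<theta> \<psi>, act B m k \<psi> b)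
         = act Y m k \<psi> ((\<lambda>(\<theta>, b)\<in>simplices (fibre B A f n (g n x)) k. h k (act X k n \<theta> x, b)) (\<theta>, b))"
        using * by (simp del: fibre_simps)
    qed
    then show ?thesis by (simp add: t_def x)
  qed
  have thom: "t \<in> hom X ?D"
  proof (rule homI)
    fix m n \<theta> x assume \<theta>: "\<theta> \<in> Delta m n" and x: "x \<in> simplices X n"
    have gm: "g m (act X m n \<theta> x) = act A m n \<theta> (g n x)" using hom_nat[OF g \<theta> x] .
    show "t m (act X m n \<theta> x) = act ?D m n \<theta> (t n x)"
      unfolding t_def using x act_closed[OF X \<theta> x]
      apply (simp add: dprod_act gm del: fibre_simps)
      apply (rule smap_eqI[where X = "fibre B A f m (act A m n \<theta> (g n x))"])
      using \<theta> x gx[OF x] by (auto simp: act_comp[OF X] act_comp[OF A] Delta_comp)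
  qed (simp_all add: tD, simp add: t_def)
  have tslice: "t \<in> slice_hom X g ?D (dprod_proj B A f Y p)"
    unfolding slice_hom_iff[OF g] using thom tD by (auto simp: dprod_proj_def) (simp add: t_def)
  have DE: "((a, s), b) \<in> simplices (pullback B f ?D (dprod_proj B A f Y p)) n"
    if "t n x = (a, s)" "(x, b) \<in> simplices ?E n" "t \<in> slice_hom X g ?D (dprod_proj B A f Y p)" for t x b a s n
    using that hom_closed[of t X ?D x n] unfolding slice_hom_iff[OF g] by (auto simp: dprod_proj_def dest!: spec[of _ n])
  have "smap_comp ?E (dprod_counit B A f Y p) (pullback_map B f X g t) = h"
  proof (rule smap_eqI[where X = ?E])
    fix n y assume y: "y \<in> simplices ?E n"
    obtain x b where yxb: "y = (x, b)" by fastforce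
    then have x: "x \<in> simplices X n" and b: "b \<in> simplices B n" "g n x = f n b" using y by auto
    have tx: "t n x = (g n x, \<lambda>k. \<lambda>(\<theta>, b)\<in>simplices (fibre B A f n (g n x)) k. h k (act X k n \<theta> x, b))"
      using x by (simp add: t_def)
    have i: "(restrict id {..n}, b) \<in> simplices (fibre B A f n (g n x)) n"
      using b gx[OF x] by (simp add: Delta_id act_id[OF A])
    show "smap_comp ?E (dprod_counit B A f Y p) (pullback_map B f X g t) n y = h n y"
      using dprod_counit_apply[OF DE[OF tx y[unfolded yxb] tslice]] i y
      by (simp add: smap_comp_apply tx act_id[OF X x] yxb del: fibre_simps pullback_simps)
  qed (simp_all add: smap_comp_ext hom_ext[OF h'(1)])
  then show "t \<in> slice_hom X g ?D (dprod_proj B A f Y p) \<and>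
    smap_comp ?E (dprod_counit B A f Y p) (pullback_map B f X g t) = h" using tslice by blast
  fix u assume "u \<in> slice_hom X g ?D (dprod_proj B A f Y p) \<and>
    smap_comp ?E (dprod_counit B A f Y p) (pullback_map B f X g u) = h"
  then have u: "u \<in> slice_hom X g ?D (dprod_proj B A f Y p)"
    and uh: "smap_comp ?E (dprod_counit B A f Y p) (pullback_map B f X g u) = h" by auto
  have u': "u \<in> hom X ?D" "\<And>n x. x \<in> simplices X n \<Longrightarrow> dprod_proj B A f Y p n (u n x) = g n x"
    using u unfolding slice_hom_iff[OF g] by auto
  show "u = t"
  proof (rule smap_eqI[where X = X])
    fix n x assume x: "x \<in> simplices X n"
    have ux: "u n x \<in> simplices ?D n" using hom_closed[OF u'(1) x] .
    obtain s where us: "u n x = (g n x, s)"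
      using u'(2)[OF x] ux by (cases "u n x") (auto simp: dprod_proj_def)
    have s: "s k \<in> extensional (simplices (fibre B A f n (g n x)) k)" for k
      using ux unfolding us dprod_mem by blast
    have "s = (\<lambda>k. \<lambda>(\<theta>, b)\<in>simplices (fibre B A f n (g n x)) k. h k (act X k n \<theta> x, b))"
    proof (rule smap_eqI[where X = "fibre B A f n (g n x)"])
      fix k y assume y: "y \<in> simplices (fibre B A f n (g n x)) k"
      obtain \<theta> b where y': "y = (\<theta>, b)" by fastforce
      note yy = y[unfolded y']
      have \<theta>: "\<theta> \<in> Delta k n" using yy by simp
      have E: "(act X k n \<theta> x, b) \<in> simplices ?E k" using inE[OF x yy] .
      have uk: "u k (act X k n \<theta> x) = (act A k n \<theta> (g n x),
         \<lambda>l. \<lambda>(\<theta>', b)\<in>simplices (fibre B A f k (act A k n \<theta> (g n x))) l. s l (compose {..l} \<theta> \<theta>', b))"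
        using hom_nat[OF u'(1) \<theta> x] by (simp add: us dprod_act)
      have i: "(restrict id {..k}, b) \<in> simplices (fibre B A f k (act A k n \<theta> (g n x))) k"
        using yy gx[OF x] by (simp add: Delta_id act_id[OF A] hom_closed[OF f])
      have "h k (act X k n \<theta> x, b) = s k (\<theta>, b)"
        using dprod_counit_apply[OF DE[OF uk E u]] i E
        by (simp add: uh[symmetric] smap_comp_apply uk Delta_id_right[OF \<theta>] del: fibre_simps pullback_simps)
      then show "s k y = (\<lambda>(\<theta>, b)\<in>simplices (fibre B A f n (g n x)) k. h k (act X k n \<theta> x, b)) y"
        using yy y' by (simp del: fibre_simps)
    qed (simp_all add: s)
    then show "u n x = t n x" by (simp add: us t_def x)
  qed (simp_all add: hom_ext[OF u'(1)], simp add: t_def)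
qed

lemma dprod_map_apply:
  "(a, s) \<in> simplices (dprod B A f Y p) n \<Longrightarrow>
     dprod_map B A f Y p h n (a, s) = (a, smap_comp (fibre B A f n a) h s)"
  by (simp add: dprod_map_def)

theorem dprod_map_adjunction:
  fixes p :: "('y, 'b) smap" and q :: "('z, 'b) smap"
  assumes Y: "simplicial_set Y" and Z: "simplicial_set Z" and p: "p \<in> hom Y B"
    and h: "h \<in> slice_hom Y p Z q"
  defines "D \<equiv> dprod B A f Y p" and "\<pi> \<equiv> dprod_proj B A f Y p"
  shows "dprod_map B A f Y p h \<in> slice_hom D \<pi> (dprod B A f Z q) (dprod_proj B A f Z q)"
    and "smap_comp (pullback B f D \<pi>) (dprod_counit B A f Z q)
           (pullback_map B f D \<pi> (dprod_map B A f Y p h)) =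
         smap_comp (pullback B f D \<pi>) h (dprod_counit B A f Y p)"
proof -
  have h': "h \<in> hom Y Z" "\<And>n y. y \<in> simplices Y n \<Longrightarrow> q n (h n y) = p n y"
    using h unfolding slice_hom_iff[OF p] by auto
  have DZ: "(a, smap_comp (fibre B A f n a) h s) \<in> simplices (dprod B A f Z q) n"
    if "(a, s) \<in> simplices D n" for a s n
  proof -
    note s = that[unfolded D_def dprod_mem]
    have a: "a \<in> simplices A n" using s by blast
    show ?thesis
      unfolding dprod_mem
    proof (intro conjI allI impI a smap_comp_ext)
      fix k \<theta> b assume *: "(\<theta>, b) \<in> simplices (fibre B A f n a) k"
      then have **: "s k (\<theta>, b) \<in> simplices Y k" "p k (s k (\<theta>, b)) = b" using s by blast+
      show "smap_comp (fibre B A f n a) h s k (\<theta>, b) \<in> simplices Z k"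
        unfolding smap_comp_apply[OF *] by (rule hom_closed[OF h'(1) **(1)])
      show "q k (smap_comp (fibre B A f n a) h s k (\<theta>, b)) = b"
        unfolding smap_comp_apply[OF *] h'(2)[OF **(1)] by (rule **(2))
    next
      fix m k \<psi> \<theta> b assume *: "\<psi> \<in> Delta m k \<and> (\<theta>, b) \<in> simplices (fibre B A f n a) k"
      then have **: "s k (\<theta>, b) \<in> simplices Y k"
        "s m (compose {..m} \<theta> \<psi>, act B m k \<psi> b) = act Y m k \<psi> (s k (\<theta>, b))" using s by blast+
      show "smap_comp (fibre B A f n a) h s m (compose {..m} \<theta> \<psi>, act B m k \<psi> b) =
          act Z m k \<psi> (smap_comp (fibre B A f n a) h s k (\<theta>, b))"
        using fibre_act[OF a] * **
        by (simp add: smap_comp_apply hom_nat[OF h'(1)] del: fibre_simps)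
    qed
  qed
  have hm: "dprod_map B A f Y p h \<in> hom D (dprod B A f Z q)"
  proof (rule homI)
    fix n show "dprod_map B A f Y p h n \<in> extensional (simplices D n)"
      by (simp add: dprod_map_def D_def)
  next
    fix n x assume "x \<in> simplices D n"
    then show "dprod_map B A f Y p h n x \<in> simplices (dprod B A f Z q) n"
      using DZ by (cases x) (auto simp: dprod_map_def D_def)
  next
    fix m n \<phi> x assume \<phi>: "\<phi> \<in> Delta m n" and x: "x \<in> simplices D n"
    obtain a s where xas: "x = (a, s)" by fastforce
    have x': "act D m n \<phi> (a, s) \<in> simplices D m"
      using act_closed[OF dprod_sset[OF Y] \<phi>] x unfolding xas D_def by blast
    have a: "a \<in> simplices A n" using x by (simp add: xas D_def dprod_mem)
    show "dprod_map B A f Y p h m (act D m n \<phi> x) = act (dprod B A f Z q) m n \<phi> (dprod_map B A f Y p h n x)"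
      unfolding xas dprod_map_apply[OF x[unfolded D_def xas]] dprod_act
      using x' unfolding D_def dprod_act dprod_map_apply[OF x'[unfolded D_def dprod_act]] prod.inject
      by (intro conjI refl smap_eqI[where X = "fibre B A f m (act A m n \<phi> a)"])
        (auto simp: smap_comp_ext smap_comp_apply fibre_shift[OF a \<phi>, simplified] Delta_comp[OF \<phi>]
           act_comp[OF A _ \<phi> a])
  qed
  have \<pi>: "\<pi> \<in> hom D A" unfolding D_def \<pi>_def by (rule dprod_proj_hom[OF Y])
  show "dprod_map B A f Y p h \<in> slice_hom D \<pi> (dprod B A f Z q) (dprod_proj B A f Z q)"
    unfolding slice_hom_iff[OF \<pi>] using hm DZ
    by (auto simp: dprod_map_def dprod_proj_def D_def \<pi>_def)
  let ?E = "pullback B f D \<pi>"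
  show "smap_comp ?E (dprod_counit B A f Z q) (pullback_map B f D \<pi> (dprod_map B A f Y p h)) =
         smap_comp ?E h (dprod_counit B A f Y p)"
  proof (rule smap_eqI[where X = ?E])
    fix n y assume y: "y \<in> simplices ?E n"
    obtain a s b where yas: "y = ((a, s), b)" by (metis prod.exhaust)
    have s: "(a, s) \<in> simplices D n" "b \<in> simplices B n" "a = f n b" "a \<in> simplices A n"
      using y by (auto simp: yas \<pi>_def dprod_proj_def D_def dprod_mem)
    have i: "(restrict id {..n}, b) \<in> simplices (fibre B A f n a) n"
      using s by (simp add: Delta_id act_id[OF A])
    have z: "((a, smap_comp (fibre B A f n a) h s), b) \<in> simplices (pullback B f (dprod B A f Z q) (dprod_proj B A f Z q)) n"
      using DZ[OF s(1)] s by (simp add: dprod_proj_def)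
    show "smap_comp ?E (dprod_counit B A f Z q) (pullback_map B f D \<pi> (dprod_map B A f Y p h)) n y =
         smap_comp ?E h (dprod_counit B A f Y p) n y"
      unfolding smap_comp_apply[OF y]
      unfolding yas pullback_map_apply[OF y[unfolded yas]] dprod_map_apply[OF s(1)[unfolded D_def]]
        dprod_counit_apply[OF z] dprod_counit_apply[OF y[unfolded D_def \<pi>_def yas]]
        smap_comp_apply[OF i] ..
  qed (simp_all add: smap_comp_ext)
qed

end


section \<open>Trees form a final coalgebra\<close>

text \<open>The value of a tree at a path is the label of the node at the end of the path. A path is a list
  of steps \<open>(k, \<theta>, b)\<close> with \<open>(\<theta>, b)\<close> a \<open>k\<close>-simplex of the fibre over the label.\<close>

definition subtree :: "('a, 'b) mtree \<Rightarrow> nat \<Rightarrow> (nat \<Rightarrow> nat) \<Rightarrow> 'b \<Rightarrow> ('a, 'b) mtree" where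
  "subtree T k \<theta> b = (\<lambda>ps. T ((k, \<theta>, b) # ps))"

definition tree_act :: "'b sset \<Rightarrow> 'a sset \<Rightarrow> ('b, 'a) smap \<Rightarrow> nat \<Rightarrow> nat \<Rightarrow> (nat \<Rightarrow> nat)
    \<Rightarrow> ('a, 'b) mtree \<Rightarrow> ('a, 'b) mtree" where
  "tree_act B A f m n \<phi> T = (\<lambda>ps. case ps of
       [] \<Rightarrow> Some (act A m n \<phi> (the (T [])))
     | (k, \<theta>, b) # qs \<Rightarrow>
         if (\<theta>, b) \<in> simplices (fibre B A f m (act A m n \<phi> (the (T [])))) k
         then T ((k, compose {..k} \<phi> \<theta>, b) # qs) else None)"

coinductive is_tree :: "'b sset \<Rightarrow> 'a sset \<Rightarrow> ('b, 'a) smap \<Rightarrow> nat \<Rightarrow> ('a, 'b) mtree \<Rightarrow> bool"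
  for B A f where
  "\<lbrakk>T [] = Some a; a \<in> simplices A n;
    \<forall>k \<theta> b ps. (\<theta>, b) \<notin> simplices (fibre B A f n a) k \<longrightarrow> T ((k, \<theta>, b) # ps) = None;
    \<forall>k \<theta> b. (\<theta>, b) \<in> simplices (fibre B A f n a) k \<longrightarrow> is_tree B A f k (subtree T k \<theta> b);
    \<forall>m k \<psi> \<theta> b. \<psi> \<in> Delta m k \<and> (\<theta>, b) \<in> simplices (fibre B A f n a) k \<longrightarrow>
      subtree T m (compose {..m} \<theta> \<psi>) (act B m k \<psi> b) = tree_act B A f m k \<psi> (subtree T k \<theta> b)\<rbrakk>
   \<Longrightarrow> is_tree B A f n T"

definition tree_sset :: "'b sset \<Rightarrow> 'a sset \<Rightarrow> ('b, 'a) smap \<Rightarrow> ('a, 'b) mtree sset" where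
  "tree_sset B A f = \<lparr>simplices = (\<lambda>n. {T. is_tree B A f n T}), act = tree_act B A f\<rparr>"

definition tree_struct :: "'b sset \<Rightarrow> 'a sset \<Rightarrow> ('b, 'a) smap
    \<Rightarrow> (('a, 'b) mtree, ('a, 'b, ('a, 'b) mtree \<times> 'b) dprod_simplex) smap" where
  "tree_struct B A f = (\<lambda>n. \<lambda>T\<in>simplices (tree_sset B A f) n. (the (T []),
     \<lambda>k. \<lambda>(\<theta>, b)\<in>simplices (fibre B A f n (the (T []))) k. (subtree T k \<theta> b, b)))"

fun tree_unfold :: "'b sset \<Rightarrow> 'a sset \<Rightarrow> ('b, 'a) smap
    \<Rightarrow> ('x, ('a, 'b, 'x \<times> 'b) dprod_simplex) smap \<Rightarrow> nat \<Rightarrow> 'x \<Rightarrow> ('a, 'b) mtree" where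
  "tree_unfold B A f \<alpha> n x [] = Some (fst (\<alpha> n x))"
| "tree_unfold B A f \<alpha> n x ((k, \<theta>, b) # ps) =
     (if (\<theta>, b) \<in> simplices (fibre B A f n (fst (\<alpha> n x))) k
      then tree_unfold B A f \<alpha> k (fst (snd (\<alpha> n x) k (\<theta>, b))) ps else None)"

lemma tree_sset_simps [simp]:
  "T \<in> simplices (tree_sset B A f) n \<longleftrightarrow> is_tree B A f n T"
  "act (tree_sset B A f) = tree_act B A f"
  by (simp_all add: tree_sset_def)

lemma tree_act_simps:
  "tree_act B A f m n \<phi> T [] = Some (act A m n \<phi> (the (T [])))"
  "tree_act B A f m n \<phi> T ((k, \<theta>, b) # qs) =
     (if (\<theta>, b) \<in> simplices (fibre B A f m (act A m n \<phi> (the (T [])))) k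
         then T ((k, compose {..k} \<phi> \<theta>, b) # qs) else None)"
  by (simp_all add: tree_act_def)

lemma tree_eqI:
  assumes "T [] = U []" "\<And>k \<theta> b ps. T ((k, \<theta>, b) # ps) = U ((k, \<theta>, b) # ps)"
  shows "T = U"
proof
  fix ps show "T ps = U ps" using assms by (cases ps) (auto simp: split_paired_all)
qed

context
  fixes B :: "'b sset" and A :: "'a sset" and f :: "('b, 'a) smap"
  assumes B: "simplicial_set B" and A: "simplicial_set A" and f: "f \<in> hom B A"
begin

lemma poly_mem:
  "(a, s) \<in> simplices (poly B A f X) n \<longleftrightarrow> a \<in> simplices A n \<and>
     (\<forall>k. s k \<in> extensional (simplices (fibre B A f n a) k)) \<and>
     (\<forall>k \<theta> b. (\<theta>, b) \<in> simplices (fibre B A f n a) k \<longrightarrow>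
        fst (s k (\<theta>, b)) \<in> simplices X k \<and> s k (\<theta>, b) = (fst (s k (\<theta>, b)), b)) \<and>
     (\<forall>m k \<psi> \<theta> b. \<psi> \<in> Delta m k \<and> (\<theta>, b) \<in> simplices (fibre B A f n a) k \<longrightarrow>
        fst (s m (compose {..m} \<theta> \<psi>, act B m k \<psi> b)) = act X m k \<psi> (fst (s k (\<theta>, b))))"
  (is "_ \<longleftrightarrow> ?a \<and> ?E \<and> ?P \<and> ?N")
proof (cases ?a)
  case True
  have *: "s k (\<theta>, b) \<in> simplices (sprod X B) k \<and> proj2 (sprod X B) k (s k (\<theta>, b)) = b \<longleftrightarrow>
     fst (s k (\<theta>, b)) \<in> simplices X k \<and> s k (\<theta>, b) = (fst (s k (\<theta>, b)), b)"
    if "(\<theta>, b) \<in> simplices (fibre B A f n a) k" for k \<theta> b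
    using that by (cases "s k (\<theta>, b)") (auto simp: proj2_def)
  have **: "s m (compose {..m} \<theta> \<psi>, act B m k \<psi> b) = act (sprod X B) m k \<psi> (s k (\<theta>, b)) \<longleftrightarrow>
      fst (s m (compose {..m} \<theta> \<psi>, act B m k \<psi> b)) = act X m k \<psi> (fst (s k (\<theta>, b)))"
    if P: ?P and k: "\<psi> \<in> Delta m k \<and> (\<theta>, b) \<in> simplices (fibre B A f n a) k" for m k \<psi> \<theta> b
  proof -
    have "(compose {..m} \<theta> \<psi>, act B m k \<psi> b) \<in> simplices (fibre B A f n a) m"
      using fibre_act[OF B A f True] k by blast
    then have "s m (compose {..m} \<theta> \<psi>, act B m k \<psi> b) = (fst (s m (compose {..m} \<theta> \<psi>, act B m k \<psi> b)), act B m k \<psi> b)"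
      "s k (\<theta>, b) = (fst (s k (\<theta>, b)), b)" using P k by blast+
    then show ?thesis by (metis fst_conv sprod_simps(2))
  qed
  show ?thesis
    unfolding poly_def dprod_mem[OF B A f] using * ** by (safe; blast)
next
  case False
  then show ?thesis unfolding poly_def dprod_mem[OF B A f] by blast
qed

lemma poly_act:
  "act (poly B A f X) m n \<phi> (a, s) = (act A m n \<phi> a,
     \<lambda>k. \<lambda>(\<theta>, b)\<in>simplices (fibre B A f m (act A m n \<phi> a)) k. s k (compose {..k} \<phi> \<theta>, b))"
  by (simp add: poly_def dprod_act[OF B A f])

lemma poly_map_apply:
  assumes "(a, s) \<in> simplices (poly B A f X) n"
  shows "poly_map B A f X k n (a, s) =
    (a, \<lambda>j. \<lambda>(\<theta>, b)\<in>simplices (fibre B A f n a) j. (k j (fst (s j (\<theta>, b))), b))"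
proof -
  have "smap_comp (fibre B A f n a) (sprod_map X B k) s =
    (\<lambda>j. \<lambda>(\<theta>, b)\<in>simplices (fibre B A f n a) j. (k j (fst (s j (\<theta>, b))), b))"
  proof (rule smap_eqI[where X = "fibre B A f n a"])
    fix j y assume y: "y \<in> simplices (fibre B A f n a) j"
    obtain \<theta> b where y': "y = (\<theta>, b)" by fastforce
    have b: "b \<in> simplices B j" using y by (simp add: y')
    have "fst (s j (\<theta>, b)) \<in> simplices X j" and e: "s j (\<theta>, b) = (fst (s j (\<theta>, b)), b)"
      using assms y unfolding y' poly_mem by blast+
    then have "sprod_map X B k j (s j (\<theta>, b)) = (k j (fst (s j (\<theta>, b))), b)"
      using b by (cases "s j (\<theta>, b)") (simp add: sprod_map_def)
    then show "smap_comp (fibre B A f n a) (sprod_map X B k) s j y =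
        (\<lambda>(\<theta>, b)\<in>simplices (fibre B A f n a) j. (k j (fst (s j (\<theta>, b))), b)) y"
      using y by (simp add: smap_comp_apply y' del: fibre_simps)
  qed (simp_all add: smap_comp_ext)
  then show ?thesis
    using assms unfolding poly_map_def poly_def by (simp add: dprod_map_def)
qed

lemma coalgebra_hom_iff:
  "k \<in> coalgebra_hom B A f X \<alpha> Y \<beta> \<longleftrightarrow> k \<in> hom X Y \<and>
     (\<forall>n. \<forall>x\<in>simplices X n. \<beta> n (k n x) = poly_map B A f X k n (\<alpha> n x))"
proof -
  have "smap_comp X \<beta> k = smap_comp X (poly_map B A f X k) \<alpha> \<longleftrightarrow>
     (\<forall>n. \<forall>x\<in>simplices X n. \<beta> n (k n x) = poly_map B A f X k n (\<alpha> n x))"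
    (is "?l = ?r \<longleftrightarrow> ?P")
  proof
    assume "?l = ?r"
    then have "?l n x = ?r n x" for n x by simp
    then show ?P by (metis smap_comp_apply)
  next
    assume ?P
    then show "?l = ?r"
      by (intro smap_eqI[where X = X] smap_comp_ext) (simp add: smap_comp_apply)
  qed
  then show ?thesis by (simp add: coalgebra_hom_def)
qed

lemma coalgebra_closed:
  "\<lbrakk>coalgebra B A f X \<alpha>; x \<in> simplices X n\<rbrakk> \<Longrightarrow> \<alpha> n x \<in> simplices (poly B A f X) n"
  unfolding coalgebra_def by (blast intro: hom_closed)

lemma coalgebra_hom_comp:
  assumes X: "coalgebra B A f X \<alpha>" and Y: "coalgebra B A f Y \<beta>"
    and k: "k \<in> coalgebra_hom B A f X \<alpha> Y \<beta>" and l: "l \<in> coalgebra_hom B A f Y \<beta> Z \<gamma>"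
  shows "smap_comp X l k \<in> coalgebra_hom B A f X \<alpha> Z \<gamma>"
  unfolding coalgebra_hom_iff
proof (intro conjI allI ballI)
  have kl: "k \<in> hom X Y" "l \<in> hom Y Z" using k l by (auto simp: coalgebra_hom_iff)
  then show "smap_comp X l k \<in> hom X Z"
    using X by (auto simp: coalgebra_def intro: smap_comp_hom)
  fix n x assume x: "x \<in> simplices X n"
  obtain a s where as: "\<alpha> n x = (a, s)" by fastforce
  have s: "(a, s) \<in> simplices (poly B A f X) n" using coalgebra_closed[OF X x] as by simp
  have kx: "k n x \<in> simplices Y n" using hom_closed[OF kl(1) x] .
  have bk: "\<beta> n (k n x) = (a, \<lambda>j. \<lambda>(\<theta>, b)\<in>simplices (fibre B A f n a) j. (k j (fst (s j (\<theta>, b))), b))"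
    using k x by (simp add: coalgebra_hom_iff as poly_map_apply[OF s])
  have s': "(a, \<lambda>j. \<lambda>(\<theta>, b)\<in>simplices (fibre B A f n a) j. (k j (fst (s j (\<theta>, b))), b)) \<in> simplices (poly B A f Y) n"
    using coalgebra_closed[OF Y kx] bk by simp
  have "\<gamma> n (l n (k n x)) = poly_map B A f Y l n (\<beta> n (k n x))"
    using l kx by (simp add: coalgebra_hom_iff)
  also have "\<dots> = poly_map B A f X (smap_comp X l k) n (\<alpha> n x)"
    unfolding bk as poly_map_apply[OF s] poly_map_apply[OF s'] prod.inject
  proof (intro conjI refl smap_eqI[where X = "fibre B A f n a"])
    fix j y assume y: "y \<in> simplices (fibre B A f n a) j"
    obtain \<theta> b where y': "y = (\<theta>, b)" by fastforce
    have "fst (s j (\<theta>, b)) \<in> simplices X j" using s y unfolding y' poly_mem by blast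
    then show "(\<lambda>(\<theta>, b)\<in>simplices (fibre B A f n a) j.
         (l j (fst ((\<lambda>(\<theta>, b)\<in>simplices (fibre B A f n a) j. (k j (fst (s j (\<theta>, b))), b)) (\<theta>, b))), b)) y =
       (\<lambda>(\<theta>, b)\<in>simplices (fibre B A f n a) j. (smap_comp X l k j (fst (s j (\<theta>, b))), b)) y"
      using y by (simp add: y' smap_comp_apply del: fibre_simps)
  qed simp_all
  finally show "\<gamma> n (smap_comp X l k n x) = poly_map B A f X (smap_comp X l k) n (\<alpha> n x)"
    using x by (simp add: smap_comp_apply)
qed

lemma coalgebra_hom_id:
  assumes X: "coalgebra B A f X \<alpha>"
  shows "(\<lambda>n. restrict id (simplices X n)) \<in> coalgebra_hom B A f X \<alpha> X \<alpha>"
  unfolding coalgebra_hom_iff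
proof (intro conjI allI ballI)
  show "(\<lambda>n. restrict id (simplices X n)) \<in> hom X X"
    using X by (intro homI) (auto simp: coalgebra_def act_closed)
  fix n x assume x: "x \<in> simplices X n"
  obtain a s where as: "\<alpha> n x = (a, s)" by fastforce
  have s: "(a, s) \<in> simplices (poly B A f X) n" using coalgebra_closed[OF X x] as by simp
  have "s = (\<lambda>j. \<lambda>(\<theta>, b)\<in>simplices (fibre B A f n a) j. (restrict id (simplices X j) (fst (s j (\<theta>, b))), b))"
  proof (rule smap_eqI[where X = "fibre B A f n a"])
    fix j show "s j \<in> extensional (simplices (fibre B A f n a) j)" using s unfolding poly_mem by blast
  next
    fix j y assume y: "y \<in> simplices (fibre B A f n a) j"
    obtain \<theta> b where y': "y = (\<theta>, b)" by fastforce
    have "fst (s j (\<theta>, b)) \<in> simplices X j" "s j (\<theta>, b) = (fst (s j (\<theta>, b)), b)"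
      using s y unfolding y' poly_mem by blast+
    then show "s j y = (\<lambda>(\<theta>, b)\<in>simplices (fibre B A f n a) j. (restrict id (simplices X j) (fst (s j (\<theta>, b))), b)) y"
      using y by (simp add: y' del: fibre_simps)
  qed simp
  then show "\<alpha> n (restrict id (simplices X n) x) = poly_map B A f X (\<lambda>n. restrict id (simplices X n)) n (\<alpha> n x)"
    using x unfolding as poly_map_apply[OF s] by (simp add: as)
qed

lemma is_treeD:
  assumes "is_tree B A f n T"
  shows "T [] = Some (the (T []))" "the (T []) \<in> simplices A n"
    "(\<theta>, b) \<notin> simplices (fibre B A f n (the (T []))) k \<Longrightarrow> T ((k, \<theta>, b) # ps) = None"
    "(\<theta>, b) \<in> simplices (fibre B A f n (the (T []))) k \<Longrightarrow> is_tree B A f k (subtree T k \<theta> b)"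
    "\<lbrakk>\<psi> \<in> Delta m k; (\<theta>, b) \<in> simplices (fibre B A f n (the (T []))) k\<rbrakk> \<Longrightarrow>
      subtree T m (compose {..m} \<theta> \<psi>) (act B m k \<psi> b) = tree_act B A f m k \<psi> (subtree T k \<theta> b)"
proof -
  show "T [] = Some (the (T []))" "the (T []) \<in> simplices A n"
    using assms by (auto elim: is_tree.cases)
  from assms obtain a where a: "T [] = Some a"
    and *: "\<forall>k \<theta> b ps. (\<theta>, b) \<notin> simplices (fibre B A f n a) k \<longrightarrow> T ((k, \<theta>, b) # ps) = None"
      "\<forall>k \<theta> b. (\<theta>, b) \<in> simplices (fibre B A f n a) k \<longrightarrow> is_tree B A f k (subtree T k \<theta> b)"
      "\<forall>m k \<psi> \<theta> b. \<psi> \<in> Delta m k \<and> (\<theta>, b) \<in> simplices (fibre B A f n a) k \<longrightarrow>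
        subtree T m (compose {..m} \<theta> \<psi>) (act B m k \<psi> b) = tree_act B A f m k \<psi> (subtree T k \<theta> b)"
    by (rule is_tree.cases) blast
  have a': "the (T []) = a" using a by simp
  show "(\<theta>, b) \<notin> simplices (fibre B A f n (the (T []))) k \<Longrightarrow> T ((k, \<theta>, b) # ps) = None"
    "(\<theta>, b) \<in> simplices (fibre B A f n (the (T []))) k \<Longrightarrow> is_tree B A f k (subtree T k \<theta> b)"
    "\<lbrakk>\<psi> \<in> Delta m k; (\<theta>, b) \<in> simplices (fibre B A f n (the (T []))) k\<rbrakk> \<Longrightarrow>
      subtree T m (compose {..m} \<theta> \<psi>) (act B m k \<psi> b) = tree_act B A f m k \<psi> (subtree T k \<theta> b)"
    unfolding a' using * by blast+
qed

lemma subtree_tree_act: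
  assumes "(\<theta>, b) \<in> simplices (fibre B A f m (act A m n \<phi> (the (T [])))) k"
  shows "subtree (tree_act B A f m n \<phi> T) k \<theta> b = subtree T k (compose {..k} \<phi> \<theta>) b"
  using assms by (intro ext) (simp add: subtree_def tree_act_simps del: fibre_simps)

lemma tree_act_closed:
  assumes \<phi>: "\<phi> \<in> Delta m n" and T: "is_tree B A f n T"
  shows "is_tree B A f m (tree_act B A f m n \<phi> T)"
proof (rule is_tree.intros)
  let ?a = "act A m n \<phi> (the (T []))"
  note t = is_treeD[OF T]
  show "tree_act B A f m n \<phi> T [] = Some ?a" by (simp add: tree_act_simps)
  show a: "?a \<in> simplices A m" by (rule act_closed[OF A \<phi> t(2)])
  show "\<forall>k \<theta> b ps. (\<theta>, b) \<notin> simplices (fibre B A f m ?a) k \<longrightarrow> tree_act B A f m n \<phi> T ((k, \<theta>, b) # ps) = None"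
    by (auto simp: tree_act_simps simp del: fibre_simps)
  show "\<forall>k \<theta> b. (\<theta>, b) \<in> simplices (fibre B A f m ?a) k \<longrightarrow> is_tree B A f k (subtree (tree_act B A f m n \<phi> T) k \<theta> b)"
    using t(4) fibre_shift[OF B A f t(2) \<phi>] by (auto simp: subtree_tree_act simp del: fibre_simps)
  show "\<forall>l k \<psi> \<theta> b. \<psi> \<in> Delta l k \<and> (\<theta>, b) \<in> simplices (fibre B A f m ?a) k \<longrightarrow>
      subtree (tree_act B A f m n \<phi> T) l (compose {..l} \<theta> \<psi>) (act B l k \<psi> b) =
      tree_act B A f l k \<psi> (subtree (tree_act B A f m n \<phi> T) k \<theta> b)"
    using t(5)[OF _ fibre_shift[OF B A f t(2) \<phi>]] fibre_act[OF B A f a]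
    by (auto simp: subtree_tree_act Delta_assoc[symmetric] simp del: fibre_simps)
qed

lemma tree_simplicial: "simplicial_set (tree_sset B A f)"
  unfolding simplicial_set_def
proof (intro conjI allI ballI; unfold tree_sset_simps)
  fix m n \<theta> T assume "\<theta> \<in> Delta m n" "is_tree B A f n T"
  then show "is_tree B A f m (tree_act B A f m n \<theta> T)" by (rule tree_act_closed)
next
  fix n T assume T: "is_tree B A f n T"
  note t = is_treeD[OF T]
  have a: "act A n n (restrict id {..n}) (the (T [])) = the (T [])" using act_id[OF A t(2)] .
  show "tree_act B A f n n (restrict id {..n}) T = T"
    using t(1,3) by (intro tree_eqI) (auto simp: tree_act_simps a Delta_id_left)
next
  fix k m n \<phi> \<theta> T assume \<phi>: "\<phi> \<in> Delta k m" and \<theta>: "\<theta> \<in> Delta m n" and T: "is_tree B A f n T"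
  note t = is_treeD[OF T]
  note a = act_comp[OF A \<phi> \<theta> t(2)]
  show "tree_act B A f k n (compose {..k} \<theta> \<phi>) T = tree_act B A f k m \<phi> (tree_act B A f m n \<theta> T)"
    using act_comp[OF A _ \<phi> act_closed[OF A \<theta> t(2)]]
    by (intro tree_eqI) (auto simp: tree_act_simps a Delta_assoc Delta_comp[OF \<phi>])
qed

lemma tree_struct_apply:
  "is_tree B A f n T \<Longrightarrow> tree_struct B A f n T = (the (T []),
     \<lambda>k. \<lambda>(\<theta>, b)\<in>simplices (fibre B A f n (the (T []))) k. (subtree T k \<theta> b, b))"
  by (simp add: tree_struct_def)

lemma tree_coalgebra: "coalgebra B A f (tree_sset B A f) (tree_struct B A f)"
  unfolding coalgebra_def
proof (intro conjI tree_simplicial homI; (unfold tree_sset_simps)?)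
  fix n show "tree_struct B A f n \<in> extensional (simplices (tree_sset B A f) n)"
    by (simp add: tree_struct_def)
next
  fix n T assume T: "is_tree B A f n T"
  note t = is_treeD[OF T]
  show "tree_struct B A f n T \<in> simplices (poly B A f (tree_sset B A f)) n"
    unfolding tree_struct_apply[OF T] poly_mem
    using t(2,4,5) fibre_act[OF B A f t(2)] by (auto simp del: fibre_simps)
next
  fix m n \<phi> T assume \<phi>: "\<phi> \<in> Delta m n" and T: "is_tree B A f n T"
  note t = is_treeD[OF T]
  show "tree_struct B A f m (tree_act B A f m n \<phi> T) = act (poly B A f (tree_sset B A f)) m n \<phi> (tree_struct B A f n T)"
    unfolding tree_struct_apply[OF T] tree_struct_apply[OF tree_act_closed[OF \<phi> T]] poly_act tree_act_simps option.sel
      prod.inject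
    using fibre_shift[OF B A f t(2) \<phi>]
    by (intro conjI refl smap_eqI[where X = "fibre B A f m (act A m n \<phi> (the (T [])))"])
       (auto simp: subtree_tree_act simp del: fibre_simps)
qed

lemma tree_unfold_act:
  assumes X: "coalgebra B A f X \<alpha>" and \<phi>: "\<phi> \<in> Delta m n" and x: "x \<in> simplices X n"
  shows "tree_unfold B A f \<alpha> m (act X m n \<phi> x) = tree_act B A f m n \<phi> (tree_unfold B A f \<alpha> n x)"
proof -
  obtain a s where as: "\<alpha> n x = (a, s)" by fastforce
  have s: "(a, s) \<in> simplices (poly B A f X) n" using coalgebra_closed[OF X x] as by simp
  then have a: "a \<in> simplices A n" by (simp add: poly_mem)
  have "\<alpha> m (act X m n \<phi> x) = act (poly B A f X) m n \<phi> (a, s)"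
    using hom_nat[of \<alpha> X _ \<phi> m n x] X \<phi> x by (simp add: coalgebra_def as)
  then show ?thesis
    using fibre_shift[OF B A f a \<phi>]
    by (intro tree_eqI) (auto simp: poly_act tree_act_simps as simp del: fibre_simps)
qed

lemma tree_unfold_subtree:
  assumes "(\<theta>, b) \<in> simplices (fibre B A f n (fst (\<alpha> n x))) k"
  shows "subtree (tree_unfold B A f \<alpha> n x) k \<theta> b = tree_unfold B A f \<alpha> k (fst (snd (\<alpha> n x) k (\<theta>, b)))"
  using assms by (intro ext) (simp add: subtree_def del: fibre_simps)

lemma tree_unfold_is_tree:
  assumes X: "coalgebra B A f X \<alpha>" and x: "x \<in> simplices X n"
  shows "is_tree B A f n (tree_unfold B A f \<alpha> n x)"
proof -
  have "\<exists>x\<in>simplices X n. tree_unfold B A f \<alpha> n x = tree_unfold B A f \<alpha> n x" using x by blast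
  moreover have "is_tree B A f n T" if "\<exists>x\<in>simplices X n. T = tree_unfold B A f \<alpha> n x" for n T
    using that
  proof (coinduction arbitrary: n T)
    case is_tree
    then obtain x where x: "x \<in> simplices X n" and T: "T = tree_unfold B A f \<alpha> n x" by blast
    obtain a s where as: "\<alpha> n x = (a, s)" by fastforce
    have s: "(a, s) \<in> simplices (poly B A f X) n" using coalgebra_closed[OF X x] as by simp
    then have a: "a \<in> simplices A n" by (simp add: poly_mem)
    have sx: "fst (s k (\<theta>, b)) \<in> simplices X k" if "(\<theta>, b) \<in> simplices (fibre B A f n a) k" for k \<theta> b
      using s that unfolding poly_mem by blast
    have sub: "subtree T k \<theta> b = tree_unfold B A f \<alpha> k (fst (s k (\<theta>, b)))"
      if "(\<theta>, b) \<in> simplices (fibre B A f n a) k" for k \<theta> b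
      using tree_unfold_subtree[of \<theta> b n \<alpha> x k] that unfolding T as by simp
    have nat: "subtree T m (compose {..m} \<theta> \<psi>) (act B m k \<psi> b) = tree_act B A f m k \<psi> (subtree T k \<theta> b)"
      if \<psi>: "\<psi> \<in> Delta m k" and \<theta>: "(\<theta>, b) \<in> simplices (fibre B A f n a) k" for m k \<psi> \<theta> b
    proof -
      have "fst (s m (compose {..m} \<theta> \<psi>, act B m k \<psi> b)) = act X m k \<psi> (fst (s k (\<theta>, b)))"
        using s \<psi> \<theta> unfolding poly_mem by blast
      then show ?thesis
        unfolding sub[OF \<theta>] sub[OF fibre_act[OF B A f a \<psi> \<theta>]]
        using tree_unfold_act[OF X \<psi> sx[OF \<theta>]] by simp
    qed
    show ?case
      using a sub sx nat by (intro exI[of _ T] exI[of _ a] exI[of _ n]) (auto simp: T as simp del: fibre_simps)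
  qed
  ultimately show ?thesis using x by blast
qed

theorem tree_coalgebra_final: "final_coalgebra TYPE('c) B A f (tree_sset B A f) (tree_struct B A f)"
  unfolding final_coalgebra_def
proof (intro conjI tree_coalgebra allI impI)
  fix X :: "'c sset" and \<alpha> assume X: "coalgebra B A f X \<alpha>"
  define u where "u = (\<lambda>n. restrict (tree_unfold B A f \<alpha> n) (simplices X n))"
  have X': "simplicial_set X" using X by (simp add: coalgebra_def)
  show "\<exists>!k. k \<in> coalgebra_hom B A f X \<alpha> (tree_sset B A f) (tree_struct B A f)"
  proof (rule ex1I)
    have "u \<in> hom X (tree_sset B A f)"
      by (intro homI) (auto simp: u_def tree_unfold_is_tree[OF X] act_closed[OF X'] tree_unfold_act[OF X])
    moreover have "tree_struct B A f n (u n x) = poly_map B A f X u n (\<alpha> n x)" if x: "x \<in> simplices X n" for n x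
    proof -
      obtain a s where as: "\<alpha> n x = (a, s)" by fastforce
      have s: "(a, s) \<in> simplices (poly B A f X) n" using coalgebra_closed[OF X x] as by simp
      have sx: "fst (s k (\<theta>, b)) \<in> simplices X k" if "(\<theta>, b) \<in> simplices (fibre B A f n a) k" for k \<theta> b
        using s that unfolding poly_mem by blast
      have sub: "subtree (tree_unfold B A f \<alpha> n x) k \<theta> b = u k (fst (s k (\<theta>, b)))"
        if "(\<theta>, b) \<in> simplices (fibre B A f n a) k" for k \<theta> b
        using tree_unfold_subtree[of \<theta> b n \<alpha> x k] that sx[OF that] unfolding as u_def by simp
      show ?thesis
        unfolding as poly_map_apply[OF s]
        using x sub
        by (auto simp: fun_cong[OF u_def, of n] tree_struct_apply[OF tree_unfold_is_tree[OF X x]] as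
            intro!: smap_eqI[where X = "fibre B A f n a"] simp del: fibre_simps)
    qed
    ultimately show "u \<in> coalgebra_hom B A f X \<alpha> (tree_sset B A f) (tree_struct B A f)"
      by (simp add: coalgebra_hom_iff)
  next
    fix k assume k: "k \<in> coalgebra_hom B A f X \<alpha> (tree_sset B A f) (tree_struct B A f)"
    then have kh: "k \<in> hom X (tree_sset B A f)" by (simp add: coalgebra_hom_iff)
    have "k n x ps = tree_unfold B A f \<alpha> n x ps" if "x \<in> simplices X n" for n x ps
      using that
    proof (induction ps arbitrary: n x)
      case (Nil n x)
      obtain a s where as: "\<alpha> n x = (a, s)" by fastforce
      have s: "(a, s) \<in> simplices (poly B A f X) n" using coalgebra_closed[OF X Nil] as by simp
      have T: "is_tree B A f n (k n x)" using hom_closed[OF kh Nil] by simp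
      have "tree_struct B A f n (k n x) = poly_map B A f X k n (a, s)"
        using k Nil by (simp add: coalgebra_hom_iff as)
      then have "the (k n x []) = a" unfolding tree_struct_apply[OF T] poly_map_apply[OF s] by simp
      then show ?case using is_treeD(1)[OF T] by (simp add: as)
    next
      case (Cons p ps n x)
      obtain j \<theta> b where p: "p = (j, \<theta>, b)" by (metis prod.exhaust)
      obtain a s where as: "\<alpha> n x = (a, s)" by fastforce
      have s: "(a, s) \<in> simplices (poly B A f X) n" using coalgebra_closed[OF X Cons.prems] as by simp
      have T: "is_tree B A f n (k n x)" using hom_closed[OF kh Cons.prems] by simp
      have *: "tree_struct B A f n (k n x) = poly_map B A f X k n (a, s)"
        using k Cons.prems by (simp add: coalgebra_hom_iff as)
      then have a: "the (k n x []) = a" unfolding tree_struct_apply[OF T] poly_map_apply[OF s] by simp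
      show ?case
      proof (cases "(\<theta>, b) \<in> simplices (fibre B A f n a) j")
        case True
        have sx: "fst (s j (\<theta>, b)) \<in> simplices X j"
          using s True unfolding poly_mem by blast
        have "snd (tree_struct B A f n (k n x)) j (\<theta>, b) = snd (poly_map B A f X k n (a, s)) j (\<theta>, b)"
          using * by simp
        then have "subtree (k n x) j \<theta> b = k j (fst (s j (\<theta>, b)))"
          unfolding tree_struct_apply[OF T] poly_map_apply[OF s] using True a by (simp del: fibre_simps)
        then have "k n x ((j, \<theta>, b) # ps) = k j (fst (s j (\<theta>, b))) ps"
          by (metis subtree_def)
        then show ?thesis using Cons.IH[OF sx] True by (simp add: p as del: fibre_simps)
      next
        case False
        then show ?thesis using is_treeD(3)[OF T] a by (simp add: p as del: fibre_simps)
      qed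
    qed
    then show "k = u"
      using hom_ext[OF kh] by (intro smap_eqI[where X = X]) (auto simp: u_def)
  qed
qed

theorem M_type_final:
  fixes M :: "'m sset"
  assumes M: "M_type B A f M \<mu>"
  shows "final_coalgebra TYPE('c) B A f M \<mu>"
proof -
  let ?T = "tree_sset B A f" and ?\<tau> = "tree_struct B A f"
  have Mc: "coalgebra B A f M \<mu>" using M by (simp add: M_type_def final_coalgebra_def)
  obtain j where j: "j \<in> coalgebra_hom B A f M \<mu> ?T ?\<tau>"
    using tree_coalgebra_final Mc unfolding final_coalgebra_def by blast
  obtain i where i: "i \<in> coalgebra_hom B A f ?T ?\<tau> M \<mu>"
    using M tree_coalgebra unfolding M_type_def final_coalgebra_def by blast
  have "\<exists>!k. k \<in> coalgebra_hom B A f M \<mu> M \<mu>"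
    using M Mc unfolding M_type_def final_coalgebra_def by blast
  then have ij: "smap_comp M i j = (\<lambda>n. restrict id (simplices M n))"
    using coalgebra_hom_id[OF Mc] coalgebra_hom_comp[OF Mc tree_coalgebra j i] by blast
  show ?thesis
    unfolding final_coalgebra_def
  proof (intro conjI Mc allI impI)
    fix X :: "'c sset" and \<alpha> assume X: "coalgebra B A f X \<alpha>"
    obtain u where u: "u \<in> coalgebra_hom B A f X \<alpha> ?T ?\<tau>"
      and uu: "\<And>v. v \<in> coalgebra_hom B A f X \<alpha> ?T ?\<tau> \<Longrightarrow> v = u"
      using tree_coalgebra_final X unfolding final_coalgebra_def by blast
    show "\<exists>!k. k \<in> coalgebra_hom B A f X \<alpha> M \<mu>"
    proof (rule ex1I)
      show "smap_comp X i u \<in> coalgebra_hom B A f X \<alpha> M \<mu>"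
        by (rule coalgebra_hom_comp[OF X tree_coalgebra u i])
      fix l assume l: "l \<in> coalgebra_hom B A f X \<alpha> M \<mu>"
      have lh: "l \<in> hom X M" using l by (simp add: coalgebra_hom_iff)
      have jl: "smap_comp X j l = u" by (rule uu[OF coalgebra_hom_comp[OF X Mc l j]])
      show "l = smap_comp X i u"
      proof (rule smap_eqI[where X = X])
        fix n x assume x: "x \<in> simplices X n"
        have lx: "l n x \<in> simplices M n" using hom_closed[OF lh x] .
        have "smap_comp M i j n (l n x) = l n x" using lx by (simp add: ij)
        then show "l n x = smap_comp X i u n x"
          using x lx by (simp add: jl[symmetric] smap_comp_apply)
      qed (simp_all add: hom_ext[OF lh] smap_comp_ext)
    qed
  qed
qed

end

end

theory Submission
  imports Defs
begin

text \<open>To fill a horn \<open>u\<close> of shape \<open>K\<^sub>0 = \<Lambda>\<^sup>k[n] \<subseteq> L\<^sub>0 = \<Delta>[n]\<close> in \<open>M\<close>, extend \<open>root \<circ> u\<close> to a map \<open>a\<^sub>0 : L\<^sub>0 \<rightarrow> A\<close>,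
  pull \<open>f\<close> back along \<open>a\<^sub>0\<close> to get \<open>L\<^sub>1 \<rightarrow> L\<^sub>0\<close>, extend the roots of the subtrees, given on the
  part \<open>K\<^sub>1\<close> of \<open>L\<^sub>1\<close> over the horn, to \<open>a\<^sub>1 : L\<^sub>1 \<rightarrow> A\<close>, and so on. The coproduct of all \<open>L\<^sub>i\<close> is a coalgebra;
  its map to \<open>M\<close> restricts to \<open>u\<close> on the horn because the coproduct of the \<open>K\<^sub>i\<close> is a subcoalgebra.
  The extensions exist because \<open>L\<^sub>i \<rightarrow> \<Delta>[n]\<close> is a Kan fibration: the homotopies
  \<open>id \<leftarrow> min(-,k) \<rightarrow> k\<close> of \<open>\<Delta>[n]\<close> preserve the horn and end inside it, so they lift to
  \<open>L\<^sub>i\<close>, and homotopy extension in \<open>A\<close> along them gives the required map.\<close>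

text \<open>The levels cannot be filled independently: the fibre that indexes the children of a
  filler depends on the root already chosen for it. Each labelling \<open>a\<^sub>i\<close>
  therefore determines the next space, and the tower is built by dependent choice. A second obstacle
  is that \<open>K\<^sub>i \<subseteq> L\<^sub>i\<close>, the preimage of a horn under a fibration,
  is not itself built from horns in any evident way. Classically it is a trivial cofibration because
  simplicial sets are right proper. The explicit homotopies replace that fact, so that the only
  anodyne maps needed are the inclusions of X x {e} \<union> S x Delta[1] into X x Delta[1],
  assembled from horns prism by prism. The detour through \<open>min(-,k)\<close> is due to the
  direction of the interval: a homotopy between self-maps of Delta[n] is an order relation between
  monotone maps, and for 0 < k < n the identity is neither above nor below the constant k. Finality
  enters twice: existence gives the filler, and uniqueness, applied to the coalgebra over the horn,
  identifies its restriction with \<open>u\<close>.\<close>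

section \<open>Partial lifts\<close>

text \<open>A partial lift is encoded by its graph, so that unions of chains are plain set unions.\<close>

definition partial_lift :: "'z sset \<Rightarrow> 'e sset \<Rightarrow> ('e, 'y) smap \<Rightarrow> ('z, 'y) smap \<Rightarrow> (nat \<times> 'z \<times> 'e) set \<Rightarrow> bool" where
  "partial_lift Z E p v R \<longleftrightarrow>
     (\<forall>m z e. (m, z, e) \<in> R \<longrightarrow> z \<in> simplices Z m \<and> e \<in> simplices E m \<and> p m e = v m z \<and>
        (\<forall>l. \<forall>\<theta>\<in>Delta l m. (l, act Z l m \<theta> z, act E l m \<theta> e) \<in> R)) \<and>
     (\<forall>m z e e'. (m, z, e) \<in> R \<longrightarrow> (m, z, e') \<in> R \<longrightarrow> e = e')"

definition lift_dom :: "(nat \<times> 'z \<times> 'e) set \<Rightarrow> (nat \<times> 'z) set" where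
  "lift_dom R = {(m, z). \<exists>e. (m, z, e) \<in> R}"

lemma partial_liftD:
  assumes "partial_lift Z E p v R" "(m, z, e) \<in> R"
  shows "z \<in> simplices Z m" "e \<in> simplices E m" "p m e = v m z"
    "\<theta> \<in> Delta l m \<Longrightarrow> (l, act Z l m \<theta> z, act E l m \<theta> e) \<in> R"
    "(m, z, e') \<in> R \<Longrightarrow> e' = e"
  using assms unfolding partial_lift_def by blast+

lemma lift_dom_act:
  "\<lbrakk>partial_lift Z E p v R; (m, z) \<in> lift_dom R; \<theta> \<in> Delta l m\<rbrakk> \<Longrightarrow> (l, act Z l m \<theta> z) \<in> lift_dom R"
  unfolding lift_dom_def by (blast dest: partial_liftD(4))

lemma partial_lift_total:
  assumes Z: "simplicial_set Z" and R: "partial_lift Z E p v R"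
    and total: "\<And>m z. z \<in> simplices Z m \<Longrightarrow> (m, z) \<in> lift_dom R"
  obtains w where "w \<in> hom Z E" "\<And>m z. z \<in> simplices Z m \<Longrightarrow> p m (w m z) = v m z"
    "\<And>m z e. (m, z, e) \<in> R \<Longrightarrow> w m z = e"
proof
  define w where "w = (\<lambda>m. \<lambda>z\<in>simplices Z m. THE e. (m, z, e) \<in> R)"
  show wR: "w m z = e" if e: "(m, z, e) \<in> R" for m z e
  proof -
    have "(THE e. (m, z, e) \<in> R) = e"
      using e partial_liftD(5)[OF R e] by (rule the_equality)
    then show ?thesis using partial_liftD(1)[OF R e] by (simp add: w_def)
  qed
  have ex: "(m, z, w m z) \<in> R" if z: "z \<in> simplices Z m" for m z
  proof -
    obtain e where "(m, z, e) \<in> R" using total[OF z] unfolding lift_dom_def by blast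
    then show ?thesis using wR by metis
  qed
  show "w \<in> hom Z E"
  proof (rule homI)
    show "w m \<in> extensional (simplices Z m)" for m by (simp add: w_def)
    show "w m z \<in> simplices E m" if "z \<in> simplices Z m" for m z
      using partial_liftD(2)[OF R ex[OF that]] .
    show "w l (act Z l m \<theta> z) = act E l m \<theta> (w m z)" if "\<theta> \<in> Delta l m" "z \<in> simplices Z m" for l m \<theta> z
      using wR[OF partial_liftD(4)[OF R ex[OF that(2)] that(1)]] .
  qed
  show "p m (w m z) = v m z" if "z \<in> simplices Z m" for m z
    using partial_liftD(3)[OF R ex[OF that]] .
qed

text \<open>Attaching a single simplex along a horn. The assumptions \<open>horn\<close>,
  \<open>new\<close> and \<open>inj\<close> say that the preimage of the old domain under
  \<open>y : Delta[N] \<rightarrow> Z\<close> is exactly the horn and that \<open>y\<close> is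
  injective outside it. So the enlarged domain is a pushout of the horn inclusion, and a lift on
  Delta[N] descends to it.\<close>

lemma partial_lift_horn_extend:
  assumes E: "kan_fibration E Y p" and Z: "simplicial_set Z" and v: "v \<in> hom Z Y"
    and R: "partial_lift Z E p v R" and y: "y \<in> simplices Z N" and N: "N \<ge> 1" "k \<le> N"
    and horn: "\<And>m \<theta>. \<theta> \<in> simplices (horn N k) m \<Longrightarrow> (m, act Z m N \<theta> y) \<in> lift_dom R"
    and new: "\<And>m \<theta>. \<lbrakk>\<theta> \<in> Delta m N; \<theta> \<notin> simplices (horn N k) m\<rbrakk> \<Longrightarrow> (m, act Z m N \<theta> y) \<notin> lift_dom R"
    and inj: "\<And>m \<theta> \<theta>'. \<lbrakk>\<theta> \<in> Delta m N; \<theta> \<notin> simplices (horn N k) m; \<theta>' \<in> Delta m N;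
      \<theta>' \<notin> simplices (horn N k) m; act Z m N \<theta> y = act Z m N \<theta>' y\<rbrakk> \<Longrightarrow> \<theta> = \<theta>'"
  obtains R' where "R \<subseteq> R'" "partial_lift Z E p v R'"
    "lift_dom R' = lift_dom R \<union> {(m, act Z m N \<theta> y) |m \<theta>. \<theta> \<in> Delta m N}"
proof -
  have E': "simplicial_set E" "simplicial_set Y" "p \<in> hom E Y" using E by (auto simp: kan_fibration_def)
  note Rd = partial_liftD[OF R]
  have hD: "\<theta> \<in> Delta m N" if "\<theta> \<in> simplices (horn N k) m" for m \<theta> using that by (simp add: horn_simps)
  have hC: "compose {..l} \<theta> \<phi> \<in> simplices (horn N k) l" if "\<theta> \<in> simplices (horn N k) m" "\<phi> \<in> Delta l m" for l m \<theta> \<phi>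
    using act_closed[OF horn_sset that(2,1)] by (simp add: horn_simps(2))
  \<comment> \<open>The horn in \<open>E\<close> is read off from the graph; \<open>THE\<close> is
    legitimate because \<open>R\<close> is single-valued and defined on the image of the
    horn.\<close>
  define h where "h = (\<lambda>m. \<lambda>\<theta>\<in>simplices (horn N k) m. THE e. (m, act Z m N \<theta> y, e) \<in> R)"
  have h: "h m \<theta> = e" if \<theta>: "\<theta> \<in> simplices (horn N k) m" and e: "(m, act Z m N \<theta> y, e) \<in> R" for m \<theta> e
  proof -
    have "(THE e. (m, act Z m N \<theta> y, e) \<in> R) = e"
      using e Rd(5)[OF e] by (rule the_equality)
    then show ?thesis using \<theta> by (simp add: h_def)
  qed
  have hR: "(m, act Z m N \<theta> y, h m \<theta>) \<in> R" if \<theta>: "\<theta> \<in> simplices (horn N k) m" for m \<theta>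
  proof -
    obtain e where "(m, act Z m N \<theta> y, e) \<in> R" using horn[OF \<theta>] unfolding lift_dom_def by blast
    then show ?thesis using h[OF \<theta>] by metis
  qed
  have hh: "h \<in> hom (horn N k) E"
  proof (rule homI)
    show "h m \<in> extensional (simplices (horn N k) m)" for m by (simp add: h_def)
    show "h m \<theta> \<in> simplices E m" if "\<theta> \<in> simplices (horn N k) m" for m \<theta> using Rd(2)[OF hR[OF that]] .
    show "h l (act (horn N k) l m \<phi> \<theta>) = act E l m \<phi> (h m \<theta>)"
      if \<phi>: "\<phi> \<in> Delta l m" and \<theta>: "\<theta> \<in> simplices (horn N k) m" for l m \<phi> \<theta>
    proof -
      have "(l, act Z l N (compose {..l} \<theta> \<phi>) y, act E l m \<phi> (h m \<theta>)) \<in> R"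
        using Rd(4)[OF hR[OF \<theta>] \<phi>] by (simp add: act_comp[OF Z \<phi> hD[OF \<theta>] y])
      then show ?thesis using h[OF hC[OF \<theta> \<phi>]] by (simp add: horn_simps(2))
    qed
  qed
  define v' where "v' = smap_comp (std_simplex N) v (classify Z N y)"
  have v'h: "v' \<in> hom (std_simplex N) Y"
    unfolding v'_def by (rule smap_comp_hom[OF std_simplex_sset classify_hom[OF Z y] v])
  have v'a: "v' m \<theta> = v m (act Z m N \<theta> y)" if "\<theta> \<in> Delta m N" for m \<theta>
    using that by (simp add: v'_def smap_comp_apply classify_def)
  have "smap_comp (horn N k) p h = smap_restrict v' (horn N k)"
  proof (rule smap_eqI[where X = "horn N k"])
    fix m \<theta> assume \<theta>: "\<theta> \<in> simplices (horn N k) m"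
    then show "smap_comp (horn N k) p h m \<theta> = smap_restrict v' (horn N k) m \<theta>"
      using Rd(3)[OF hR[OF \<theta>]] by (simp add: smap_comp_apply smap_restrict_def v'a[OF hD])
  qed (simp_all add: smap_comp_ext smap_restrict_def)
  then obtain w where w: "w \<in> hom (std_simplex N) E" "smap_restrict w (horn N k) = h"
    "smap_comp (std_simplex N) p w = v'"
    using E N hh v'h unfolding kan_fibration_def by blast
  have wh: "w m \<theta> = h m \<theta>" if "\<theta> \<in> simplices (horn N k) m" for m \<theta>
    using w(2) that by (auto simp: smap_restrict_def)
  have wR: "e = w m \<theta>" if \<theta>: "\<theta> \<in> Delta m N" and e: "(m, act Z m N \<theta> y, e) \<in> R" for m \<theta> e
  proof -
    have "\<theta> \<in> simplices (horn N k) m" using new[OF \<theta>] e unfolding lift_dom_def by blast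
    then show ?thesis using wh h e by metis
  qed
  \<comment> \<open>The new value does not depend on the operator that presents a simplex: inside
    the old domain both values come from \<open>R\<close>, and outside it both operators lie off the
    horn, where \<open>inj\<close> makes them equal.\<close>
  have ww: "w m \<theta> = w m \<theta>'" if \<theta>: "\<theta> \<in> Delta m N" "\<theta>' \<in> Delta m N" and eq: "act Z m N \<theta> y = act Z m N \<theta>' y" for m \<theta> \<theta>'
  proof (cases "(m, act Z m N \<theta> y) \<in> lift_dom R")
    case True
    then obtain e where "(m, act Z m N \<theta> y, e) \<in> R" unfolding lift_dom_def by blast
    then show ?thesis using wR \<theta> eq by metis
  next
    case False
    then show ?thesis using inj[OF \<theta>(1) _ \<theta>(2) _ eq] horn eq by metis
  qed
  define R' where "R' = R \<union> {(m, act Z m N \<theta> y, w m \<theta>) |m \<theta>. \<theta> \<in> Delta m N}"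
  show thesis
  proof (rule that)
    show "R \<subseteq> R'" by (simp add: R'_def)
    show "lift_dom R' = lift_dom R \<union> {(m, act Z m N \<theta> y) |m \<theta>. \<theta> \<in> Delta m N}"
      unfolding R'_def lift_dom_def by blast
    show "partial_lift Z E p v R'"
      unfolding partial_lift_def
    proof (rule conjI; intro allI impI)
      fix m z e assume "(m, z, e) \<in> R'"
      then consider "(m, z, e) \<in> R" | \<theta> where "\<theta> \<in> Delta m N" "z = act Z m N \<theta> y" "e = w m \<theta>"
        unfolding R'_def by blast
      then show "z \<in> simplices Z m \<and> e \<in> simplices E m \<and> p m e = v m z \<and>
        (\<forall>l. \<forall>\<theta>\<in>Delta l m. (l, act Z l m \<theta> z, act E l m \<theta> e) \<in> R')"
      proof cases
        case 1
        then show ?thesis using Rd[OF 1] unfolding R'_def by blast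
      next
        case 2
        have "p m (w m \<theta>) = v' m \<theta>" using w(3) 2(1) by (auto simp: smap_comp_apply[symmetric])
        moreover have "(l, act Z l m \<phi> z, act E l m \<phi> e) \<in> R'" if \<phi>: "\<phi> \<in> Delta l m" for l \<phi>
        proof -
          have "act E l m \<phi> e = w l (compose {..l} \<theta> \<phi>)"
            using hom_nat[OF w(1) \<phi>, of \<theta>] 2 by simp
          then show ?thesis
            using act_comp[OF Z \<phi> 2(1) y] Delta_comp[OF 2(1) \<phi>] unfolding R'_def 2 by auto
        qed
        ultimately show ?thesis
          using act_closed[OF Z 2(1) y] hom_closed[OF w(1), of \<theta> m] 2 by (simp add: v'a)
      qed
    next
      fix m z e e' assume e: "(m, z, e) \<in> R'" "(m, z, e') \<in> R'"
      have *: "(m, z, x) \<in> R \<or> (\<exists>\<theta>\<in>Delta m N. z = act Z m N \<theta> y \<and> x = w m \<theta>)" if "(m, z, x) \<in> R'" for x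
        using that unfolding R'_def by blast
      show "e = e'"
        using *[OF e(1)] *[OF e(2)] Rd(5)[of m z e e'] wR ww by metis
    qed
  qed
qed

section \<open>Prisms\<close>

text \<open>Together \<open>degen n i\<close> and \<open>cut (Suc n) i\<close> are the staircase
  (0,0), ..., (i,0), (i,1), ..., (n,1), the i-th nondegenerate (n+1)-simplex of the prism Delta[n] x
  Delta[1].\<close>

definition degen :: "nat \<Rightarrow> nat \<Rightarrow> nat \<Rightarrow> nat" where
  "degen n i = (\<lambda>j\<in>{..Suc n}. if j \<le> i then j else j - 1)"

definition cut :: "nat \<Rightarrow> nat \<Rightarrow> nat \<Rightarrow> nat" where
  "cut n i = (\<lambda>j\<in>{..n}. if j \<le> i then 0 else 1)"

definition const_op :: "nat \<Rightarrow> nat \<Rightarrow> nat \<Rightarrow> nat" where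
  "const_op m c = (\<lambda>j\<in>{..m}. c)"

lemma DeltaI:
  "\<lbrakk>\<And>j. j \<le> m \<Longrightarrow> \<theta> j \<le> n; \<And>j. j > m \<Longrightarrow> \<theta> j = undefined; \<And>i j. \<lbrakk>i \<le> j; j \<le> m\<rbrakk> \<Longrightarrow> \<theta> i \<le> \<theta> j\<rbrakk> \<Longrightarrow> \<theta> \<in> Delta m n"
  by (auto simp: Delta_def mono_on_def PiE_iff extensional_def)

lemma DeltaD:
  assumes "\<theta> \<in> Delta m n"
  shows "j \<le> m \<Longrightarrow> \<theta> j \<le> n" "j > m \<Longrightarrow> \<theta> j = undefined" "\<lbrakk>i \<le> j; j \<le> m\<rbrakk> \<Longrightarrow> \<theta> i \<le> \<theta> j"
  using assms by (auto simp: Delta_def mono_on_def PiE_iff extensional_def)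

lemma Delta_eqI:
  assumes "\<theta> \<in> Delta m n" "\<phi> \<in> Delta m k" "\<And>j. j \<le> m \<Longrightarrow> \<theta> j = \<phi> j"
  shows "\<theta> = \<phi>"
  by (metis assms DeltaD(2) ext not_le)

lemma compose_apply: "j \<le> m \<Longrightarrow> compose {..m} \<theta> \<phi> j = \<theta> (\<phi> j)"
  by (simp add: compose_def)

lemma degen_Delta: "i \<le> n \<Longrightarrow> degen n i \<in> Delta (Suc n) n"
  by (intro DeltaI) (auto simp: degen_def)

lemma cut_Delta: "cut n i \<in> Delta n 1"
  by (intro DeltaI) (auto simp: cut_def)

lemma const_Delta: "c \<le> n \<Longrightarrow> const_op m c \<in> Delta m n"
  by (intro DeltaI) (auto simp: const_op_def)

lemma compose_const: "\<theta> \<in> Delta l m \<Longrightarrow> compose {..l} (const_op m c) \<theta> = const_op l c"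
  by (rule ext) (auto simp: const_op_def compose_def dest: DeltaD(1))

text \<open>Each step of a staircase raises exactly one coordinate by one, so the position of a
  vertex is the sum of its coordinates. Hence an operator can be recovered from its two components
  in the prism.\<close>

lemma degen_cut_sum:
  assumes "\<theta> \<in> Delta m (Suc n)" "i \<le> n" "j \<le> m"
  shows "\<theta> j = compose {..m} (degen n i) \<theta> j + compose {..m} (cut (Suc n) i) \<theta> j"
  using DeltaD(1)[OF assms(1,3)] assms(3) by (auto simp: degen_def cut_def compose_apply)

text \<open>The staircases i and i+1 differ only at vertex i+1, which is (i,1) on one and (i+1,0) on
  the other; they share the face opposite to it.\<close>

lemma degen_cut_shift:
  assumes "\<theta> \<in> Delta m (Suc n)" "Suc i \<notin> \<theta> ` {..m}"
  shows "compose {..m} (degen n i) \<theta> = compose {..m} (degen n (Suc i)) \<theta>"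
    "compose {..m} (cut (Suc n) i) \<theta> = compose {..m} (cut (Suc n) (Suc i)) \<theta>"
proof -
  have "\<theta> j \<noteq> Suc i" if "j \<le> m" for j using assms(2) that by (metis atMost_iff imageI)
  then show "compose {..m} (degen n i) \<theta> = compose {..m} (degen n (Suc i)) \<theta>"
    "compose {..m} (cut (Suc n) i) \<theta> = compose {..m} (cut (Suc n) (Suc i)) \<theta>"
    using DeltaD(1)[OF assms(1)] by (auto simp: fun_eq_iff degen_def cut_def compose_def le_Suc_eq)
qed

text \<open>Every chain in [n] x [1] lies on a staircase: it may cross anywhere between the last
  first coordinate at height 0 and the earliest one at height 1.\<close>

lemma prism_cover:
  assumes \<rho>: "\<rho> \<in> Delta m n" and \<chi>: "\<chi> \<in> Delta m 1"
  obtains i \<theta> where "i \<le> n" "\<theta> \<in> Delta m (Suc n)" "compose {..m} (degen n i) \<theta> = \<rho>"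
    "compose {..m} (cut (Suc n) i) \<theta> = \<chi>"
proof -
  note r = DeltaD[OF \<rho>] and c = DeltaD[OF \<chi>]
  \<comment> \<open>The crossing is put at the largest first coordinate at height 0; the inserted 0
    serves chains that lie wholly at height 1.\<close>
  define i where "i = Max (insert 0 (\<rho> ` {j. j \<le> m \<and> \<chi> j = 0}))"
  have fin: "finite (insert 0 (\<rho> ` {j. j \<le> m \<and> \<chi> j = 0}))" by simp
  have lo: "\<rho> j \<le> i" if "j \<le> m" "\<chi> j = 0" for j
    unfolding i_def using that by (intro Max_ge[OF fin]) auto
  have hi: "i \<le> \<rho> j" if j: "j \<le> m" "\<chi> j = 1" for j
  proof -
    have "\<rho> l \<le> \<rho> j" if "l \<le> m" "\<chi> l = 0" for l
      using that j r(3)[of l j] c(3)[of j l] by (cases "l \<le> j") auto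
    then show ?thesis unfolding i_def by (subst Max_le_iff[OF fin]) auto
  qed
  have i: "i \<le> n" unfolding i_def using r(1) by (subst Max_le_iff[OF fin]) auto
  have c01: "\<chi> j = 0 \<or> \<chi> j = 1" if "j \<le> m" for j using c(1)[OF that] by auto
  \<comment> \<open>By \<open>degen_cut_sum\<close> this is the only candidate.\<close>
  define \<theta> where "\<theta> = (\<lambda>j\<in>{..m}. \<rho> j + \<chi> j)"
  have \<theta>: "\<theta> \<in> Delta m (Suc n)"
  proof (rule DeltaI)
    show "\<theta> j \<le> Suc n" if "j \<le> m" for j using r(1)[OF that] c(1)[OF that] that by (simp add: \<theta>_def)
    show "\<theta> j \<le> \<theta> l" if "j \<le> l" "l \<le> m" for j l
      using r(3)[OF that] c(3)[OF that] that by (simp add: \<theta>_def)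
  qed (simp add: \<theta>_def)
  show thesis
  proof (rule that[OF i \<theta>])
    show "compose {..m} (degen n i) \<theta> = \<rho>"
    proof (rule Delta_eqI[OF Delta_comp[OF degen_Delta[OF i] \<theta>] \<rho>])
      fix j assume j: "j \<le> m"
      show "compose {..m} (degen n i) \<theta> j = \<rho> j"
        using c01[OF j] lo[OF j] hi[OF j] r(1)[OF j] j by (auto simp: compose_apply degen_def \<theta>_def)
    qed
    show "compose {..m} (cut (Suc n) i) \<theta> = \<chi>"
    proof (rule Delta_eqI[OF Delta_comp[OF cut_Delta \<theta>] \<chi>])
      fix j assume j: "j \<le> m"
      show "compose {..m} (cut (Suc n) i) \<theta> j = \<chi> j"
        using c01[OF j] lo[OF j] hi[OF j] r(1)[OF j] j by (auto simp: compose_apply cut_def \<theta>_def)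
    qed
  qed
qed

section \<open>Faces, sections and nondegenerate simplices\<close>

text \<open>Deleting the value \<open>c\<close> from the codomain factors \<rho> through a coface.
  This carries the induction on dimension in \<open>cylinder_lift\<close>, where all non-surjective
  operators have to be covered.\<close>

lemma Delta_factor_face:
  assumes \<rho>: "\<rho> \<in> Delta m n" and c: "c \<le> n" "c \<notin> \<rho> ` {..m}"
  obtains n' \<delta> \<psi> where "n = Suc n'" "\<delta> \<in> Delta n' n" "\<psi> \<in> Delta m n'" "\<rho> = compose {..m} \<delta> \<psi>"
proof -
  note r = DeltaD[OF \<rho>]
  have ne: "\<rho> j \<noteq> c" if "j \<le> m" for j using c(2) that by (metis atMost_iff imageI)
  obtain n' where n: "n = Suc n'"
    using ne[of 0] r(1)[of 0] c(1) by (cases n) auto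
  define \<delta> where "\<delta> = (\<lambda>j\<in>{..n'}. if j < c then j else Suc j)"
  define \<psi> where "\<psi> = (\<lambda>j\<in>{..m}. if \<rho> j < c then \<rho> j else \<rho> j - 1)"
  have \<delta>: "\<delta> \<in> Delta n' n" by (intro DeltaI) (auto simp: \<delta>_def n)
  have le: "\<rho> j \<le> n" if "j \<le> m" for j using r(1) that by blast
  have \<psi>: "\<psi> \<in> Delta m n'"
  proof (rule DeltaI)
    show "\<psi> j \<le> n'" if "j \<le> m" for j using le[OF that] ne[OF that] c that by (auto simp: \<psi>_def n)
    show "\<psi> i \<le> \<psi> j" if "i \<le> j" "j \<le> m" for i j using r(3)[OF that] that by (auto simp: \<psi>_def)
  qed (simp add: \<psi>_def)
  have "\<rho> = compose {..m} \<delta> \<psi>"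
  proof (rule Delta_eqI[OF \<rho> Delta_comp[OF \<delta> \<psi>]])
    fix j assume j: "j \<le> m"
    show "\<rho> j = compose {..m} \<delta> \<psi> j"
      using j ne[OF j] le[OF j] c(1) by (auto simp: compose_apply \<delta>_def \<psi>_def n)
  qed
  then show thesis using that n \<delta> \<psi> by blast
qed

lemma Delta_section:
  assumes \<rho>: "\<rho> \<in> Delta m n" and surj: "{..n} \<subseteq> \<rho> ` {..m}" and j0: "j0 \<le> m"
  obtains s where "s \<in> Delta n m" "compose {..n} \<rho> s = restrict id {..n}" "s (\<rho> j0) = j0"
proof -
  note r = DeltaD[OF \<rho>]
  define s where "s = (\<lambda>c\<in>{..n}. if c = \<rho> j0 then j0 else (SOME j. j \<le> m \<and> \<rho> j = c))"
  have s: "s c \<le> m \<and> \<rho> (s c) = c" if c: "c \<le> n" for c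
  proof (cases "c = \<rho> j0")
    case True
    then show ?thesis using c j0 by (simp add: s_def)
  next
    case False
    have "\<exists>j. j \<le> m \<and> \<rho> j = c" using surj c by force
    then have "(SOME j. j \<le> m \<and> \<rho> j = c) \<le> m \<and> \<rho> (SOME j. j \<le> m \<and> \<rho> j = c) = c" by (rule someI_ex)
    then show ?thesis using False c by (simp add: s_def)
  qed
  have sD: "s \<in> Delta n m"
  proof (rule DeltaI)
    \<comment> \<open>Any choice of preimages is monotone: for \<open>i < j\<close>, having
      \<open>s j \<le> s i\<close> would give \<open>j \<le> i\<close> on applying \<rho>.\<close>
    show "s i \<le> s j" if "i \<le> j" "j \<le> n" for i j
      using s[of i] s[of j] that r(3)[of "s j" "s i"] by (cases "i = j"; cases "s i \<le> s j") auto
  qed (use s in \<open>simp_all add: s_def\<close>)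
  moreover have "compose {..n} \<rho> s = restrict id {..n}"
    using s by (auto simp: fun_eq_iff compose_def)
  moreover have "s (\<rho> j0) = j0" using r(1)[OF j0] by (simp add: s_def)
  ultimately show thesis by (rule that)
qed

lemma Delta_surj_id:
  assumes \<phi>: "\<phi> \<in> Delta n n" and surj: "{..n} \<subseteq> \<phi> ` {..n}"
  shows "\<phi> = restrict id {..n}"
proof (rule Delta_eqI[OF \<phi> Delta_id])
  note p = DeltaD[OF \<phi>]
  have im: "\<phi> ` {..n} = {..n}" using surj p(1) by auto
  have inj: "inj_on \<phi> {..n}" by (rule eq_card_imp_inj_on) (simp_all add: im)
  have "\<phi> j = j" if "j \<le> n" for j
    using that
  proof (induction j rule: less_induct)
    case (less j)
    obtain l where l: "l \<le> n" "\<phi> l = j" using surj less.prems by force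
    have "l \<ge> j" using less.IH[of l] l by (cases "l < j") auto
    then have "\<phi> j \<le> j" using p(3)[of j l] l by simp
    moreover have "\<phi> j \<noteq> i" if "i < j" for i
      using less.IH[of i] that less.prems inj_onD[OF inj, of j i] by auto
    ultimately show ?case by (metis le_neq_implies_less)
  qed
  then show "\<phi> j = restrict id {..n} j" if "j \<le> n" for j using that by simp
qed

text \<open>A substitute for the Eilenberg--Zilber lemma: composing with a section of \<open>\<rho>\<close> through a given vertex
  yields an operator fixing \<open>x\<close>, hence the identity.\<close>

lemma act_surj_cancel:
  assumes X: "simplicial_set X" and x: "x \<in> simplices X n"
    and nondegen: "\<And>\<phi>. \<phi> \<in> Delta n n \<Longrightarrow> act X n n \<phi> x = x \<Longrightarrow> {..n} \<subseteq> \<phi> ` {..n}"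
    and \<rho>: "\<rho> \<in> Delta m n" "{..n} \<subseteq> \<rho> ` {..m}" and \<rho>': "\<rho>' \<in> Delta m n"
    and eq: "act X m n \<rho> x = act X m n \<rho>' x"
  shows "\<rho> = \<rho>'"
proof (rule Delta_eqI[OF \<rho>(1) \<rho>'])
  fix j assume j: "j \<le> m"
  obtain s where s: "s \<in> Delta n m" "compose {..n} \<rho> s = restrict id {..n}" "s (\<rho> j) = j"
    by (rule Delta_section[OF \<rho> j])
  have "act X n n (compose {..n} \<rho>' s) x = act X n n (compose {..n} \<rho> s) x"
    unfolding act_comp[OF X s(1) \<rho>' x] act_comp[OF X s(1) \<rho>(1) x] eq ..
  also have "\<dots> = x" unfolding s(2) by (rule act_id[OF X x])
  finally have "compose {..n} \<rho>' s = restrict id {..n}"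
    using Delta_surj_id[OF Delta_comp[OF \<rho>' s(1)]] nondegen[OF Delta_comp[OF \<rho>' s(1)]] by blast
  moreover have n: "\<rho> j \<le> n" using DeltaD(1)[OF \<rho>(1) j] .
  ultimately have "\<rho>' (s (\<rho> j)) = \<rho> j"
    by (metis atMost_iff compose_apply id_apply restrict_apply')
  then show "\<rho> j = \<rho>' j" by (simp add: s(3))
qed

section \<open>Lifting against cylinders\<close>

abbreviation cylinder :: "'x sset \<Rightarrow> ('x \<times> (nat \<Rightarrow> nat)) sset" where
  "cylinder X \<equiv> sprod X (std_simplex 1)"

text \<open>The prism simplices \<open>y i\<close> below are attached in the order \<open>i = n, \<dots>, 0\<close> if the end \<open>e = 0\<close> is given, and
  \<open>i = 0, \<dots>, n\<close> if \<open>e = 1\<close>; in both cases the faces of \<open>y i\<close> already present form a horn.\<close>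

lemma prism_extend:
  assumes E: "kan_fibration E Y p" and X: "simplicial_set X" and v: "v \<in> hom (cylinder X) Y"
    and e: "e \<le> 1" and R: "partial_lift (cylinder X) E p v R" and x: "x \<in> simplices X n"
    and dom: "\<And>m z \<chi>. (m, z, \<chi>) \<in> lift_dom R \<longleftrightarrow>
      z \<in> simplices X m \<and> \<chi> \<in> Delta m 1 \<and> (z \<in> S m \<or> \<chi> = const_op m e)"
    and S: "\<And>l m \<theta> z. \<lbrakk>z \<in> simplices X m; z \<in> S m; \<theta> \<in> Delta l m\<rbrakk> \<Longrightarrow> act X l m \<theta> z \<in> S l"
    and xS: "x \<notin> S n"
    and faces: "\<And>m \<rho>. \<lbrakk>\<rho> \<in> Delta m n; \<not> {..n} \<subseteq> \<rho> ` {..m}\<rbrakk> \<Longrightarrow> act X m n \<rho> x \<in> S m"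
  obtains R' where "R \<subseteq> R'" "partial_lift (cylinder X) E p v R'"
    "lift_dom R' = lift_dom R \<union> {(m, act X m n \<rho> x, \<chi>) |m \<rho> \<chi>. \<rho> \<in> Delta m n \<and> \<chi> \<in> Delta m 1}"
proof -
  let ?Z = "cylinder X"
  have Z: "simplicial_set ?Z" by (rule sprod_sset[OF X std_simplex_sset])
  have act_in: "act X m n \<rho> x \<in> simplices X m" if "\<rho> \<in> Delta m n" for m \<rho> by (rule act_closed[OF X that x])
  \<comment> \<open>A surjective operator has a section, which would carry this simplex back to
    \<open>x\<close> and so put \<open>x\<close> into the closed family \<open>S\<close>.\<close>
  have surjS: "act X m n \<rho> x \<notin> S m" if \<rho>: "\<rho> \<in> Delta m n" "{..n} \<subseteq> \<rho> ` {..m}" for m \<rho>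
  proof
    assume a: "act X m n \<rho> x \<in> S m"
    obtain s where s: "s \<in> Delta n m" "compose {..n} \<rho> s = restrict id {..n}"
      using Delta_section[OF \<rho>, of 0] by blast
    have "act X n m s (act X m n \<rho> x) = x"
      unfolding act_comp[OF X s(1) \<rho>(1) x, symmetric] s(2) by (rule act_id[OF X x])
    then show False using S[OF act_in[OF \<rho>(1)] a s(1)] xS by simp
  qed
  \<comment> \<open>An operator that fixes \<open>x\<close> is surjective, since otherwise
    \<open>faces\<close> would place \<open>x\<close> in \<open>S\<close>; this is the nondegeneracy
    asked for by \<open>act_surj_cancel\<close>.\<close>
  have cancel: "\<rho> = \<rho>'" if "\<rho> \<in> Delta m n" "{..n} \<subseteq> \<rho> ` {..m}" "\<rho>' \<in> Delta m n"
    "act X m n \<rho> x = act X m n \<rho>' x" for m \<rho> \<rho>'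
    using act_surj_cancel[OF X x _ that] faces xS by metis
  \<comment> \<open>\<open>y i\<close> is the i-th staircase over \<open>x\<close>.
    \<open>g i m \<theta>\<close> is its restriction along \<theta>, written out in both coordinates
    because membership in the domain is tested on them separately.\<close>
  define y where "y i = (act X (Suc n) n (degen n i) x, cut (Suc n) i)" for i
  define g where "g i m \<theta> = (act X m n (compose {..m} (degen n i) \<theta>) x, compose {..m} (cut (Suc n) i) \<theta>)" for i m \<theta>
  have y: "y i \<in> simplices ?Z (Suc n)" if "i \<le> n" for i
    unfolding y_def using act_closed[OF X degen_Delta[OF that] x] cut_Delta by simp
  have gy: "act ?Z m (Suc n) \<theta> (y i) = g i m \<theta>" if "i \<le> n" "\<theta> \<in> Delta m (Suc n)" for i m \<theta>
    unfolding y_def g_def using act_comp[OF X that(2) degen_Delta[OF that(1)] x] by simp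
  \<comment> \<open>The staircases present after \<open>t\<close> steps: the \<open>t\<close>
    largest indices for \<open>e = 0\<close>, the \<open>t\<close> smallest for
    \<open>e = 1\<close>.\<close>
  define I where "I t = (if e = 0 then {i. i \<le> n \<and> n < i + t} else {i. i < t})" for t
  have "\<exists>R'. R \<subseteq> R' \<and> partial_lift ?Z E p v R' \<and>
    lift_dom R' = lift_dom R \<union> {(m, g i m \<theta>) |m i \<theta>. i \<in> I t \<and> \<theta> \<in> Delta m (Suc n)}" if "t \<le> Suc n" for t
    using that
  proof (induction t)
    case 0
    have "I 0 = {}" by (auto simp: I_def)
    then show ?case using R by auto
  next
    case (Suc t)
    then obtain R' where R': "R \<subseteq> R'" "partial_lift ?Z E p v R'"
      "lift_dom R' = lift_dom R \<union> {(m, g i m \<theta>) |m i \<theta>. i \<in> I t \<and> \<theta> \<in> Delta m (Suc n)}" by auto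
    define i where "i = (if e = 0 then n - t else t)"
    \<comment> \<open>The open face of the horn. For \<open>e = 0\<close>, face \<open>Suc i\<close>
      of \<open>y i\<close> is shared with \<open>y (Suc i)\<close>, or lies in the given end if
      \<open>i = n\<close>, while face \<open>i\<close> is still missing. For \<open>e = 1\<close>
      the roles are exchanged: face \<open>i\<close> is present and face \<open>Suc i\<close> is
      missing.\<close>
    define k where "k = (if e = 0 then i else Suc i)"
    have i: "i \<le> n" using Suc.prems by (auto simp: i_def)
    have k: "k \<le> Suc n" using i by (auto simp: k_def)
    have I: "I (Suc t) = insert i (I t)" using Suc.prems by (auto simp: I_def i_def)
    have In: "i' \<le> n" if "i' \<in> I t" for i' using that Suc.prems by (auto simp: I_def split: if_splits)
    have In': "i < i'" if "i' \<in> I t" "e = 0" for i' using that Suc.prems by (auto simp: I_def i_def)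
    have In'': "i' < i" if "i' \<in> I t" "e \<noteq> 0" for i' using that Suc.prems by (auto simp: I_def i_def)
    have Iup: "Suc i \<in> I t" if "e = 0" "i < n" using that Suc.prems by (auto simp: I_def i_def)
    have Idown: "i - 1 \<in> I t" if "e \<noteq> 0" "i > 0" using that Suc.prems by (auto simp: I_def i_def)
    have dc: "compose {..m} (degen n i) \<theta> \<in> Delta m n" "compose {..m} (cut (Suc n) i) \<theta> \<in> Delta m 1"
      if "\<theta> \<in> Delta m (Suc n)" "i \<le> n" for i m \<theta>
      using Delta_comp[OF degen_Delta that(1)] Delta_comp[OF cut_Delta that(1)] that(2) by auto
    have horn_mem: "j \<in> \<theta> ` {..m}" if "\<theta> \<in> Delta m (Suc n)" "\<theta> \<notin> simplices (horn (Suc n) k) m" "j \<le> Suc n" "j \<noteq> k"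
      for j m \<theta> using that by (auto simp: horn_simps)
    \<comment> \<open>Off the horn every vertex except \<open>k\<close> is hit. Since
      \<open>degen n i\<close> identifies \<open>i\<close> with \<open>Suc i\<close> and
      \<open>k\<close> is one of these two, all of [n] is still reached.\<close>
    have surj: "{..n} \<subseteq> compose {..m} (degen n i) \<theta> ` {..m}"
      if \<theta>: "\<theta> \<in> Delta m (Suc n)" "\<theta> \<notin> simplices (horn (Suc n) k) m" for m \<theta>
    proof
      fix c assume c: "c \<in> {..n}"
      define j where "j = (if c < i then c else if c > i then Suc c else if k = i then Suc i else i)"
      have "j \<le> Suc n" "j \<noteq> k" using c by (auto simp: j_def k_def)
      then obtain l where l: "l \<le> m" "\<theta> l = j" using horn_mem[OF \<theta>] by (metis atMost_iff imageE)
      have "compose {..m} (degen n i) \<theta> l = c"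
        using l c i by (auto simp: compose_apply degen_def j_def k_def)
      then show "c \<in> compose {..m} (degen n i) \<theta> ` {..m}" using l(1) by force
    qed
    \<comment> \<open>The partner of \<open>k\<close> among \<open>i\<close> and
      \<open>Suc i\<close> is hit, and its height is not \<open>e\<close>.\<close>
    have ne: "compose {..m} (cut (Suc n) i) \<theta> \<noteq> const_op m e"
      if \<theta>: "\<theta> \<in> Delta m (Suc n)" "\<theta> \<notin> simplices (horn (Suc n) k) m" for m \<theta>
    proof -
      define j where "j = (if e = 0 then Suc i else i)"
      have "j \<le> Suc n" "j \<noteq> k" using i by (auto simp: j_def k_def)
      then obtain l where l: "l \<le> m" "\<theta> l = j" using horn_mem[OF \<theta>] by (metis atMost_iff imageE)
      then have "compose {..m} (cut (Suc n) i) \<theta> l \<noteq> const_op m e l"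
        using i by (auto simp: compose_apply cut_def j_def const_op_def)
      then show ?thesis by metis
    qed
    obtain R'' where R'': "R' \<subseteq> R''" "partial_lift ?Z E p v R''"
      "lift_dom R'' = lift_dom R' \<union> {(m, act ?Z m (Suc n) \<theta> (y i)) |m \<theta>. \<theta> \<in> Delta m (Suc n)}"
    proof (rule partial_lift_horn_extend[OF E Z v R'(2) y[OF i] _ k])
      show "1 \<le> Suc n" by simp
    next
      fix m \<theta> assume \<theta>': "\<theta> \<in> simplices (horn (Suc n) k) m"
      then obtain j where \<theta>: "\<theta> \<in> Delta m (Suc n)" and j: "j \<le> Suc n" "j \<noteq> k" "j \<notin> \<theta> ` {..m}"
        by (auto simp: horn_simps)
      have ne: "\<theta> l \<noteq> j" if "l \<le> m" for l using j(3) that by (metis atMost_iff imageI)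
      let ?\<rho> = "compose {..m} (degen n i) \<theta>" and ?\<chi> = "compose {..m} (cut (Suc n) i) \<theta>"
      have ing: "g i m \<theta> \<in> simplices ?Z m" using dc[OF \<theta> i] act_in by (simp add: g_def)
      \<comment> \<open>The face opposite a vertex other than \<open>i\<close> and
        \<open>Suc i\<close> projects into the boundary of \<open>x\<close>; of these two vertices
        only the one different from \<open>k\<close> remains.\<close>
      consider "\<not> {..n} \<subseteq> ?\<rho> ` {..m}" | "j = Suc i" "e = 0" | "j = i" "e \<noteq> 0"
      proof (cases "j = i \<or> j = Suc i")
        case True
        then show thesis using that j(2) by (auto simp: k_def split: if_splits)
      next
        case False
        define c where "c = (if j < i then j else j - 1)"
        have "c \<le> n" using j(1) i by (auto simp: c_def)
        moreover have "?\<rho> l \<noteq> c" if "l \<le> m" for l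
          using that ne[OF that] False DeltaD(1)[OF \<theta> that] by (auto simp: compose_apply degen_def c_def)
        ultimately have "\<not> {..n} \<subseteq> ?\<rho> ` {..m}" by fastforce
        then show thesis by (rule that(1))
      qed
      then have "(m, g i m \<theta>) \<in> lift_dom R'"
      proof cases
        case 1
        then have "act X m n ?\<rho> x \<in> S m" by (rule faces[OF dc(1)[OF \<theta> i]])
        then show ?thesis using dc[OF \<theta> i] act_in R'(3) dom by (simp add: g_def)
      next
        case 2
        show ?thesis
        proof (cases "i < n")
          case True
          have "g i m \<theta> = g (Suc i) m \<theta>" using degen_cut_shift[OF \<theta>, of i] j(3) 2 by (simp add: g_def)
          then show ?thesis using Iup[OF 2(2) True] \<theta> R'(3) by blast
        next
          case False
          have "?\<chi> = const_op m e"
          proof (rule Delta_eqI[OF dc(2)[OF \<theta> i] const_Delta[OF e]])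
            fix l assume l: "l \<le> m"
            show "?\<chi> l = const_op m e l"
              using DeltaD(1)[OF \<theta> l] ne[OF l] l False i 2 by (auto simp: compose_apply cut_def const_op_def)
          qed
          then show ?thesis using dc[OF \<theta> i] act_in R'(3) dom by (simp add: g_def)
        qed
      next
        case 3
        show ?thesis
        proof (cases "i > 0")
          case True
          then obtain i' where i': "i = Suc i'" by (cases i) auto
          have "g i' m \<theta> = g i m \<theta>" using degen_cut_shift[OF \<theta>, of i'] j(3) 3 i' by (simp add: g_def)
          then show ?thesis using Idown[OF 3(2) True] \<theta> R'(3) i' by force
        next
          case False
          have "?\<chi> = const_op m e"
          proof (rule Delta_eqI[OF dc(2)[OF \<theta> i] const_Delta[OF e]])
            fix l assume l: "l \<le> m"
            show "?\<chi> l = const_op m e l"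
              using DeltaD(1)[OF \<theta> l] ne[OF l] l False i 3 e by (auto simp: compose_apply cut_def const_op_def)
          qed
          then show ?thesis using dc[OF \<theta> i] act_in R'(3) dom by (simp add: g_def)
        qed
      qed
      then show "(m, act ?Z m (Suc n) \<theta> (y i)) \<in> lift_dom R'" unfolding gy[OF i \<theta>] .
    next
      fix m \<theta> assume \<theta>: "\<theta> \<in> Delta m (Suc n)" and nh: "\<theta> \<notin> simplices (horn (Suc n) k) m"
      let ?\<rho> = "compose {..m} (degen n i) \<theta>" and ?\<chi> = "compose {..m} (cut (Suc n) i) \<theta>"
      note s = surj[OF \<theta> nh] and d = dc[OF \<theta> i]
      have "(m, g i m \<theta>) \<notin> lift_dom R"
        using surjS[OF d(1) s] ne[OF \<theta> nh] dom by (simp add: g_def)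
      \<comment> \<open>One vertex separates the new staircase from the earlier ones: (i,1) lies on
        no staircase \<open>i' > i\<close>, and (i,0) on no staircase \<open>i' < i\<close>. Off the
        horn this vertex is hit.\<close>
      moreover have False if i': "i' \<in> I t" and \<phi>: "\<phi> \<in> Delta m (Suc n)" and eq: "g i m \<theta> = g i' m \<phi>" for i' \<phi>
      proof -
        note d' = dc[OF \<phi> In[OF i']]
        have r: "?\<rho> = compose {..m} (degen n i') \<phi>"
          using cancel[OF d(1) s d'(1)] eq by (simp add: g_def)
        have c: "?\<chi> = compose {..m} (cut (Suc n) i') \<phi>" using eq by (simp add: g_def)
        define j where "j = (if e = 0 then Suc i else i)"
        have "j \<le> Suc n" "j \<noteq> k" using i by (auto simp: j_def k_def)
        then obtain l where l: "l \<le> m" "\<theta> l = j" using horn_mem[OF \<theta> nh] by (metis atMost_iff imageE)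
        have \<phi>l: "\<phi> l \<le> Suc n" using DeltaD(1)[OF \<phi> l(1)] .
        have 1: "degen n i (\<theta> l) = degen n i' (\<phi> l)" using fun_cong[OF r, of l] l(1) by (simp add: compose_apply)
        have 2: "cut (Suc n) i (\<theta> l) = cut (Suc n) i' (\<phi> l)" using fun_cong[OF c, of l] l(1) by (simp add: compose_apply)
        show False
        proof (cases "e = 0")
          case True
          then show False using 1 2 l(2) \<phi>l i In'[OF i' True]
            by (auto simp: degen_def cut_def j_def split: if_splits)
        next
          case False
          then show False using 1 2 l(2) \<phi>l i In''[OF i' False]
            by (auto simp: degen_def cut_def j_def split: if_splits)
        qed
      qed
      ultimately show "(m, act ?Z m (Suc n) \<theta> (y i)) \<notin> lift_dom R'"
        unfolding gy[OF i \<theta>] R'(3) by blast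
    next
      fix m \<theta> \<theta>' assume \<theta>: "\<theta> \<in> Delta m (Suc n)" and nh: "\<theta> \<notin> simplices (horn (Suc n) k) m"
        and \<theta>': "\<theta>' \<in> Delta m (Suc n)" and eq: "act ?Z m (Suc n) \<theta> (y i) = act ?Z m (Suc n) \<theta>' (y i)"
      have "g i m \<theta> = g i m \<theta>'" using eq gy i \<theta> \<theta>' by simp
      then have "compose {..m} (cut (Suc n) i) \<theta> = compose {..m} (cut (Suc n) i) \<theta>'"
        "compose {..m} (degen n i) \<theta> = compose {..m} (degen n i) \<theta>'"
        using cancel[OF dc(1)[OF \<theta> i] surj[OF \<theta> nh] dc(1)[OF \<theta>' i]] by (simp_all add: g_def)
      then show "\<theta> = \<theta>'"
        by (intro Delta_eqI[OF \<theta> \<theta>']) (simp add: degen_cut_sum[OF \<theta> i] degen_cut_sum[OF \<theta>' i])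
    qed blast
    have "{(m, act ?Z m (Suc n) \<theta> (y i)) |m \<theta>. \<theta> \<in> Delta m (Suc n)} = {(m, g i m \<theta>) |m \<theta>. \<theta> \<in> Delta m (Suc n)}"
      by (simp only: gy[OF i] cong: rev_conj_cong)
    then have "lift_dom R'' = lift_dom R \<union> ({(m, g i m \<theta>) |m i \<theta>. i \<in> I t \<and> \<theta> \<in> Delta m (Suc n)}
        \<union> {(m, g i m \<theta>) |m \<theta>. \<theta> \<in> Delta m (Suc n)})"
      unfolding R''(3) R'(3) Un_assoc by (rule arg_cong)
    also have "{(m, g i m \<theta>) |m i \<theta>. i \<in> I t \<and> \<theta> \<in> Delta m (Suc n)} \<union> {(m, g i m \<theta>) |m \<theta>. \<theta> \<in> Delta m (Suc n)}
        = {(m, g i m \<theta>) |m i \<theta>. i \<in> I (Suc t) \<and> \<theta> \<in> Delta m (Suc n)}"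
      unfolding I by blast
    finally have "lift_dom R'' = lift_dom R \<union> {(m, g i m \<theta>) |m i \<theta>. i \<in> I (Suc t) \<and> \<theta> \<in> Delta m (Suc n)}" .
    then show ?case using R''(2) order_trans[OF R'(1) R''(1)] by (intro exI[of _ R''] conjI)
  qed
  from this[of "Suc n"] obtain R' where R': "R \<subseteq> R'" "partial_lift ?Z E p v R'"
    "lift_dom R' = lift_dom R \<union> {(m, g i m \<theta>) |m i \<theta>. i \<in> I (Suc n) \<and> \<theta> \<in> Delta m (Suc n)}" by auto
  have I: "i \<in> I (Suc n) \<longleftrightarrow> i \<le> n" for i by (auto simp: I_def)
  have "{(m, g i m \<theta>) |m i \<theta>. i \<in> I (Suc n) \<and> \<theta> \<in> Delta m (Suc n)} =
      {(m, act X m n \<rho> x, \<chi>) |m \<rho> \<chi>. \<rho> \<in> Delta m n \<and> \<chi> \<in> Delta m 1}" (is "?L = ?R")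
  proof
    show "?L \<subseteq> ?R"
      using Delta_comp[OF degen_Delta] Delta_comp[OF cut_Delta] unfolding g_def I by blast
    show "?R \<subseteq> ?L"
    proof
      fix q assume "q \<in> ?R"
      then obtain m \<rho> \<chi> where q: "q = (m, act X m n \<rho> x, \<chi>)" "\<rho> \<in> Delta m n" "\<chi> \<in> Delta m 1" by blast
      from q(2,3) obtain i \<theta> where "i \<le> n" "\<theta> \<in> Delta m (Suc n)" "compose {..m} (degen n i) \<theta> = \<rho>"
        "compose {..m} (cut (Suc n) i) \<theta> = \<chi>" by (rule prism_cover)
      then show "q \<in> ?L" unfolding q(1) g_def I by blast
    qed
  qed
  then show thesis using that R' by simp
qed

lemma lift_dom_mono: "R \<subseteq> R' \<Longrightarrow> lift_dom R \<subseteq> lift_dom R'"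
  unfolding lift_dom_def by blast

text \<open>The cylinder is exhausted by attaching whole prisms; Zorn's lemma takes the place of an
  enumeration of the nondegenerate simplices of \<open>X\<close>.\<close>

lemma cylinder_lift:
  assumes E: "kan_fibration E Y p" and X: "simplicial_set X" and v: "v \<in> hom (cylinder X) Y"
    and e: "e \<le> 1" and R: "partial_lift (cylinder X) E p v R"
    and dom: "\<And>m z \<chi>. (m, z, \<chi>) \<in> lift_dom R \<longleftrightarrow>
      z \<in> simplices X m \<and> \<chi> \<in> Delta m 1 \<and> (z \<in> S m \<or> \<chi> = const_op m e)"
  obtains w where "w \<in> hom (cylinder X) E" "\<And>m z. z \<in> simplices (cylinder X) m \<Longrightarrow> p m (w m z) = v m z"
    "\<And>m z y. (m, z, y) \<in> R \<Longrightarrow> w m z = y"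
proof -
  let ?Z = "cylinder X"
  \<comment> \<open>Off the given end, a simplex of \<open>X\<close> contributes its full column or
    nothing. The clause keeps the domain of a maximal element in the shape required by
    \<open>prism_extend\<close>.\<close>
  define F where "F = {T. R \<subseteq> T \<and> partial_lift ?Z E p v T \<and> (\<forall>m z \<chi>. (m, z, \<chi>) \<in> lift_dom T \<longrightarrow>
    \<chi> = const_op m e \<or> (\<forall>\<chi>'\<in>Delta m 1. (m, z, \<chi>') \<in> lift_dom T))}"
  have RF: "R \<in> F" using R dom by (auto simp: F_def)
  have "\<exists>T\<in>F. \<forall>T'\<in>F. T \<subseteq> T' \<longrightarrow> T' = T"
  proof (rule subset_Zorn_nonempty)
    show "F \<noteq> {}" using RF by blast
  next
    fix C assume C: "C \<noteq> {}" "subset.chain F C"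
    then have CF: "T \<in> F" if "T \<in> C" for T using that unfolding subset.chain_def by blast
    have tot: "T \<subseteq> T' \<or> T' \<subseteq> T" if "T \<in> C" "T' \<in> C" for T T'
      using C that unfolding subset.chain_def by blast
    have PL: "partial_lift ?Z E p v T" if "T \<in> C" for T using CF[OF that] by (simp add: F_def)
    have "partial_lift ?Z E p v (\<Union>C)"
      unfolding partial_lift_def
    proof (rule conjI; intro allI impI)
      fix m z y assume "(m, z, y) \<in> \<Union>C"
      then obtain T where T: "T \<in> C" "(m, z, y) \<in> T" by blast
      show "z \<in> simplices ?Z m \<and> y \<in> simplices E m \<and> p m y = v m z \<and>
        (\<forall>l. \<forall>\<theta>\<in>Delta l m. (l, act ?Z l m \<theta> z, act E l m \<theta> y) \<in> \<Union>C)"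
        using partial_liftD(1-4)[OF PL[OF T(1)] T(2)] T(1) by blast
    next
      fix m z y y' assume "(m, z, y) \<in> \<Union>C" "(m, z, y') \<in> \<Union>C"
      then obtain T T' where T: "T \<in> C" "(m, z, y) \<in> T" "T' \<in> C" "(m, z, y') \<in> T'" by blast
      then have "\<exists>U\<in>C. (m, z, y) \<in> U \<and> (m, z, y') \<in> U" using tot[OF T(1,3)] by blast
      then show "y = y'" using partial_liftD(5)[OF PL] by blast
    qed
    moreover have "R \<subseteq> \<Union>C" using C(1) CF unfolding F_def by blast
    moreover have "\<chi> = const_op m e \<or> (\<forall>\<chi>'\<in>Delta m 1. (m, z, \<chi>') \<in> lift_dom (\<Union>C))"
      if z: "(m, z, \<chi>) \<in> lift_dom (\<Union>C)" for m z \<chi>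
    proof -
      obtain T where T: "T \<in> C" "(m, z, \<chi>) \<in> lift_dom T" using z unfolding lift_dom_def by blast
      then have "\<chi> = const_op m e \<or> (\<forall>\<chi>'\<in>Delta m 1. (m, z, \<chi>') \<in> lift_dom T)"
        using CF[OF T(1)] unfolding F_def by blast
      then show ?thesis using lift_dom_mono[of T "\<Union>C"] T(1) by blast
    qed
    ultimately show "\<Union>C \<in> F" by (simp add: F_def)
  qed
  then obtain T where T: "T \<in> F" and maximal: "\<And>T'. T' \<in> F \<Longrightarrow> T \<subseteq> T' \<Longrightarrow> T' = T" by blast
  have RT: "R \<subseteq> T" and TP: "partial_lift ?Z E p v T"
    and Tc: "\<And>m z \<chi> \<chi>'. \<lbrakk>(m, z, \<chi>) \<in> lift_dom T; \<chi> \<noteq> const_op m e; \<chi>' \<in> Delta m 1\<rbrakk> \<Longrightarrow> (m, z, \<chi>') \<in> lift_dom T"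
    using T unfolding F_def by blast+
  have Tin: "z \<in> simplices X m" "\<chi> \<in> Delta m 1" if "(m, z, \<chi>) \<in> lift_dom T" for m z \<chi>
    using that partial_liftD(1)[OF TP] unfolding lift_dom_def by fastforce+
  have base: "(m, z, const_op m e) \<in> lift_dom T" if "z \<in> simplices X m" for m z
    using dom[of m z "const_op m e"] that const_Delta[OF e] lift_dom_mono[OF RT] by blast
  define U where "U m = {z. \<forall>\<chi>\<in>Delta m 1. (m, z, \<chi>) \<in> lift_dom T}" for m
  have domT: "(m, z, \<chi>) \<in> lift_dom T \<longleftrightarrow>
      z \<in> simplices X m \<and> \<chi> \<in> Delta m 1 \<and> (z \<in> U m \<or> \<chi> = const_op m e)" for m z \<chi>
    using Tin[of m z \<chi>] Tc[of m z \<chi>] base[of z m] unfolding U_def by blast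
  \<comment> \<open>One simplex of the column is enough to detect \<open>U\<close>. The constant at
    the opposite end \<open>1 - e\<close> is chosen because it stays constant under every operator
    and never becomes \<open>const_op l e\<close>.\<close>
  have U: "act X l m \<theta> z \<in> U l" if z: "z \<in> U m" and \<theta>: "\<theta> \<in> Delta l m" for l m \<theta> z
  proof -
    have e': "1 - e \<le> 1" by simp
    have "(m, z, const_op m (1 - e)) \<in> lift_dom T" using z const_Delta[OF e'] unfolding U_def by blast
    from lift_dom_act[OF TP this \<theta>] have 1: "(l, act X l m \<theta> z, const_op l (1 - e)) \<in> lift_dom T"
      by (simp add: compose_const[OF \<theta>])
    have "const_op l (1 - e) 0 \<noteq> const_op l e 0" using e by (simp add: const_op_def) arith
    then have "const_op l (1 - e) \<noteq> const_op l e" by metis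
    then show ?thesis using Tc[OF 1] unfolding U_def by blast
  qed
  have all: "x \<in> U n" if "x \<in> simplices X n" for n x
    using that
  \<comment> \<open>A simplex of least dimension outside \<open>U\<close> has its proper faces in
    \<open>U\<close>, so its prism could be attached, against maximality.\<close>
  proof (induction n arbitrary: x rule: less_induct)
    case (less n)
    show ?case
    proof (rule ccontr)
      assume xU: "x \<notin> U n"
      have faces: "act X m n \<rho> x \<in> U m" if \<rho>: "\<rho> \<in> Delta m n" "\<not> {..n} \<subseteq> \<rho> ` {..m}" for m \<rho>
      proof -
        obtain c where "c \<le> n" "c \<notin> \<rho> ` {..m}" using \<rho>(2) by blast
        then obtain n' \<delta> \<psi> where n': "n = Suc n'" and \<delta>: "\<delta> \<in> Delta n' n" and \<psi>: "\<psi> \<in> Delta m n'"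
          and eq: "\<rho> = compose {..m} \<delta> \<psi>" by (rule Delta_factor_face[OF \<rho>(1)])
        have "act X n' n \<delta> x \<in> U n'" using less.IH[of n'] n' act_closed[OF X \<delta> less.prems] by simp
        then show ?thesis unfolding eq act_comp[OF X \<psi> \<delta> less.prems] by (rule U[OF _ \<psi>])
      qed
      obtain T' where T': "T \<subseteq> T'" "partial_lift ?Z E p v T'"
        "lift_dom T' = lift_dom T \<union> {(m, act X m n \<rho> x, \<chi>) |m \<rho> \<chi>. \<rho> \<in> Delta m n \<and> \<chi> \<in> Delta m 1}"
        by (rule prism_extend[OF E X v e TP less.prems domT U xU faces])
      have "\<chi> = const_op m e \<or> (\<forall>\<chi>'\<in>Delta m 1. (m, z, \<chi>') \<in> lift_dom T')"
        if "(m, z, \<chi>) \<in> lift_dom T'" for m z \<chi>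
        using that Tc unfolding T'(3) by blast
      then have "T' \<in> F" using RT T'(1,2) unfolding F_def by auto
      then have "T' = T" using maximal T'(1) by blast
      then have "(m, act X m n \<rho> x, \<chi>) \<in> lift_dom T" if "\<rho> \<in> Delta m n" "\<chi> \<in> Delta m 1" for m \<rho> \<chi>
        using T'(3) that by blast
      from this[OF Delta_id] show False using xU act_id[OF X less.prems] unfolding U_def by simp
    qed
  qed
  have "z \<in> simplices ?Z m \<Longrightarrow> (m, z) \<in> lift_dom T" for m z
    using all domT[of m "fst z" "snd z"] by (cases z) auto
  then obtain w where w: "w \<in> hom ?Z E" "\<And>m z. z \<in> simplices ?Z m \<Longrightarrow> p m (w m z) = v m z"
    "\<And>m z y. (m, z, y) \<in> T \<Longrightarrow> w m z = y"
    using partial_lift_total[OF sprod_sset[OF X std_simplex_sset] TP] by blast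
  then show thesis using that RT by blast
qed

section \<open>Relative homotopy lifting and extension\<close>

text \<open>Lifting against X x {e} \<union> S x Delta[1] for a simplicial subset \<open>S\<close>.
  Here \<open>h\<close> is a bare function with its compatibilities as assumptions, which avoids
  making S x Delta[1] an object of its own.\<close>

lemma kan_fibration_cylinder_lift:
  assumes E: "kan_fibration E Y p" and X: "simplicial_set X" and v: "v \<in> hom (cylinder X) Y"
    and e: "e \<le> 1" and u: "u \<in> hom X E" and pu: "\<And>m x. x \<in> simplices X m \<Longrightarrow> p m (u m x) = v m (x, const_op m e)"
    and S: "\<And>m x. x \<in> S m \<Longrightarrow> x \<in> simplices X m"
      "\<And>l m \<theta> x. \<lbrakk>x \<in> S m; \<theta> \<in> Delta l m\<rbrakk> \<Longrightarrow> act X l m \<theta> x \<in> S l"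
    and h: "\<And>m x \<chi>. \<lbrakk>x \<in> S m; \<chi> \<in> Delta m 1\<rbrakk> \<Longrightarrow> h m (x, \<chi>) \<in> simplices E m \<and> p m (h m (x, \<chi>)) = v m (x, \<chi>)"
      "\<And>l m \<theta> x \<chi>. \<lbrakk>x \<in> S m; \<chi> \<in> Delta m 1; \<theta> \<in> Delta l m\<rbrakk> \<Longrightarrow>
        h l (act X l m \<theta> x, compose {..l} \<chi> \<theta>) = act E l m \<theta> (h m (x, \<chi>))"
      "\<And>m x. x \<in> S m \<Longrightarrow> h m (x, const_op m e) = u m x"
  obtains w where "w \<in> hom (cylinder X) E" "\<And>m x \<chi>. \<lbrakk>x \<in> simplices X m; \<chi> \<in> Delta m 1\<rbrakk> \<Longrightarrow> p m (w m (x, \<chi>)) = v m (x, \<chi>)"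
    "\<And>m x. x \<in> simplices X m \<Longrightarrow> w m (x, const_op m e) = u m x"
    "\<And>m x \<chi>. \<lbrakk>x \<in> S m; \<chi> \<in> Delta m 1\<rbrakk> \<Longrightarrow> w m (x, \<chi>) = h m (x, \<chi>)"
proof -
  \<comment> \<open>The two prescriptions are glued as graphs; their agreement on S x {e} makes the
    union single-valued.\<close>
  define R where "R = {(m, (x, \<chi>), y). x \<in> simplices X m \<and> \<chi> \<in> Delta m 1 \<and>
    (x \<in> S m \<and> y = h m (x, \<chi>) \<or> \<chi> = const_op m e \<and> y = u m x)}"
  have "partial_lift (cylinder X) E p v R"
    unfolding partial_lift_def
  proof (rule conjI; intro allI impI)
    fix m z y assume "(m, z, y) \<in> R"
    then obtain x \<chi> where z: "z = (x, \<chi>)" and x: "x \<in> simplices X m" and \<chi>: "\<chi> \<in> Delta m 1"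
      and y: "x \<in> S m \<and> y = h m (x, \<chi>) \<or> \<chi> = const_op m e \<and> y = u m x"
      unfolding R_def by auto
    have "y \<in> simplices E m" "p m y = v m z"
      using y h(1)[OF _ \<chi>, of x] hom_closed[OF u x] pu[OF x] z by auto
    moreover have "(l, act (cylinder X) l m \<theta> z, act E l m \<theta> y) \<in> R" if \<theta>: "\<theta> \<in> Delta l m" for l \<theta>
      using y S(2)[OF _ \<theta>, of x] h(2)[OF _ \<chi> \<theta>, of x] act_closed[OF X \<theta> x] Delta_comp[OF \<chi> \<theta>]
        hom_nat[OF u \<theta> x] compose_const[OF \<theta>]
      unfolding R_def z by auto
    ultimately show "z \<in> simplices (cylinder X) m \<and> y \<in> simplices E m \<and> p m y = v m z \<and>
        (\<forall>l. \<forall>\<theta>\<in>Delta l m. (l, act (cylinder X) l m \<theta> z, act E l m \<theta> y) \<in> R)"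
      using x \<chi> by (simp add: z)
  next
    fix m z y y' assume "(m, z, y) \<in> R" "(m, z, y') \<in> R"
    then show "y = y'" unfolding R_def using h(3) by auto
  qed
  moreover have "(m, z, \<chi>) \<in> lift_dom R \<longleftrightarrow>
      z \<in> simplices X m \<and> \<chi> \<in> Delta m 1 \<and> (z \<in> S m \<or> \<chi> = const_op m e)" for m z \<chi>
    unfolding lift_dom_def R_def by auto
  ultimately obtain w where w: "w \<in> hom (cylinder X) E"
      "\<And>m z. z \<in> simplices (cylinder X) m \<Longrightarrow> p m (w m z) = v m z"
    and wR: "\<And>m z y. (m, z, y) \<in> R \<Longrightarrow> w m z = y"
    by (rule cylinder_lift[OF E X v e]) (rule that)
  show thesis
  proof (rule that[OF w(1)])
    show "p m (w m (x, \<chi>)) = v m (x, \<chi>)" if "x \<in> simplices X m" "\<chi> \<in> Delta m 1" for m x \<chi>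
      using w(2) that by simp
    show "w m (x, const_op m e) = u m x" if "x \<in> simplices X m" for m x
      by (rule wR) (use that const_Delta[OF e] in \<open>auto simp: R_def\<close>)
    show "w m (x, \<chi>) = h m (x, \<chi>)" if "x \<in> S m" "\<chi> \<in> Delta m 1" for m x \<chi>
      by (rule wR) (use that S(1) in \<open>auto simp: R_def\<close>)
  qed
qed

lemma cylinder_end_hom:
  assumes X: "simplicial_set X" and w: "w \<in> hom (cylinder X) E" and e: "e \<le> 1"
  shows "(\<lambda>m. \<lambda>x\<in>simplices X m. w m (x, const_op m e)) \<in> hom X E"
proof (rule homI)
  have c: "const_op m e \<in> Delta m 1" for m by (rule const_Delta[OF e])
  show "(\<lambda>x\<in>simplices X m. w m (x, const_op m e)) \<in> extensional (simplices X m)" for m by simp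
  show "(\<lambda>x\<in>simplices X m. w m (x, const_op m e)) x \<in> simplices E m" if "x \<in> simplices X m" for m x
    using hom_closed[OF w, of "(x, const_op m e)" m] c that by simp
  show "(\<lambda>x\<in>simplices X l. w l (x, const_op l e)) (act X l m \<theta> x) =
      act E l m \<theta> ((\<lambda>x\<in>simplices X m. w m (x, const_op m e)) x)"
    if "\<theta> \<in> Delta l m" "x \<in> simplices X m" for l m \<theta> x
    using hom_nat[OF w that(1), of "(x, const_op m e)"] c that act_closed[OF X that]
    by (simp add: compose_const[OF that(1)])
qed

definition point :: "unit sset" where
  "point = \<lparr>simplices = \<lambda>_. {()}, act = \<lambda>_ _ _ _. ()\<rparr>"

lemma kan_complex_fibration:
  assumes A: "kan_complex A"
  shows "kan_fibration A point (\<lambda>m. \<lambda>x\<in>simplices A m. ())"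
proof -
  have A': "simplicial_set A" using A by (simp add: kan_complex_def)
  have "simplicial_set point" by (simp add: simplicial_set_def point_def)
  moreover have "(\<lambda>m. \<lambda>x\<in>simplices A m. ()) \<in> hom A point"
    by (rule homI) (auto simp: point_def)
  moreover have "smap_comp (std_simplex n) (\<lambda>m. \<lambda>x\<in>simplices A m. ()) w = v"
    if "v \<in> hom (std_simplex n) point" for n w v
    by (rule smap_eqI[where X = "std_simplex n", OF smap_comp_ext hom_ext[OF that]]) simp
  ultimately show ?thesis
    using A unfolding kan_fibration_def kan_complex_def by blast
qed

text \<open>The homotopy extension property, obtained by regarding the Kan complex as fibred over
  \<open>point\<close>.\<close>

lemma kan_complex_cylinder_extend:
  assumes A: "kan_complex A" and X: "simplicial_set X" and e: "e \<le> 1" and u: "u \<in> hom X A"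
    and S: "\<And>m x. x \<in> S m \<Longrightarrow> x \<in> simplices X m"
      "\<And>l m \<theta> x. \<lbrakk>x \<in> S m; \<theta> \<in> Delta l m\<rbrakk> \<Longrightarrow> act X l m \<theta> x \<in> S l"
    and h: "\<And>m x \<chi>. \<lbrakk>x \<in> S m; \<chi> \<in> Delta m 1\<rbrakk> \<Longrightarrow> h m (x, \<chi>) \<in> simplices A m"
      "\<And>l m \<theta> x \<chi>. \<lbrakk>x \<in> S m; \<chi> \<in> Delta m 1; \<theta> \<in> Delta l m\<rbrakk> \<Longrightarrow>
        h l (act X l m \<theta> x, compose {..l} \<chi> \<theta>) = act A l m \<theta> (h m (x, \<chi>))"
      "\<And>m x. x \<in> S m \<Longrightarrow> h m (x, const_op m e) = u m x"
  obtains w where "w \<in> hom (cylinder X) A"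
    "\<And>m x. x \<in> simplices X m \<Longrightarrow> w m (x, const_op m e) = u m x"
    "\<And>m x \<chi>. \<lbrakk>x \<in> S m; \<chi> \<in> Delta m 1\<rbrakk> \<Longrightarrow> w m (x, \<chi>) = h m (x, \<chi>)"
proof -
  have v: "(\<lambda>m. \<lambda>x\<in>simplices (cylinder X) m. ()) \<in> hom (cylinder X) point"
    using act_closed[OF sprod_sset[OF X std_simplex_sset]] by (intro homI) (auto simp: point_def)
  show thesis
    by (rule kan_fibration_cylinder_lift[where S = S and h = h, OF kan_complex_fibration[OF A] X v e u])
      (use S h that in auto)
qed

section \<open>Extending maps from the preimage of a horn\<close>

text \<open>A monotone \<open>F : [1] x [n] \<rightarrow> [n]\<close> describes a homotopy of
  Delta[n] on vertices; \<open>blend\<close> is its effect on the simplex (\<rho>, \<chi>) of the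
  cylinder.\<close>

definition blend :: "(nat \<Rightarrow> nat \<Rightarrow> nat) \<Rightarrow> nat \<Rightarrow> (nat \<Rightarrow> nat) \<Rightarrow> (nat \<Rightarrow> nat) \<Rightarrow> nat \<Rightarrow> nat" where
  "blend F m \<rho> \<chi> = (\<lambda>j\<in>{..m}. F (\<chi> j) (\<rho> j))"

lemma blend_Delta:
  assumes F: "\<And>s t b c. \<lbrakk>s \<le> t; t \<le> 1; b \<le> c\<rbrakk> \<Longrightarrow> F s b \<le> F t c" "\<And>t c. F t c \<in> {c, k}"
    and k: "k \<le> n" and \<rho>: "\<rho> \<in> Delta m n" and \<chi>: "\<chi> \<in> Delta m 1"
  shows "blend F m \<rho> \<chi> \<in> Delta m n"
proof (rule DeltaI)
  show "blend F m \<rho> \<chi> j \<le> n" if "j \<le> m" for j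
    using F(2)[of "\<chi> j" "\<rho> j"] k DeltaD(1)[OF \<rho> that] that by (auto simp: blend_def)
  show "blend F m \<rho> \<chi> i \<le> blend F m \<rho> \<chi> j" if "i \<le> j" "j \<le> m" for i j
    using F(1)[OF DeltaD(3)[OF \<chi> that] DeltaD(1)[OF \<chi> that(2)] DeltaD(3)[OF \<rho> that]] that by (simp add: blend_def)
qed (simp add: blend_def)

lemma blend_compose:
  "\<theta> \<in> Delta l m \<Longrightarrow> compose {..l} (blend F m \<rho> \<chi>) \<theta> = blend F l (compose {..l} \<rho> \<theta>) (compose {..l} \<chi> \<theta>)"
  by (rule ext) (auto simp: blend_def compose_def dest: DeltaD(1))

text \<open>Each vertex stays put or moves to \<open>k\<close>, so a vertex other than
  \<open>k\<close> that \<rho> omits is still omitted.\<close>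

lemma blend_horn:
  assumes F: "\<And>t c. F t c \<in> {c, k}" and D: "blend F m \<rho> \<chi> \<in> Delta m n" and \<rho>: "\<rho> \<in> simplices (horn n k) m"
  shows "blend F m \<rho> \<chi> \<in> simplices (horn n k) m"
proof -
  obtain j where j: "j \<in> {..n} - {k}" "j \<notin> \<rho> ` {..m}" using \<rho> by (auto simp: horn_simps)
  have "blend F m \<rho> \<chi> i \<noteq> j" if "i \<le> m" for i
    using F[of "\<chi> i" "\<rho> i"] that j by (auto simp: blend_def)
  then have "j \<notin> blend F m \<rho> \<chi> ` {..m}" by blast
  then show ?thesis using j(1) D by (auto simp: horn_simps)
qed

text \<open>Over the horn, \<open>g\<close> after the lifted homotopies joins \<open>g\<close> to
  the restriction of a map defined on all of \<open>E\<close>. Two homotopy extensions run back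
  along this zigzag.\<close>

lemma kan_extend_over_horn:
  fixes A :: "'a sset" and E :: "'x sset"
  assumes q: "kan_fibration E (std_simplex n) q" and A: "kan_complex A" and n: "n \<ge> 1" "k \<le> n"
    and g: "\<And>m x. \<lbrakk>x \<in> simplices E m; q m x \<in> simplices (horn n k) m\<rbrakk> \<Longrightarrow> g m x \<in> simplices A m"
      "\<And>l m \<theta> x. \<lbrakk>x \<in> simplices E m; q m x \<in> simplices (horn n k) m; \<theta> \<in> Delta l m\<rbrakk> \<Longrightarrow>
        g l (act E l m \<theta> x) = act A l m \<theta> (g m x)"
  obtains a where "a \<in> hom E A"
    "\<And>m x. \<lbrakk>x \<in> simplices E m; q m x \<in> simplices (horn n k) m\<rbrakk> \<Longrightarrow> a m x = g m x"
proof -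
  have E: "simplicial_set E" and qh: "q \<in> hom E (std_simplex n)" using q by (auto simp: kan_fibration_def)
  have A': "simplicial_set A" using A by (simp add: kan_complex_def)
  define K where "K m = {x \<in> simplices E m. q m x \<in> simplices (horn n k) m}" for m
  have KE: "x \<in> simplices E m" if "x \<in> K m" for x m using that by (simp add: K_def)
  have Kact: "act E l m \<theta> x \<in> K l" if "x \<in> K m" "\<theta> \<in> Delta l m" for l m \<theta> x
    using that act_closed[OF E that(2)] act_closed[OF horn_sset that(2)] hom_nat[OF qh that(2)]
    by (auto simp: K_def horn_simps(2))
  have qD: "q m x \<in> Delta m n" if "x \<in> simplices E m" for m x using hom_closed[OF qh that] by simp
  note cyl = sprod_sset[OF E std_simplex_sset[of 1]]
  have c0: "const_op m 0 \<in> Delta m 1" and c1: "const_op m 1 \<in> Delta m 1" for m by (simp_all add: const_Delta)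
  \<comment> \<open>Monotonicity in \<open>t\<close> amounts to \<open>min c k \<le> c\<close> for
    \<open>F1\<close> and \<open>min c k \<le> k\<close> for \<open>F2\<close>; hence both
    homotopies have \<open>min(-,k)\<close> at their end 0.\<close>
  define F1 where "F1 t c = (if t = 0 then min c k else c)" for t c :: nat
  define F2 where "F2 t c = (if t = 0 then min c k else k)" for t c :: nat
  have F1: "\<lbrakk>s \<le> t; t \<le> 1; b \<le> c\<rbrakk> \<Longrightarrow> F1 s b \<le> F1 t c" "F1 t c \<in> {c, k}" for s t b c by (auto simp: F1_def)
  have F2: "\<lbrakk>s \<le> t; t \<le> 1; b \<le> c\<rbrakk> \<Longrightarrow> F2 s b \<le> F2 t c" "F2 t c \<in> {c, k}" for s t b c by (auto simp: F2_def)
  define H where "H F = (\<lambda>m. \<lambda>(x, \<chi>)\<in>simplices (cylinder E) m. blend F m (q m x) \<chi>)" for F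
  have H: "H F \<in> hom (cylinder E) (std_simplex n)"
    if F: "\<And>s t b c. \<lbrakk>s \<le> t; t \<le> 1; b \<le> c\<rbrakk> \<Longrightarrow> F s b \<le> F t c" "\<And>t c. F t c \<in> {c, k}" for F
  proof (rule homI)
    show "H F m \<in> extensional (simplices (cylinder E) m)" for m unfolding H_def by simp
    show "H F m z \<in> simplices (std_simplex n) m" if "z \<in> simplices (cylinder E) m" for m z
      using that blend_Delta[OF F n(2)] qD by (auto simp: H_def)
    show "H F l (act (cylinder E) l m \<theta> z) = act (std_simplex n) l m \<theta> (H F m z)"
      if \<theta>: "\<theta> \<in> Delta l m" and z: "z \<in> simplices (cylinder E) m" for l m \<theta> z
      using z act_closed[OF E \<theta>] Delta_comp[OF _ \<theta>] blend_compose[OF \<theta>] hom_nat[OF qh \<theta>] by (auto simp: H_def)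
  qed
  have Ha: "H F m (x, \<chi>) = blend F m (q m x) \<chi>" if "x \<in> simplices E m" "\<chi> \<in> Delta m 1" for F m x \<chi>
    using that by (simp add: H_def)
  have id_hom: "(\<lambda>m. restrict id (simplices E m)) \<in> hom E E" by (rule homI) (auto simp: act_closed[OF E])
  have blend1: "blend F1 m \<rho> (const_op m 1) = \<rho>" if "\<rho> \<in> Delta m n" for m \<rho>
    using DeltaD(2)[OF that] by (auto simp: blend_def F1_def const_op_def)
  have blend2: "blend F2 m \<rho> (const_op m 0) = blend F1 m \<rho> (const_op m 0)" for m \<rho>
    by (auto simp: blend_def F1_def F2_def const_op_def)
  have blend3: "blend F2 m \<rho> (const_op m 1) = const_op m k" for m \<rho>
    by (auto simp: blend_def F2_def const_op_def)
  \<comment> \<open>\<open>n \<ge> 1\<close> supplies a vertex other than \<open>k\<close>, which a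
    constant simplex at \<open>k\<close> omits.\<close>
  have const_horn: "const_op m k \<in> simplices (horn n k) m" for m
  proof -
    obtain j where "j \<in> {..n} - {k}" using n by (metis Diff_iff atMost_iff le_zero_eq order_refl singletonD zero_neq_one zero_le)
    then show ?thesis using const_Delta[OF n(2)] by (auto simp: horn_simps const_op_def)
  qed
  \<comment> \<open>The lift starts at end 1, where it is the identity; its other end
    \<open>?r\<close> covers \<open>min(-,k)\<close>.\<close>
  obtain w1 where w1: "w1 \<in> hom (cylinder E) E"
      "\<And>m x \<chi>. \<lbrakk>x \<in> simplices E m; \<chi> \<in> Delta m 1\<rbrakk> \<Longrightarrow> q m (w1 m (x, \<chi>)) = H F1 m (x, \<chi>)"
      "\<And>m x. x \<in> simplices E m \<Longrightarrow> w1 m (x, const_op m 1) = restrict id (simplices E m) x"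
    by (rule kan_fibration_cylinder_lift[where S = "\<lambda>_. {}" and e = 1, OF q E H[OF F1] _ id_hom])
      (auto simp: Ha c1[simplified] qD blend1[simplified])
  let ?r = "\<lambda>m. \<lambda>x\<in>simplices E m. w1 m (x, const_op m 0)"
  have r: "?r \<in> hom E E" using cylinder_end_hom[OF E w1(1), of 0] by simp
  \<comment> \<open>Starting at \<open>?r\<close> itself, and not merely at some lift of
    \<open>min(-,k)\<close>, is what lets the two homotopies be joined.\<close>
  obtain w2 where w2: "w2 \<in> hom (cylinder E) E"
      "\<And>m x \<chi>. \<lbrakk>x \<in> simplices E m; \<chi> \<in> Delta m 1\<rbrakk> \<Longrightarrow> q m (w2 m (x, \<chi>)) = H F2 m (x, \<chi>)"
      "\<And>m x. x \<in> simplices E m \<Longrightarrow> w2 m (x, const_op m 0) = ?r m x"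
    by (rule kan_fibration_cylinder_lift[where S = "\<lambda>_. {}" and e = 0, OF q E H[OF F2] _ r])
      (auto simp: Ha c0[simplified] qD blend2 w1(2)[simplified])
  have w1E: "w1 m (x, \<chi>) \<in> simplices E m" if "x \<in> simplices E m" "\<chi> \<in> Delta m 1" for m x \<chi>
    using hom_closed[OF w1(1)] that by simp
  have w2E: "w2 m (x, \<chi>) \<in> simplices E m" if "x \<in> simplices E m" "\<chi> \<in> Delta m 1" for m x \<chi>
    using hom_closed[OF w2(1)] that by simp
  have w1n: "w1 l (act E l m \<theta> x, compose {..l} \<chi> \<theta>) = act E l m \<theta> (w1 m (x, \<chi>))"
    if "x \<in> simplices E m" "\<chi> \<in> Delta m 1" "\<theta> \<in> Delta l m" for l m \<theta> x \<chi>
    using hom_nat[OF w1(1) that(3), of "(x, \<chi>)"] that by simp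
  have w2n: "w2 l (act E l m \<theta> x, compose {..l} \<chi> \<theta>) = act E l m \<theta> (w2 m (x, \<chi>))"
    if "x \<in> simplices E m" "\<chi> \<in> Delta m 1" "\<theta> \<in> Delta l m" for l m \<theta> x \<chi>
    using hom_nat[OF w2(1) that(3), of "(x, \<chi>)"] that by simp
  have w1K: "w1 m (x, \<chi>) \<in> K m" if "x \<in> K m" "\<chi> \<in> Delta m 1" for m x \<chi>
    using that w1E w1(2) Ha blend_horn[OF F1(2) blend_Delta[OF F1 n(2) qD that(2)]] by (simp add: K_def)
  have w2K: "w2 m (x, \<chi>) \<in> K m" if "x \<in> K m" "\<chi> \<in> Delta m 1" for m x \<chi>
    using that w2E w2(2) Ha blend_horn[OF F2(2) blend_Delta[OF F2 n(2) qD that(2)]] by (simp add: K_def)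
  have w2K1: "w2 m (x, const_op m 1) \<in> K m" if "x \<in> simplices E m" for m x
    unfolding K_def using w2E[OF that c1] w2(2)[OF that c1] Ha[OF that c1] blend3 const_horn by simp
  have gK: "g m x \<in> simplices A m" "\<theta> \<in> Delta l m \<Longrightarrow> g l (act E l m \<theta> x) = act A l m \<theta> (g m x)"
    if "x \<in> K m" for l m \<theta> x
    using g that by (auto simp: K_def)
  \<comment> \<open>The end 1 of \<open>w2\<close> lies over the vertex \<open>k\<close>, hence over
    the horn, so \<open>g\<close> after it is defined on all of \<open>E\<close>.\<close>
  let ?u = "\<lambda>m. \<lambda>x\<in>simplices E m. g m (w2 m (x, const_op m 1))"
  have u: "?u \<in> hom E A"
  proof (rule homI)
    show "?u m x \<in> simplices A m" if "x \<in> simplices E m" for m x using gK w2K1[OF that] that by simp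
    show "?u l (act E l m \<theta> x) = act A l m \<theta> (?u m x)" if "\<theta> \<in> Delta l m" "x \<in> simplices E m" for l m \<theta> x
      using that act_closed[OF E that] gK(2)[OF w2K1[OF that(2)] that(1)] w2n[OF that(2) c1 that(1)]
      by (simp add: compose_const[OF that(1)])
  qed simp
  obtain b1 where b1: "b1 \<in> hom (cylinder E) A"
      "\<And>m x \<chi>. \<lbrakk>x \<in> K m; \<chi> \<in> Delta m 1\<rbrakk> \<Longrightarrow> b1 m (x, \<chi>) = g m (w2 m (x, \<chi>))"
    by (rule kan_complex_cylinder_extend[where S = K and e = 1 and h = "\<lambda>m z. g m (w2 m z)", OF A E _ u KE Kact])
      (use gK w2K w2n KE in \<open>auto\<close>)
  \<comment> \<open>On \<open>K\<close> this end is \<open>g\<close> after \<open>?r\<close>, which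
    is where the homotopy \<open>g\<close> after \<open>w1\<close> begins.\<close>
  let ?c = "\<lambda>m. \<lambda>x\<in>simplices E m. b1 m (x, const_op m 0)"
  have c: "?c \<in> hom E A" using cylinder_end_hom[OF E b1(1), of 0] by simp
  have cK: "?c m x = g m (w1 m (x, const_op m 0))" if "x \<in> K m" for m x
    using b1(2)[OF that c0] w2(3)[OF KE[OF that]] KE[OF that] by simp
  obtain b2 where b2: "b2 \<in> hom (cylinder E) A"
      "\<And>m x \<chi>. \<lbrakk>x \<in> K m; \<chi> \<in> Delta m 1\<rbrakk> \<Longrightarrow> b2 m (x, \<chi>) = g m (w1 m (x, \<chi>))"
    by (rule kan_complex_cylinder_extend[where S = K and e = 0 and h = "\<lambda>m z. g m (w1 m z)", OF A E _ c KE Kact])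
      (use gK w1K w1n KE cK in \<open>auto\<close>)
  show thesis
  proof (rule that)
    show "(\<lambda>m. \<lambda>x\<in>simplices E m. b2 m (x, const_op m 1)) \<in> hom E A"
      by (rule cylinder_end_hom[OF E b2(1)]) simp
    show "(\<lambda>x\<in>simplices E m. b2 m (x, const_op m 1)) x = g m x"
      if "x \<in> simplices E m" "q m x \<in> simplices (horn n k) m" for m x
      using b2(2)[OF _ c1, of x m] w1(3) that by (simp add: K_def)
  qed
qed

section \<open>Coalgebras in terms of roots and children\<close>

definition root :: "('m, ('a, 'b, 'm \<times> 'b) dprod_simplex) smap \<Rightarrow> nat \<Rightarrow> 'm \<Rightarrow> 'a" where
  "root \<mu> m x = fst (\<mu> m x)"

text \<open>Only the value at the identity operator is kept; the values at other operators are
  children of restrictions, by \<open>coalgebra_child\<close>.\<close>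

definition child :: "('m, ('a, 'b, 'm \<times> 'b) dprod_simplex) smap \<Rightarrow> nat \<Rightarrow> 'm \<Rightarrow> 'b \<Rightarrow> 'm" where
  "child \<mu> m x b = fst (snd (\<mu> m x) m (restrict id {..m}, b))"

text \<open>The converse passage. For natural \<open>r\<close>, the function \<open>c\<close> is
  consulted only where \<open>r\<close> and \<open>f\<close> agree.\<close>

definition coalg :: "'b sset \<Rightarrow> 'a sset \<Rightarrow> ('b, 'a) smap \<Rightarrow> 'x sset \<Rightarrow> ('x, 'a) smap \<Rightarrow> (nat \<Rightarrow> 'x \<Rightarrow> 'b \<Rightarrow> 'x)
    \<Rightarrow> ('x, ('a, 'b, 'x \<times> 'b) dprod_simplex) smap" where
  "coalg B A f X r c = (\<lambda>m. \<lambda>x\<in>simplices X m. (r m x,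
     \<lambda>l. \<lambda>(\<phi>, b)\<in>simplices (fibre B A f m (r m x)) l. (c l (act X l m \<phi> x) b, b)))"

context
  fixes B :: "'b sset" and A :: "'a sset" and f :: "('b, 'a) smap"
  assumes B: "simplicial_set B" and A: "simplicial_set A" and f: "f \<in> hom B A"
begin

lemma fibre_id_iff:
  "a \<in> simplices A m \<Longrightarrow> (restrict id {..m}, b) \<in> simplices (fibre B A f m a) m \<longleftrightarrow> b \<in> simplices B m \<and> a = f m b"
  by (simp add: Delta_id act_id[OF A])

lemma root_closed: "\<lbrakk>coalgebra B A f M \<mu>; x \<in> simplices M m\<rbrakk> \<Longrightarrow> root \<mu> m x \<in> simplices A m"
  using coalgebra_closed[OF B A f, of M \<mu> x m]
  by (cases "\<mu> m x") (simp add: root_def poly_mem[OF B A f] del: fibre_simps)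

lemma root_nat:
  assumes M: "coalgebra B A f M \<mu>" and x: "x \<in> simplices M m" and \<phi>: "\<phi> \<in> Delta l m"
  shows "root \<mu> l (act M l m \<phi> x) = act A l m \<phi> (root \<mu> m x)"
proof -
  have "\<mu> l (act M l m \<phi> x) = act (poly B A f M) l m \<phi> (\<mu> m x)"
    using hom_nat[OF _ \<phi> x, of \<mu> "poly B A f M"] M by (simp add: coalgebra_def)
  then show ?thesis by (cases "\<mu> m x") (simp add: root_def poly_act[OF B A f])
qed

text \<open>Restricting \<open>x\<close> along \<phi> turns the point (\<phi>, b) of its fibre into
  the identity paired with \<open>b\<close>, and the structure map commutes with
  restriction.\<close>

lemma coalgebra_child:
  assumes M: "coalgebra B A f M \<mu>" and x: "x \<in> simplices M m"
    and b: "(\<phi>, b) \<in> simplices (fibre B A f m (root \<mu> m x)) l"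
  shows "snd (\<mu> m x) l (\<phi>, b) = (child \<mu> l (act M l m \<phi> x) b, b)"
proof -
  obtain a s where as: "\<mu> m x = (a, s)" by fastforce
  have s: "(a, s) \<in> simplices (poly B A f M) m" using coalgebra_closed[OF B A f M x] as by simp
  have ra: "root \<mu> m x = a" by (simp add: root_def as)
  have a: "a \<in> simplices A m" using s by (simp add: poly_mem[OF B A f])
  have \<phi>: "\<phi> \<in> Delta l m" and b': "b \<in> simplices B l" "act A l m \<phi> a = f l b" using b ra by auto
  have 1: "\<mu> l (act M l m \<phi> x) = act (poly B A f M) l m \<phi> (a, s)"
    using hom_nat[OF _ \<phi> x, of \<mu> "poly B A f M"] M by (simp add: coalgebra_def as)
  have 2: "(restrict id {..l}, b) \<in> simplices (fibre B A f l (act A l m \<phi> a)) l"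
    using fibre_id_iff[OF act_closed[OF A \<phi> a]] b' by blast
  have "child \<mu> l (act M l m \<phi> x) b = fst (s l (\<phi>, b))"
    unfolding child_def 1 poly_act[OF B A f] using 2 by (simp add: Delta_id_right[OF \<phi>] del: fibre_simps)
  moreover have "s l (\<phi>, b) = (fst (s l (\<phi>, b)), b)" using s b unfolding ra poly_mem[OF B A f] by blast
  ultimately show ?thesis by (simp add: as)
qed

lemma child_closed:
  assumes M: "coalgebra B A f M \<mu>" and x: "x \<in> simplices M m"
    and b: "b \<in> simplices B m" "root \<mu> m x = f m b"
  shows "child \<mu> m x b \<in> simplices M m"
proof -
  obtain a s where as: "\<mu> m x = (a, s)" by fastforce
  have s: "(a, s) \<in> simplices (poly B A f M) m" using coalgebra_closed[OF B A f M x] as by simp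
  have "(restrict id {..m}, b) \<in> simplices (fibre B A f m a) m"
    using fibre_id_iff[OF root_closed[OF M x], of b] b by (simp add: root_def as del: fibre_simps)
  then show ?thesis using s unfolding poly_mem[OF B A f] child_def as snd_conv by blast
qed

lemma child_nat:
  assumes M: "coalgebra B A f M \<mu>" and x: "x \<in> simplices M m"
    and b: "b \<in> simplices B m" "root \<mu> m x = f m b" and \<phi>: "\<phi> \<in> Delta l m"
  shows "child \<mu> l (act M l m \<phi> x) (act B l m \<phi> b) = act M l m \<phi> (child \<mu> m x b)"
proof -
  obtain a s where as: "\<mu> m x = (a, s)" by fastforce
  have s: "(a, s) \<in> simplices (poly B A f M) m" using coalgebra_closed[OF B A f M x] as by simp
  have a: "a \<in> simplices A m" using s by (simp add: poly_mem[OF B A f])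
  have i: "(restrict id {..m}, b) \<in> simplices (fibre B A f m a) m"
    using fibre_id_iff[OF root_closed[OF M x], of b] b by (simp add: root_def as del: fibre_simps)
  have "(\<phi>, act B l m \<phi> b) \<in> simplices (fibre B A f m a) l"
    using fibre_act[OF B A f a \<phi> i] by (simp only: Delta_id_left[OF \<phi>])
  then have "(child \<mu> l (act M l m \<phi> x) (act B l m \<phi> b), act B l m \<phi> b) = s l (\<phi>, act B l m \<phi> b)"
    using coalgebra_child[OF M x, of \<phi> "act B l m \<phi> b" l] by (simp add: root_def as)
  moreover have "fst (s l (compose {..l} (restrict id {..m}) \<phi>, act B l m \<phi> b)) = act M l m \<phi> (fst (s m (restrict id {..m}, b)))"
    using s i \<phi> unfolding poly_mem[OF B A f] by blast
  ultimately show ?thesis by (metis Delta_id_left[OF \<phi>] as child_def fst_conv snd_conv)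
qed

lemma coalg_coalgebra:
  assumes X: "simplicial_set X"
    and r: "\<And>m x. x \<in> simplices X m \<Longrightarrow> r m x \<in> simplices A m"
      "\<And>l m \<phi> x. \<lbrakk>x \<in> simplices X m; \<phi> \<in> Delta l m\<rbrakk> \<Longrightarrow> r l (act X l m \<phi> x) = act A l m \<phi> (r m x)"
    and c: "\<And>m x b. \<lbrakk>x \<in> simplices X m; b \<in> simplices B m; r m x = f m b\<rbrakk> \<Longrightarrow> c m x b \<in> simplices X m"
      "\<And>l m \<phi> x b. \<lbrakk>x \<in> simplices X m; b \<in> simplices B m; r m x = f m b; \<phi> \<in> Delta l m\<rbrakk> \<Longrightarrow>
        c l (act X l m \<phi> x) (act B l m \<phi> b) = act X l m \<phi> (c m x b)"
  shows "coalgebra B A f X (coalg B A f X r c)"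
  unfolding coalgebra_def
proof (intro conjI X homI)
  show "coalg B A f X r c m \<in> extensional (simplices X m)" for m by (simp add: coalg_def)
next
  fix m x assume x: "x \<in> simplices X m"
  have fib: "\<phi> \<in> Delta l m" "act X l m \<phi> x \<in> simplices X l" "b \<in> simplices B l" "r l (act X l m \<phi> x) = f l b"
    if "(\<phi>, b) \<in> simplices (fibre B A f m (r m x)) l" for l \<phi> b
    using that r(2)[OF x] act_closed[OF X _ x] by auto
  show "coalg B A f X r c m x \<in> simplices (poly B A f X) m"
    unfolding coalg_def restrict_apply if_P[OF x] poly_mem[OF B A f]
  proof (intro conjI allI impI; (elim conjE)?)
    show "r m x \<in> simplices A m" by (rule r(1)[OF x])
  next
    fix l \<phi> b assume *: "(\<phi>, b) \<in> simplices (fibre B A f m (r m x)) l"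
    show "fst (if (\<phi>, b) \<in> simplices (fibre B A f m (r m x)) l
        then case (\<phi>, b) of (\<phi>, b) \<Rightarrow> (c l (act X l m \<phi> x) b, b) else undefined) \<in> simplices X l"
      using c(1)[OF fib(2-4)[OF *]] * by (simp del: fibre_simps)
    show "(if (\<phi>, b) \<in> simplices (fibre B A f m (r m x)) l
        then case (\<phi>, b) of (\<phi>, b) \<Rightarrow> (c l (act X l m \<phi> x) b, b) else undefined) =
      (fst (if (\<phi>, b) \<in> simplices (fibre B A f m (r m x)) l
        then case (\<phi>, b) of (\<phi>, b) \<Rightarrow> (c l (act X l m \<phi> x) b, b) else undefined), b)"
      using * by (simp del: fibre_simps)
  next
    fix j l \<psi> \<phi> b assume \<psi>: "\<psi> \<in> Delta j l" and *: "(\<phi>, b) \<in> simplices (fibre B A f m (r m x)) l"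
    show "fst (if (compose {..j} \<phi> \<psi>, act B j l \<psi> b) \<in> simplices (fibre B A f m (r m x)) j
        then case (compose {..j} \<phi> \<psi>, act B j l \<psi> b) of (\<phi>, b) \<Rightarrow> (c j (act X j m \<phi> x) b, b) else undefined) =
      act X j l \<psi> (fst (if (\<phi>, b) \<in> simplices (fibre B A f m (r m x)) l
        then case (\<phi>, b) of (\<phi>, b) \<Rightarrow> (c l (act X l m \<phi> x) b, b) else undefined))"
      using * fibre_act[OF B A f r(1)[OF x] \<psi> *] c(2)[OF fib(2-4)[OF *] \<psi>] act_comp[OF X \<psi> fib(1)[OF *] x]
      by (simp del: fibre_simps)
  qed (simp add: extensional_def)
next
  fix l m \<phi> x assume \<phi>: "\<phi> \<in> Delta l m" and x: "x \<in> simplices X m"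
  note x' = act_closed[OF X \<phi> x]
  show "coalg B A f X r c l (act X l m \<phi> x) = act (poly B A f X) l m \<phi> (coalg B A f X r c m x)"
    unfolding coalg_def restrict_apply if_P[OF x] if_P[OF x'] poly_act[OF B A f] r(2)[OF x \<phi>] prod.inject
  proof (intro conjI refl smap_eqI[where X = "fibre B A f l (act A l m \<phi> (r m x))"])
    fix j y assume y: "y \<in> simplices (fibre B A f l (act A l m \<phi> (r m x))) j"
    obtain \<psi> b where y': "y = (\<psi>, b)" by fastforce
    have \<psi>: "\<psi> \<in> Delta j l" using y y' by simp
    show "(if y \<in> simplices (fibre B A f l (act A l m \<phi> (r m x))) j
        then case y of (\<psi>, b) \<Rightarrow> (c j (act X j l \<psi> (act X l m \<phi> x)) b, b) else undefined) =
      (if y \<in> simplices (fibre B A f l (act A l m \<phi> (r m x))) j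
        then case y of (\<psi>, b) \<Rightarrow> (if (compose {..j} \<phi> \<psi>, b) \<in> simplices (fibre B A f m (r m x)) j
          then case (compose {..j} \<phi> \<psi>, b) of (\<phi>, b) \<Rightarrow> (c j (act X j m \<phi> x) b, b) else undefined) else undefined)"
      using y fibre_shift[OF B A f r(1)[OF x] \<phi>, of \<psi> b j] act_comp[OF X \<psi> \<phi> x]
      by (simp add: y' del: fibre_simps)
  qed (simp_all add: extensional_def)
qed

text \<open>At identity operators the square of a coalgebra morphism says that roots and children
  are preserved; naturality of \<open>k\<close> recovers the square at all other operators.\<close>

lemma coalg_hom_iff:
  assumes X: "coalgebra B A f X (coalg B A f X r c)" and M: "coalgebra B A f M \<mu>" and k: "k \<in> hom X M"
    and r: "\<And>l m \<phi> x. \<lbrakk>x \<in> simplices X m; \<phi> \<in> Delta l m\<rbrakk> \<Longrightarrow> r l (act X l m \<phi> x) = act A l m \<phi> (r m x)"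
  shows "k \<in> coalgebra_hom B A f X (coalg B A f X r c) M \<mu> \<longleftrightarrow>
    (\<forall>m. \<forall>x\<in>simplices X m. root \<mu> m (k m x) = r m x \<and>
      (\<forall>b\<in>simplices B m. r m x = f m b \<longrightarrow> child \<mu> m (k m x) b = k m (c m x b)))"
    (is "_ \<longleftrightarrow> (\<forall>m. \<forall>x\<in>_. ?P m x)")
proof -
  have X': "simplicial_set X" using X by (simp add: coalgebra_def)
  have eq: "poly_map B A f X k m (coalg B A f X r c m x) = (r m x,
      \<lambda>l. \<lambda>(\<phi>, b)\<in>simplices (fibre B A f m (r m x)) l. (k l (c l (act X l m \<phi> x) b), b))"
    if x: "x \<in> simplices X m" for m x
  proof -
    let ?s = "\<lambda>l. \<lambda>(\<phi>, b)\<in>simplices (fibre B A f m (r m x)) l. (c l (act X l m \<phi> x) b, b)"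
    have eq: "coalg B A f X r c m x = (r m x, ?s)" using x by (simp only: coalg_def restrict_apply if_True)
    have "(r m x, ?s) \<in> simplices (poly B A f X) m" unfolding eq[symmetric] by (rule coalgebra_closed[OF B A f X x])
    then have "poly_map B A f X k m (coalg B A f X r c m x) = (r m x,
        \<lambda>l. \<lambda>(\<phi>, b)\<in>simplices (fibre B A f m (r m x)) l. (k l (fst (?s l (\<phi>, b))), b))"
      unfolding eq by (rule poly_map_apply[OF B A f])
    also have "\<dots> = (r m x, \<lambda>l. \<lambda>(\<phi>, b)\<in>simplices (fibre B A f m (r m x)) l. (k l (c l (act X l m \<phi> x) b), b))"
      by (auto intro!: smap_eqI[where X = "fibre B A f m (r m x)"] simp del: fibre_simps)
    finally show ?thesis .
  qed
  have iff: "k \<in> coalgebra_hom B A f X (coalg B A f X r c) M \<mu> \<longleftrightarrow>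
    (\<forall>m. \<forall>x\<in>simplices X m. \<mu> m (k m x) = (r m x,
      \<lambda>l. \<lambda>(\<phi>, b)\<in>simplices (fibre B A f m (r m x)) l. (k l (c l (act X l m \<phi> x) b), b)))"
    using k eq by (simp add: coalgebra_hom_iff[OF B A f])
  have kM: "k m x \<in> simplices M m" if "x \<in> simplices X m" for m x by (rule hom_closed[OF k that])
  show ?thesis
    unfolding iff
  proof (intro iffI allI ballI)
    fix m x assume *: "\<forall>m. \<forall>x\<in>simplices X m. \<mu> m (k m x) = (r m x,
      \<lambda>l. \<lambda>(\<phi>, b)\<in>simplices (fibre B A f m (r m x)) l. (k l (c l (act X l m \<phi> x) b), b))"
      and x: "x \<in> simplices X m"
    have mu: "\<mu> m (k m x) = (r m x,
      \<lambda>l. \<lambda>(\<phi>, b)\<in>simplices (fibre B A f m (r m x)) l. (k l (c l (act X l m \<phi> x) b), b))" using * x by blast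
    have r': "root \<mu> m (k m x) = r m x" by (simp add: root_def mu)
    then have rA: "r m x \<in> simplices A m" using root_closed[OF M kM[OF x]] by simp
    have "child \<mu> m (k m x) b = k m (c m x b)" if "b \<in> simplices B m" "r m x = f m b" for b
    proof -
      have "(restrict id {..m}, b) \<in> simplices (fibre B A f m (r m x)) m" using fibre_id_iff[OF rA] that by blast
      then show ?thesis by (simp add: child_def mu act_id[OF X' x] del: fibre_simps)
    qed
    then show "?P m x" using r' by blast
  next
    fix m x assume *: "\<forall>m. \<forall>x\<in>simplices X m. ?P m x" and x: "x \<in> simplices X m"
    have r': "fst (\<mu> m (k m x)) = r m x" using * x by (simp add: root_def)
    obtain s where s: "\<mu> m (k m x) = (r m x, s)" using r' by (metis prod.collapse)
    have sP: "(r m x, s) \<in> simplices (poly B A f M) m" using coalgebra_closed[OF B A f M kM[OF x]] s by simp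
    have "s = (\<lambda>l. \<lambda>(\<phi>, b)\<in>simplices (fibre B A f m (r m x)) l. (k l (c l (act X l m \<phi> x) b), b))"
    proof (rule smap_eqI[where X = "fibre B A f m (r m x)"])
      show "s l \<in> extensional (simplices (fibre B A f m (r m x)) l)" for l
        using sP unfolding poly_mem[OF B A f] by blast
      fix l y assume y: "y \<in> simplices (fibre B A f m (r m x)) l"
      obtain \<phi> b where y': "y = (\<phi>, b)" by fastforce
      have \<phi>: "\<phi> \<in> Delta l m" and b: "b \<in> simplices B l" "act A l m \<phi> (r m x) = f l b" using y y' by auto
      have "s l (\<phi>, b) = (child \<mu> l (act M l m \<phi> (k m x)) b, b)"
        using coalgebra_child[OF M kM[OF x], of \<phi> b l] y y' by (simp add: s root_def del: fibre_simps)
      also have "act M l m \<phi> (k m x) = k l (act X l m \<phi> x)" using hom_nat[OF k \<phi> x] by simp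
      also have "child \<mu> l \<dots> b = k l (c l (act X l m \<phi> x) b)"
        using * act_closed[OF X' \<phi> x] b r[OF x \<phi>] by metis
      finally show "s l y = (\<lambda>(\<phi>, b)\<in>simplices (fibre B A f m (r m x)) l. (k l (c l (act X l m \<phi> x) b), b)) y"
        using y by (simp add: y' del: fibre_simps)
    qed simp
    then show "\<mu> m (k m x) = (r m x,
      \<lambda>l. \<lambda>(\<phi>, b)\<in>simplices (fibre B A f m (r m x)) l. (k l (c l (act X l m \<phi> x) b), b))" by (simp add: s)
  qed
qed

end

section \<open>The tower of iterated pullbacks\<close>

text \<open>A simplex of \<open>L\<^sub>i\<close> is a simplex \<open>\<theta>\<close> of \<open>\<Delta>[n]\<close> with a list of \<open>i\<close> simplices of \<open>B\<close>, most recent first;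
  thus all stages share one type and are disjoint.\<close>

type_synonym 'b cell = "(nat \<Rightarrow> nat) \<times> 'b list"

definition path_act :: "'b sset \<Rightarrow> nat \<Rightarrow> nat \<Rightarrow> (nat \<Rightarrow> nat) \<Rightarrow> 'b cell \<Rightarrow> 'b cell" where
  "path_act B m n \<phi> = (\<lambda>(\<theta>, bs). (compose {..m} \<theta> \<phi>, map (act B m n \<phi>) bs))"

definition paths :: "'b sset \<Rightarrow> (nat \<Rightarrow> 'b cell set) \<Rightarrow> 'b cell sset" where
  "paths B L = \<lparr>simplices = L, act = path_act B\<rparr>"

definition base :: "(nat \<Rightarrow> 'b cell set) \<Rightarrow> ('b cell, nat \<Rightarrow> nat) smap" where
  "base L = (\<lambda>m. restrict fst (L m))"

text \<open>The total space of the pullback of \<open>f\<close> along \<open>a\<close>.\<close>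

definition grow :: "'b sset \<Rightarrow> ('b, 'a) smap \<Rightarrow> (nat \<Rightarrow> 'b cell set) \<Rightarrow> ('b cell, 'a) smap \<Rightarrow> nat \<Rightarrow> 'b cell set" where
  "grow B f L a m = {(\<theta>, b # bs) |\<theta> b bs. (\<theta>, bs) \<in> L m \<and> b \<in> simplices B m \<and> a m (\<theta>, bs) = f m b}"

lemma paths_simps [simp]:
  "simplices (paths B L) = L" "act (paths B L) m n \<phi> (\<theta>, bs) = (compose {..m} \<theta> \<phi>, map (act B m n \<phi>) bs)"
  by (simp_all add: paths_def path_act_def)

lemma grow_iff [simp]:
  "(\<theta>, bs') \<in> grow B f L a m \<longleftrightarrow>
    (\<exists>b bs. bs' = b # bs \<and> (\<theta>, bs) \<in> L m \<and> b \<in> simplices B m \<and> a m (\<theta>, bs) = f m b)"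
  by (auto simp: grow_def)

text \<open>Here \<open>base\<close> is an isomorphism onto Delta[n], so the lift is
  \<open>v\<close> with empty lists attached.\<close>

lemma base_fibration_trivial:
  "kan_fibration (paths B (\<lambda>m. {(\<theta>, []) |\<theta>. \<theta> \<in> Delta m n})) (std_simplex n) (base (\<lambda>m. {(\<theta>, []) |\<theta>. \<theta> \<in> Delta m n}))"
  (is "kan_fibration (paths B ?L) _ _")
proof -
  have mem: "x \<in> ?L m \<longleftrightarrow> fst x \<in> Delta m n \<and> snd x = []" for x :: "'a cell" and m by (cases x) auto
  have P: "simplicial_set (paths B ?L)"
    unfolding simplicial_set_def by (auto simp: Delta_comp Delta_assoc Delta_id_right)
  have q: "base ?L \<in> hom (paths B ?L) (std_simplex n)"
    by (rule homI) (auto simp: base_def Delta_comp)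
  have "\<exists>w\<in>hom (std_simplex N) (paths B ?L). smap_restrict w (horn N k) = u \<and> smap_comp (std_simplex N) (base ?L) w = v"
    if u: "u \<in> hom (horn N k) (paths B ?L)" and v: "v \<in> hom (std_simplex N) (std_simplex n)"
      and uv: "smap_comp (horn N k) (base ?L) u = smap_restrict v (horn N k)" for N k u v
  proof (intro bexI conjI)
    let ?w = "\<lambda>m. \<lambda>\<theta>\<in>Delta m N. (v m \<theta>, [])"
    show "?w \<in> hom (std_simplex N) (paths B ?L)"
      using hom_closed[OF v] hom_nat[OF v] by (intro homI) (auto simp: Delta_comp)
    show "smap_restrict ?w (horn N k) = u"
    proof (rule smap_eqI[where X = "horn N k"])
      show "smap_restrict ?w (horn N k) m \<in> extensional (simplices (horn N k) m)" for m by (simp only: smap_restrict_def restrict_extensional)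
      show "u m \<in> extensional (simplices (horn N k) m)" for m by (rule hom_ext[OF u])
      fix m \<theta> assume \<theta>: "\<theta> \<in> simplices (horn N k) m"
      have "u m \<theta> \<in> ?L m" using hom_closed[OF u \<theta>] by simp
      moreover have "base ?L m (u m \<theta>) = v m \<theta>"
        using fun_cong[OF fun_cong[OF uv, of m], of \<theta>] \<theta> by (simp add: smap_comp_apply smap_restrict_def)
      ultimately show "smap_restrict ?w (horn N k) m \<theta> = u m \<theta>"
        using \<theta> by (auto simp: smap_restrict_def base_def horn_simps)
    qed
    show "smap_comp (std_simplex N) (base ?L) ?w = v"
      by (rule smap_eqI[where X = "std_simplex N", OF smap_comp_ext hom_ext[OF v]])
        (use hom_closed[OF v] in \<open>auto simp: smap_comp_apply base_def\<close>)
  qed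
  then show ?thesis
    unfolding kan_fibration_def using P q std_simplex_sset by blast
qed

text \<open>Kan fibrations are stable under pullback and composition: the new \<open>base\<close> is
  the projection to \<open>L\<close>, a pullback of \<open>f\<close>, followed by
  \<open>base L\<close>.\<close>

lemma base_fibration_grow:
  assumes f: "kan_fibration B A f" and q: "kan_fibration (paths B L) (std_simplex n) (base L)"
    and a: "a \<in> hom (paths B L) A"
  shows "kan_fibration (paths B (grow B f L a)) (std_simplex n) (base (grow B f L a))"
proof -
  let ?L = "paths B L" and ?G = "grow B f L a"
  let ?P = "paths B ?G"
  have B: "simplicial_set B" and fh: "f \<in> hom B A" using f by (auto simp: kan_fibration_def)
  have L: "simplicial_set ?L" and qh: "base L \<in> hom ?L (std_simplex n)" using q by (auto simp: kan_fibration_def)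
  have Lc: "(compose {..l} \<theta> \<phi>, map (act B l m \<phi>) bs) \<in> L l" if "(\<theta>, bs) \<in> L m" "\<phi> \<in> Delta l m" for l m \<theta> \<phi> bs
    using act_closed[OF L that(2), of "(\<theta>, bs)"] that(1) by simp
  have Lq: "\<theta> \<in> Delta m n" if "(\<theta>, bs) \<in> L m" for \<theta> m bs
    using hom_closed[OF qh, of "(\<theta>, bs)" m] that by (simp add: base_def)
  have an: "a l (compose {..l} \<theta> \<phi>, map (act B l m \<phi>) bs) = act A l m \<phi> (a m (\<theta>, bs))"
    if "(\<theta>, bs) \<in> L m" "\<phi> \<in> Delta l m" for l m \<theta> \<phi> bs
    using hom_nat[OF a that(2), of "(\<theta>, bs)"] that(1) by simp
  have P: "simplicial_set ?P"
    unfolding simplicial_set_def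
  proof (intro conjI allI ballI)
    show "act ?P m l \<phi> x \<in> simplices ?P m" if "\<phi> \<in> Delta m l" "x \<in> simplices ?P l" for m l \<phi> x
      using that Lc an hom_nat[OF fh] act_closed[OF B] by (cases x) auto
    show "act ?P m m (restrict id {..m}) x = x" if x: "x \<in> simplices ?P m" for m x
    proof -
      obtain \<theta> b bs where x': "x = (\<theta>, b # bs)" "(\<theta>, bs) \<in> L m" "b \<in> simplices B m" using x by (cases x) auto
      then show ?thesis using act_id[OF L, of "(\<theta>, bs)" m] act_id[OF B, of b m] by simp
    qed
    show "act ?P k j (compose {..k} \<theta> \<phi>) x = act ?P k m \<phi> (act ?P m j \<theta> x)"
      if \<phi>: "\<phi> \<in> Delta k m" and \<theta>: "\<theta> \<in> Delta m j" and x: "x \<in> simplices ?P j" for k m j \<phi> \<theta> x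
    proof -
      obtain \<rho> b bs where x': "x = (\<rho>, b # bs)" "(\<rho>, bs) \<in> L j" "b \<in> simplices B j" using x by (cases x) auto
      then show ?thesis using act_comp[OF L \<phi> \<theta>, of "(\<rho>, bs)"] act_comp[OF B \<phi> \<theta>, of b] by simp
    qed
  qed
  have qG: "base ?G \<in> hom ?P (std_simplex n)"
  proof (rule homI)
    show "base ?G m \<in> extensional (simplices ?P m)" for m by (simp add: base_def)
    show "base ?G m x \<in> simplices (std_simplex n) m" if "x \<in> simplices ?P m" for m x
      using that Lq by (cases x) (auto simp: base_def)
    show "base ?G l (act ?P l m \<phi> x) = act (std_simplex n) l m \<phi> (base ?G m x)"
      if "\<phi> \<in> Delta l m" "x \<in> simplices ?P m" for l m \<phi> x
      using that act_closed[OF P that] by (cases x) (simp add: base_def del: grow_iff)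
  qed
  \<comment> \<open>\<open>par\<close> and \<open>top\<close> are the pullback projections to
    \<open>L\<close> and to \<open>B\<close>.\<close>
  define par where "par = (\<lambda>m. \<lambda>(\<theta>, bs)\<in>?G m. (\<theta>, tl bs))"
  define top where "top = (\<lambda>m. \<lambda>(\<theta>, bs)\<in>?G m. hd bs)"
  have par: "par \<in> hom ?P ?L"
  proof (rule homI)
    show "par l (act ?P l m \<phi> x) = act ?L l m \<phi> (par m x)" if "\<phi> \<in> Delta l m" "x \<in> simplices ?P m" for l m \<phi> x
      using that act_closed[OF P that] by (cases x) (auto simp: par_def)
  qed (auto simp: par_def)
  have top: "top \<in> hom ?P B"
  proof (rule homI)
    show "top l (act ?P l m \<phi> x) = act B l m \<phi> (top m x)" if "\<phi> \<in> Delta l m" "x \<in> simplices ?P m" for l m \<phi> x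
      using that act_closed[OF P that] by (cases x) (auto simp: top_def)
  qed (auto simp: top_def)
  have split: "par m x \<in> L m" "top m x \<in> simplices B m" "a m (par m x) = f m (top m x)"
    "base L m (par m x) = base ?G m x" "x = (fst (par m x), top m x # snd (par m x))" if "x \<in> ?G m" for m x
    using that by (cases x; auto simp: par_def top_def base_def)+
  have "\<exists>w\<in>hom (std_simplex N) ?P. smap_restrict w (horn N k) = u \<and> smap_comp (std_simplex N) (base ?G) w = v"
    if N: "N \<ge> 1" "k \<le> N" and u: "u \<in> hom (horn N k) ?P" and v: "v \<in> hom (std_simplex N) (std_simplex n)"
      and uv: "smap_comp (horn N k) (base ?G) u = smap_restrict v (horn N k)" for N k u v
  proof -
    let ?H = "horn N k"
    have uG: "u m \<theta> \<in> ?G m" if "\<theta> \<in> simplices ?H m" for m \<theta> using hom_closed[OF u that] by simp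
    have HD: "\<theta> \<in> Delta m N" if "\<theta> \<in> simplices ?H m" for m \<theta> using that by (simp add: horn_simps)
    have u1: "smap_comp ?H par u \<in> hom ?H ?L" by (rule smap_comp_hom[OF horn_sset u par])
    have u2: "smap_comp ?H top u \<in> hom ?H B" by (rule smap_comp_hom[OF horn_sset u top])
    have uv': "base ?G m (u m \<theta>) = v m \<theta>" if "\<theta> \<in> simplices ?H m" for m \<theta>
      using fun_cong[OF fun_cong[OF uv, of m], of \<theta>] that by (simp add: smap_comp_apply smap_restrict_def)
    have "smap_comp ?H (base L) (smap_comp ?H par u) = smap_restrict v ?H"
      by (rule smap_eqI[where X = ?H])
        (auto simp: smap_comp_ext smap_restrict_def smap_comp_apply split(4)[OF uG] uv')
    \<comment> \<open>The lift to \<open>L\<close> comes before the lift along \<open>f\<close>,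
      because \<open>a\<close> after it is the simplex of \<open>A\<close> over which the latter
      takes place.\<close>
    then obtain w1 where w1: "w1 \<in> hom (std_simplex N) ?L" and w1u: "smap_restrict w1 ?H = smap_comp ?H par u"
      and w1v: "smap_comp (std_simplex N) (base L) w1 = v"
      using q N u1 v unfolding kan_fibration_def by blast
    have w1u': "w1 m \<theta> = par m (u m \<theta>)" if "\<theta> \<in> simplices ?H m" for m \<theta>
      using fun_cong[OF fun_cong[OF w1u, of m], of \<theta>] that by (simp add: smap_comp_apply smap_restrict_def)
    have w1v': "base L m (w1 m \<theta>) = v m \<theta>" if "\<theta> \<in> Delta m N" for m \<theta>
      using fun_cong[OF fun_cong[OF w1v, of m], of \<theta>] that by (simp add: smap_comp_apply)
    have aw1: "smap_comp (std_simplex N) a w1 \<in> hom (std_simplex N) A"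
      by (rule smap_comp_hom[OF std_simplex_sset w1 a])
    have "smap_comp ?H f (smap_comp ?H top u) = smap_restrict (smap_comp (std_simplex N) a w1) ?H"
      by (rule smap_eqI[where X = ?H])
        (auto simp: smap_comp_ext smap_restrict_def smap_comp_apply HD split(3)[OF uG, symmetric] w1u')
    then obtain w2 where w2: "w2 \<in> hom (std_simplex N) B" and w2u: "smap_restrict w2 ?H = smap_comp ?H top u"
      and w2v: "smap_comp (std_simplex N) f w2 = smap_comp (std_simplex N) a w1"
      using f N u2 aw1 unfolding kan_fibration_def by blast
    have w2u': "w2 m \<theta> = top m (u m \<theta>)" if "\<theta> \<in> simplices ?H m" for m \<theta>
      using fun_cong[OF fun_cong[OF w2u, of m], of \<theta>] that by (simp add: smap_comp_apply smap_restrict_def)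
    have w2v': "f m (w2 m \<theta>) = a m (w1 m \<theta>)" if "\<theta> \<in> Delta m N" for m \<theta>
      using fun_cong[OF fun_cong[OF w2v, of m], of \<theta>] that by (simp add: smap_comp_apply)
    have w1L: "w1 m \<theta> \<in> L m" if "\<theta> \<in> Delta m N" for m \<theta> using hom_closed[OF w1, of \<theta> m] that by simp
    have w2B: "w2 m \<theta> \<in> simplices B m" if "\<theta> \<in> Delta m N" for m \<theta> using hom_closed[OF w2, of \<theta> m] that by simp
    define w where "w = (\<lambda>m. \<lambda>\<theta>\<in>Delta m N. (fst (w1 m \<theta>), w2 m \<theta> # snd (w1 m \<theta>)))"
    have wG: "w m \<theta> \<in> ?G m" if "\<theta> \<in> Delta m N" for m \<theta>
      using w1L[OF that] w2B[OF that] w2v'[OF that] that by (simp add: w_def)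
    show ?thesis
    proof (intro bexI conjI)
      show "w \<in> hom (std_simplex N) ?P"
      proof (rule homI)
        show "w l (act (std_simplex N) l m \<phi> \<theta>) = act ?P l m \<phi> (w m \<theta>)"
          if \<phi>: "\<phi> \<in> Delta l m" and \<theta>: "\<theta> \<in> simplices (std_simplex N) m" for l m \<phi> \<theta>
          using hom_nat[OF w1 \<phi> \<theta>] hom_nat[OF w2 \<phi> \<theta>] \<theta> Delta_comp[OF _ \<phi>, of \<theta> N]
          by (cases "w1 m \<theta>") (simp add: w_def)
      qed (use wG in \<open>auto simp: w_def\<close>)
      show "smap_restrict w ?H = u"
      proof (rule smap_eqI[where X = ?H])
        show "smap_restrict w ?H m \<in> extensional (simplices ?H m)" for m by (simp only: smap_restrict_def restrict_extensional)
        show "u m \<in> extensional (simplices ?H m)" for m by (rule hom_ext[OF u])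
        show "smap_restrict w ?H m \<theta> = u m \<theta>" if "\<theta> \<in> simplices ?H m" for m \<theta>
          using split(5)[OF uG[OF that]] that HD[OF that] by (simp add: smap_restrict_def w_def w1u' w2u')
      qed
      show "smap_comp (std_simplex N) (base ?G) w = v"
      proof (rule smap_eqI[where X = "std_simplex N", OF smap_comp_ext hom_ext[OF v]])
        fix m \<theta> assume \<theta>: "\<theta> \<in> simplices (std_simplex N) m"
        then show "smap_comp (std_simplex N) (base ?G) w m \<theta> = v m \<theta>"
          using wG[of \<theta> m] w1L[of \<theta> m] w1v'[of \<theta> m] by (simp add: smap_comp_apply base_def w_def del: grow_iff)
      qed
    qed
  qed
  then show ?thesis
    unfolding kan_fibration_def using P qG std_simplex_sset by blast
qed

section \<open>Labelled stages and their prescribed values over the horn\<close>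

text \<open>The simplex of \<open>M\<close> reached from \<open>u\<close> by descending along the
  list. Over the horn this is the value that the final coalgebra map is bound to take; elsewhere it
  carries no information.\<close>

fun node :: "('m, ('a, 'b, 'm \<times> 'b) dprod_simplex) smap \<Rightarrow> (nat \<Rightarrow> nat, 'm) smap \<Rightarrow> nat \<Rightarrow> 'b cell \<Rightarrow> 'm" where
  "node \<mu> u m (\<theta>, []) = u m \<theta>"
| "node \<mu> u m (\<theta>, b # bs) = child \<mu> m (node \<mu> u m (\<theta>, bs)) b"

text \<open>The invariant of the tower. Over the horn \<open>a\<close> has to be the root of the
  prescribed value, so that the lists of the next stage index actual children of it.\<close>

definition stage :: "'b sset \<Rightarrow> 'a sset \<Rightarrow> 'm sset \<Rightarrow> ('m, ('a, 'b, 'm \<times> 'b) dprod_simplex) smap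
    \<Rightarrow> nat \<Rightarrow> nat \<Rightarrow> (nat \<Rightarrow> nat, 'm) smap \<Rightarrow> nat \<Rightarrow> (nat \<Rightarrow> 'b cell set) \<times> ('b cell, 'a) smap \<Rightarrow> bool" where
  "stage B A M \<mu> n k u i = (\<lambda>(L, a).
     (\<forall>m. \<forall>x\<in>L m. length (snd x) = i) \<and> kan_fibration (paths B L) (std_simplex n) (base L) \<and>
     (\<forall>m. \<forall>x\<in>L m. fst x \<in> simplices (horn n k) m \<longrightarrow> node \<mu> u m x \<in> simplices M m \<and> a m x = root \<mu> m (node \<mu> u m x) \<and>
       (\<forall>l. \<forall>\<phi>\<in>Delta l m. node \<mu> u l (path_act B l m \<phi> x) = act M l m \<phi> (node \<mu> u m x))) \<and>
     a \<in> hom (paths B L) A)"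

text \<open>The only choice at a given stage is the labelling; \<open>kan_extend_over_horn\<close>
  makes it, with the roots of the \<open>node\<close> values prescribed over the horn.\<close>

lemma stage_exists:
  assumes B: "simplicial_set B" and A: "kan_complex A" and f: "f \<in> hom B A" and M: "coalgebra B A f M \<mu>"
    and n: "n \<ge> 1" "k \<le> n"
    and len: "\<And>m x. x \<in> L m \<Longrightarrow> length (snd x) = i"
    and q: "kan_fibration (paths B L) (std_simplex n) (base L)"
    and node: "\<And>m x. \<lbrakk>x \<in> L m; fst x \<in> simplices (horn n k) m\<rbrakk> \<Longrightarrow> node \<mu> u m x \<in> simplices M m"
      "\<And>l m \<phi> x. \<lbrakk>x \<in> L m; fst x \<in> simplices (horn n k) m; \<phi> \<in> Delta l m\<rbrakk> \<Longrightarrow>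
        node \<mu> u l (path_act B l m \<phi> x) = act M l m \<phi> (node \<mu> u m x)"
  shows "\<exists>a. stage B A M \<mu> n k u i (L, a)"
proof -
  have A': "simplicial_set A" using A by (simp add: kan_complex_def)
  obtain a where a: "a \<in> hom (paths B L) A"
    "\<And>m x. \<lbrakk>x \<in> simplices (paths B L) m; base L m x \<in> simplices (horn n k) m\<rbrakk> \<Longrightarrow> a m x = root \<mu> m (node \<mu> u m x)"
  proof (rule kan_extend_over_horn[OF q A n, where g = "\<lambda>m x. root \<mu> m (node \<mu> u m x)"])
    show "root \<mu> m (node \<mu> u m x) \<in> simplices A m"
      if "x \<in> simplices (paths B L) m" "base L m x \<in> simplices (horn n k) m" for m x
      using root_closed[OF B A' f M] node(1)[of x m] that by (simp add: base_def)
    show "root \<mu> l (node \<mu> u l (act (paths B L) l m \<theta> x)) = act A l m \<theta> (root \<mu> m (node \<mu> u m x))"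
      if "x \<in> simplices (paths B L) m" "base L m x \<in> simplices (horn n k) m" "\<theta> \<in> Delta l m" for l m \<theta> x
      using root_nat[OF B A' f M] node[of x m] that by (simp add: base_def paths_def)
  qed (rule that)
  have "stage B A M \<mu> n k u i (L, a)"
    using len q node a by (auto simp: stage_def base_def)
  then show ?thesis by (rule exI[of _ a])
qed

lemma path_tower:
  assumes f: "kan_fibration B A f" and A: "kan_complex A" and M: "coalgebra B A f M \<mu>"
    and n: "n \<ge> 1" "k \<le> n" and u: "u \<in> hom (horn n k) M"
  obtains st where "fst (st 0) = (\<lambda>m. {(\<theta>, []) |\<theta>. \<theta> \<in> Delta m n})"
    "\<And>i. fst (st (Suc i)) = grow B f (fst (st i)) (snd (st i))" "\<And>i. stage B A M \<mu> n k u i (st i)"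
proof -
  have B: "simplicial_set B" and fh: "f \<in> hom B A" using f by (auto simp: kan_fibration_def)
  have A': "simplicial_set A" using A by (simp add: kan_complex_def)
  let ?L0 = "\<lambda>m. {(\<theta>, []) |\<theta>. \<theta> \<in> Delta m n}"
  \<comment> \<open>The bottom stage is fixed inside the invariant, because dependent choice gives
    no other hold on \<open>st 0\<close>.\<close>
  define P where "P i s \<longleftrightarrow> stage B A M \<mu> n k u i s \<and> (i = 0 \<longrightarrow> fst s = ?L0)" for i s
  have hn: "u l (compose {..l} \<theta> \<phi>) = act M l m \<phi> (u m \<theta>)"
    if "\<theta> \<in> simplices (horn n k) m" "\<phi> \<in> Delta l m" for l m \<theta> \<phi>
    using hom_nat[OF u that(2,1)] by (simp add: horn_simps(2))
  have "\<exists>a. stage B A M \<mu> n k u 0 (?L0, a)"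
    by (rule stage_exists[OF B A fh M n _ base_fibration_trivial])
      (auto simp: path_act_def hom_closed[OF u] hn)
  then have 0: "\<exists>s. P 0 s" by (auto simp: P_def)
  have step: "\<exists>s'. P (Suc i) s' \<and> fst s' = grow B f (fst s) (snd s)" if s: "P i s" for i s
  proof -
    obtain L a where La: "s = (L, a)" by fastforce
    have st: "stage B A M \<mu> n k u i (L, a)" using s by (simp add: P_def La)
    then have q: "kan_fibration (paths B L) (std_simplex n) (base L)" and a: "a \<in> hom (paths B L) A"
      and len: "\<And>m x. x \<in> L m \<Longrightarrow> length (snd x) = i"
      by (auto simp: stage_def)
    have nd: "node \<mu> u m x \<in> simplices M m" "a m x = root \<mu> m (node \<mu> u m x)"
      "\<And>l \<phi>. \<phi> \<in> Delta l m \<Longrightarrow> node \<mu> u l (path_act B l m \<phi> x) = act M l m \<phi> (node \<mu> u m x)"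
      if "x \<in> L m" "fst x \<in> simplices (horn n k) m" for m x
      using st that unfolding stage_def prod.case by blast+
    have "\<exists>a'. stage B A M \<mu> n k u (Suc i) (grow B f L a, a')"
    proof (rule stage_exists[OF B A fh M n _ base_fibration_grow[OF f q a]])
      show "length (snd x) = Suc i" if "x \<in> grow B f L a m" for m x
        using that len by (cases x) fastforce
    next
      fix m x assume "x \<in> grow B f L a m" and h: "fst x \<in> simplices (horn n k) m"
      then obtain \<theta> b bs where x: "x = (\<theta>, b # bs)" "(\<theta>, bs) \<in> L m" "b \<in> simplices B m" "a m (\<theta>, bs) = f m b"
        by (cases x) auto
      have h': "fst (\<theta>, bs) \<in> simplices (horn n k) m" using h x(1) by simp
      \<comment> \<open>Over the horn the label is the root of the node, so the equation in
        \<open>grow\<close> says that \<open>b\<close> lies in the fibre where the node has a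
        child.\<close>
      show "node \<mu> u m x \<in> simplices M m"
        using child_closed[OF B A' fh M nd(1)[OF x(2) h'] x(3)] nd(2)[OF x(2) h'] x by simp
      show "node \<mu> u l (path_act B l m \<phi> x) = act M l m \<phi> (node \<mu> u m x)" if \<phi>: "\<phi> \<in> Delta l m" for l \<phi>
        using child_nat[OF B A' fh M nd(1)[OF x(2) h'] x(3) _ \<phi>] nd(2)[OF x(2) h'] nd(3)[OF x(2) h' \<phi>] x
        by (simp add: path_act_def)
    qed
    then show ?thesis by (auto simp: P_def La)
  qed
  obtain st where st: "\<And>i. P i (st i)" "\<And>i. fst (st (Suc i)) = grow B f (fst (st i)) (snd (st i))"
    using dependent_nat_choice[of P "\<lambda>_ s s'. fst s' = grow B f (fst s) (snd s)", OF 0 step] by blast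
  then show thesis using that[of st] by (auto simp: P_def)
qed

section \<open>The horn filler from finality\<close>

theorem theorem3p6:
  fixes A :: "'a sset" and B :: "'b sset" and f :: "('b, 'a) smap"
    and M :: "'m sset" and \<mu> :: "('m, ('a, 'b, 'm \<times> 'b) dprod_simplex) smap"
  assumes "kan_complex A" and "kan_complex B" and "kan_fibration B A f"
    and "M_type B A f M \<mu>"
  shows "kan_complex M"
proof -
  have B: "simplicial_set B" and f: "f \<in> hom B A" using assms(3) by (auto simp: kan_fibration_def)
  have A: "simplicial_set A" using assms(1) by (simp add: kan_complex_def)
  \<comment> \<open>Finality is needed on the type of the tower, whereas \<open>M_type\<close> tests
    the types of \<open>M\<close> and of trees; \<open>M_type_final\<close> transfers it.\<close>
  have fin: "final_coalgebra TYPE('b cell) B A f M \<mu>" by (rule M_type_final[OF B A f assms(4)])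
  then have M: "coalgebra B A f M \<mu>" by (simp add: final_coalgebra_def)
  then have M': "simplicial_set M" by (simp add: coalgebra_def)
  have "\<exists>w\<in>hom (std_simplex n) M. smap_restrict w (horn n k) = u"
    if n: "n \<ge> 1" "k \<le> n" and u: "u \<in> hom (horn n k) M" for n k u
  proof -
    obtain st where st0: "fst (st 0) = (\<lambda>m. {(\<theta>, []) |\<theta>. \<theta> \<in> Delta m n})"
      and stS: "\<And>i. fst (st (Suc i)) = grow B f (fst (st i)) (snd (st i))"
      and st: "\<And>i. stage B A M \<mu> n k u i (st i)"
      using path_tower[OF assms(3,1) M n u] by blast
    define L where "L i = fst (st i)" for i
    \<comment> \<open>The length of the list tells the stage, so one function carries all labels,
      and the plain union \<open>D\<close> below is a disjoint one.\<close>
    define r where "r m x = snd (st (length (snd x))) m x" for m x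
    define D where "D m = (\<Union>i. L i m)" for m
    let ?X = "paths B D"
    have st': "stage B A M \<mu> n k u i (L i, snd (st i))" for i using st by (simp add: L_def)
    have len: "length (snd x) = i" if "x \<in> L i m" for i m x
      using st'[of i] that by (auto simp: stage_def)
    have q: "kan_fibration (paths B (L i)) (std_simplex n) (base (L i))" and ah: "snd (st i) \<in> hom (paths B (L i)) A" for i
      using st'[of i] by (auto simp: stage_def)
    have Ls: "simplicial_set (paths B (L i))" for i using q[of i] by (simp add: kan_fibration_def)
    have DL: "x \<in> L (length (snd x)) m" if x: "x \<in> D m" for x m
    proof -
      obtain i where i: "x \<in> L i m" using x unfolding D_def by blast
      then show ?thesis using len[OF i] by simp
    qed
    have act_eq: "act ?X = act (paths B (L i))" for i by (simp add: paths_def)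
    have X: "simplicial_set ?X"
      unfolding simplicial_set_def
    proof (intro conjI allI ballI)
      show "act ?X m l \<phi> x \<in> simplices ?X m" if "\<phi> \<in> Delta m l" "x \<in> simplices ?X l" for m l \<phi> x
        using act_closed[OF Ls that(1), of x "length (snd x)"] DL that
        by (auto simp: act_eq[of "length (snd x)"] D_def)
      show "act ?X m m (restrict id {..m}) x = x" if "x \<in> simplices ?X m" for m x
        unfolding act_eq[of "length (snd x)"] using act_id[OF Ls] DL that by simp
      show "act ?X j m (compose {..j} \<theta> \<phi>) x = act ?X j l \<phi> (act ?X l m \<theta> x)"
        if "\<phi> \<in> Delta j l" "\<theta> \<in> Delta l m" "x \<in> simplices ?X m" for j l m \<phi> \<theta> x
        unfolding act_eq[of "length (snd x)"] using act_comp[OF Ls that(1,2)] DL that by simp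
    qed
    have len_act: "length (snd (act ?X l m \<phi> x)) = length (snd x)" for l m \<phi> x by (cases x) simp
    have r: "r m x \<in> simplices A m" if "x \<in> simplices ?X m" for m x
      using hom_closed[OF ah] DL that by (simp add: r_def)
    have rn: "r l (act ?X l m \<phi> x) = act A l m \<phi> (r m x)" if "x \<in> simplices ?X m" "\<phi> \<in> Delta l m" for l m \<phi> x
      unfolding r_def len_act using hom_nat[OF ah that(2), of x "length (snd x)"] DL that(1)
      by (simp add: act_eq[of "length (snd x)"])
    \<comment> \<open>Consing leads to the next stage, because \<open>r m x = f m b\<close> is the
      equation that defines \<open>grow\<close>.\<close>
    define c where "c m x b = (fst x, b # snd x)" for m :: nat and x :: "'b cell" and b
    have cX: "c m x b \<in> simplices ?X m" if "x \<in> simplices ?X m" "b \<in> simplices B m" "r m x = f m b" for m x b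
    proof -
      have "c m x b \<in> L (Suc (length (snd x))) m"
        using DL[of x m] that unfolding L_def stS c_def r_def by simp
      then show ?thesis unfolding D_def paths_simps by blast
    qed
    have cn: "c l (act ?X l m \<phi> x) (act B l m \<phi> b) = act ?X l m \<phi> (c m x b)" for l m \<phi> x b
      by (cases x) (simp add: c_def)
    have XD: "fst x \<in> Delta m n" if "x \<in> D m" for m x
      using q[of "length (snd x)"] hom_closed[of "base (L (length (snd x)))" _ _ x m] DL[OF that]
      by (fastforce simp: kan_fibration_def base_def)
    let ?\<alpha> = "coalg B A f ?X r c"
    have Xc: "coalgebra B A f ?X ?\<alpha>"
      by (rule coalg_coalgebra[OF B A f X r rn cX cn])
    \<comment> \<open>Closed under children, since these keep the underlying simplex of
      Delta[n].\<close>
    define K where "K m = {x \<in> D m. fst x \<in> simplices (horn n k) m}" for m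
    let ?K = "paths B K"
    have actK: "act ?K = act ?X" by (simp add: paths_def)
    have KD: "x \<in> D m" if "x \<in> K m" for m x using that by (simp add: K_def)
    have Kact: "act ?X l m \<phi> x \<in> K l" if "x \<in> K m" "\<phi> \<in> Delta l m" for l m \<phi> x
      using that act_closed[OF X that(2), of x] act_closed[OF horn_sset that(2), of "fst x"]
      by (cases x) (auto simp: K_def horn_simps(2))
    have Ks: "simplicial_set ?K"
      unfolding simplicial_set_def actK using Kact KD act_id[OF X] act_comp[OF X] by simp
    have Kc: "coalgebra B A f ?K (coalg B A f ?K r c)"
    proof (rule coalg_coalgebra[OF B A f Ks])
      show "c m x b \<in> simplices ?K m" if "x \<in> simplices ?K m" "b \<in> simplices B m" "r m x = f m b" for m x b
        using cX[of x m b] that by (simp add: K_def) (simp add: c_def)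
    qed (use r rn cn KD in \<open>simp_all add: actK\<close>)
    obtain h where h: "h \<in> coalgebra_hom B A f ?X ?\<alpha> M \<mu>"
      using fin Xc unfolding final_coalgebra_def by blast
    then have hh: "h \<in> hom ?X M" by (simp add: coalgebra_hom_iff[OF B A f])
    have iffX: "h \<in> coalgebra_hom B A f ?X ?\<alpha> M \<mu> \<longleftrightarrow>
        (\<forall>m. \<forall>x\<in>simplices ?X m. root \<mu> m (h m x) = r m x \<and>
          (\<forall>b\<in>simplices B m. r m x = f m b \<longrightarrow> child \<mu> m (h m x) b = h m (c m x b)))"
      by (rule coalg_hom_iff[OF B A f Xc M hh rn])
    have hD: "root \<mu> m (h m x) = r m x"
        "\<And>b. \<lbrakk>b \<in> simplices B m; r m x = f m b\<rbrakk> \<Longrightarrow> child \<mu> m (h m x) b = h m (c m x b)"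
      if "x \<in> D m" for m x
      using h that unfolding iffX by auto
    have nd: "node \<mu> u m x \<in> simplices M m" "r m x = root \<mu> m (node \<mu> u m x)"
      "\<And>l \<phi>. \<phi> \<in> Delta l m \<Longrightarrow> node \<mu> u l (path_act B l m \<phi> x) = act M l m \<phi> (node \<mu> u m x)"
      if "x \<in> K m" for m x
      using st'[of "length (snd x)"] DL[OF KD[OF that]] that unfolding stage_def K_def r_def prod.case by blast+
    \<comment> \<open>Two coalgebra maps out of the part over the horn: the restriction of
      \<open>h\<close>, and the values obtained by descending from \<open>u\<close>.\<close>
    let ?h = "smap_restrict h ?K" and ?g = "smap_restrict (node \<mu> u) ?K"
    have hK: "?h \<in> hom ?K M"
      by (rule homI) (use hom_closed[OF hh] hom_nat[OF hh] Kact KD in \<open>simp_all add: smap_restrict_def actK\<close>)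
    have gK: "?g \<in> hom ?K M"
    proof (rule homI)
      show "?g l (act ?K l m \<phi> x) = act M l m \<phi> (?g m x)" if "\<phi> \<in> Delta l m" "x \<in> simplices ?K m" for l m \<phi> x
        using nd(3)[of x m \<phi> l] Kact[of x m \<phi> l] that unfolding actK by (simp add: smap_restrict_def) (simp add: paths_def)
    qed (use nd in \<open>simp_all add: smap_restrict_def\<close>)
    have cK: "c m x b \<in> K m" if "x \<in> K m" "b \<in> simplices B m" "r m x = f m b" for m x b
      using cX[of x m b] that by (simp add: K_def) (simp add: c_def)
    have rK: "r l (act ?K l m \<phi> x) = act A l m \<phi> (r m x)" if "x \<in> simplices ?K m" "\<phi> \<in> Delta l m" for l m \<phi> x
      using rn that KD by (simp add: actK)
    have iffK: "j \<in> coalgebra_hom B A f ?K (coalg B A f ?K r c) M \<mu> \<longleftrightarrow>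
        (\<forall>m. \<forall>x\<in>simplices ?K m. root \<mu> m (j m x) = r m x \<and>
          (\<forall>b\<in>simplices B m. r m x = f m b \<longrightarrow> child \<mu> m (j m x) b = j m (c m x b)))"
      if "j \<in> hom ?K M" for j
      by (rule coalg_hom_iff[OF B A f Kc M that rK])
    have "?h \<in> coalgebra_hom B A f ?K (coalg B A f ?K r c) M \<mu>"
      unfolding iffK[OF hK] using hD KD cK by (simp add: smap_restrict_def)
    moreover have "?g \<in> coalgebra_hom B A f ?K (coalg B A f ?K r c) M \<mu>"
      unfolding iffK[OF gK]
    proof (intro allI ballI conjI impI)
      fix m x assume x: "x \<in> simplices ?K m"
      show "root \<mu> m (?g m x) = r m x" using nd(2)[of x m] x by (simp add: smap_restrict_def)
      show "child \<mu> m (?g m x) b = ?g m (c m x b)" if "b \<in> simplices B m" "r m x = f m b" for b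
        using cK[OF _ that] x by (cases x) (simp add: smap_restrict_def c_def)
    qed
    ultimately have hg: "?h = ?g" using fin Kc unfolding final_coalgebra_def by blast
    have start: "(\<theta>, []) \<in> D m" if "\<theta> \<in> Delta m n" for m \<theta>
      using that st0 unfolding D_def L_def by (intro UN_I[of 0]) auto
    \<comment> \<open>The filler is \<open>h\<close> on the bottom stage, which is a copy of
      Delta[n].\<close>
    let ?w = "\<lambda>m. \<lambda>\<theta>\<in>Delta m n. h m (\<theta>, [])"
    show ?thesis
    proof
      show "?w \<in> hom (std_simplex n) M"
      proof (rule homI)
        show "?w m \<theta> \<in> simplices M m" if "\<theta> \<in> simplices (std_simplex n) m" for m \<theta>
          using hom_closed[OF hh, of "(\<theta>, [])" m] start that by simp
        show "?w l (act (std_simplex n) l m \<phi> \<theta>) = act M l m \<phi> (?w m \<theta>)"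
          if "\<phi> \<in> Delta l m" "\<theta> \<in> simplices (std_simplex n) m" for l m \<phi> \<theta>
          using hom_nat[OF hh that(1), of "(\<theta>, [])"] start that by (simp add: Delta_comp)
      qed simp
      show "smap_restrict ?w (horn n k) = u"
      proof (rule smap_eqI[where X = "horn n k"])
        show "smap_restrict ?w (horn n k) m \<in> extensional (simplices (horn n k) m)" for m by (simp only: smap_restrict_def restrict_extensional)
        show "u m \<in> extensional (simplices (horn n k) m)" for m by (rule hom_ext[OF u])
        fix m \<theta> assume \<theta>: "\<theta> \<in> simplices (horn n k) m"
        then have \<theta>': "\<theta> \<in> Delta m n" by (simp add: horn_simps)
        have "(\<theta>, []) \<in> K m" using start[OF \<theta>'] \<theta> by (simp add: K_def)
        then have "h m (\<theta>, []) = u m \<theta>"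
          using fun_cong[OF fun_cong[OF hg, of m], of "(\<theta>, [])"] by (simp add: smap_restrict_def)
        then show "smap_restrict ?w (horn n k) m \<theta> = u m \<theta>" using \<theta> \<theta>' by (simp add: smap_restrict_def)
      qed
    qed
  qed
  then show ?thesis using M' by (simp add: kan_complex_def)
qed

end
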